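(* Let $k\ge 2$ and let $x=(x_1,\dots,x_k)\in\mathbb{R}^k$ satisfy $1+x_k>x_1>x_2>\cdots>x_k$. Let $B_1,\dots,B_k$ be independent standard one-dimensional Brownian motions started at $x_1,\dots,x_k$ respectively (law $\mathbb{P}_x$), and let $\xi_n=e^{i2\pi B_n}$, $1\le n\le k$, be their projections onto the circle. For $i<j$ put $T_{ij}=\inf\{t:B_i(t)=B_j(t)\}$, $\widetilde T_{ij}=\inf\{t:\xi_i(t)=\xi_j(t)\}$, and let $\widetilde T=\min_{1\le i<j\le k}\widetilde T_{ij}$. Then for every $t\ge 0$: (i) If $k$ is even, then $$\mathbb{P}_x(\widetilde T>t)=\mathrm{Pf}(\widetilde p_{ij})_{i,j\in[k]},$$ where for $i<j$, $\widetilde p_{ij}=\mathbb{P}_x(\widetilde T_{ij}>t)$ and $\widetilde p_{ji}=-\widetilde p_{ij}$. (ii) If $k$ is odd, then $$\mathbb{P}_x(\widetilde T>t)=\sum_{l=1}^k(-1)^{l+1}\,\mathrm{Pf}(q_{ij})_{i,j\in[k]\setminus\{l\}},$$ where for $i<j$, $q_{ij}=\mathbb{P}_x(\widetilde T_{ij}>t)+2\,\mathbb{P}_x(\widetilde T_{ij}\le t,\ \widetilde T_{ij}<T_{ij})$ and $q_{ji}=-q_{ij}$.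
   Context: $[k]=\{1,\dots,k\}$. $\mathrm{Pf}$ denotes the Pfaffian of a skew-symmetric matrix (zero diagonal) of even size $n$ indexed by an ordered set: $\mathrm{Pf}(a_{ij})=\sum_{\pi}(-1)^{c(\pi)}\prod_{\{i<j\}\in\pi}a_{ij}$, the sum running over partitions $\pi$ of the index set into pairs, where $c(\pi)$ is the number of crossings of $\pi$ (pairs of blocks $\{i<j\},\{i'<j'\}$ with $i<i'<j<j'$). *)

theory Defs
  imports "HOL-Probability.Probability"
begin

text \<open>Only times \<open>t \<ge> 0\<close> matter. All paths (not just almost all) are continuous, so that the meeting
  events below are measurable without completing \<open>M\<close>.\<close>

definition brownian_motion :: "'a measure \<Rightarrow> real \<Rightarrow> (real \<Rightarrow> 'a \<Rightarrow> real) \<Rightarrow> bool" where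
  "brownian_motion M x B \<longleftrightarrow>
     prob_space M \<and>
     (\<forall>t\<ge>0. B t \<in> borel_measurable M) \<and>
     (AE \<omega> in M. B 0 \<omega> = x) \<and>
     (\<forall>s t. 0 \<le> s \<and> s < t \<longrightarrow>
        distributed M lborel (\<lambda>\<omega>. B t \<omega> - B s \<omega>) (normal_density 0 (sqrt (t - s)))) \<and>
     (\<forall>(m::nat) \<tau>. 0 \<le> \<tau> 0 \<and> strict_mono_on {..m} \<tau> \<longrightarrow>
        prob_space.indep_vars M (\<lambda>_. borel) (\<lambda>n \<omega>. B (\<tau> (Suc n)) \<omega> - B (\<tau> n) \<omega>) {..<m}) \<and>
     (\<forall>\<omega>\<in>space M. continuous_on {0..} (\<lambda>t. B t \<omega>))"

text \<open>Joint independence of whole paths, not merely of the values at each fixed time.\<close>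

definition independent_processes ::
    "'a measure \<Rightarrow> nat set \<Rightarrow> (nat \<Rightarrow> real \<Rightarrow> 'a \<Rightarrow> real) \<Rightarrow> bool" where
  "independent_processes M I B \<longleftrightarrow>
     prob_space.indep_vars M (\<lambda>_. \<Pi>\<^sub>M t\<in>{0..}. borel) (\<lambda>n \<omega>. \<lambda>t\<in>{0..}. B n t \<omega>) I"

definition circle_proj :: "(nat \<Rightarrow> real \<Rightarrow> 'a \<Rightarrow> real) \<Rightarrow> nat \<Rightarrow> real \<Rightarrow> 'a \<Rightarrow> complex" where
  "circle_proj B n t \<omega> = exp (\<i> * 2 * pi * B n t \<omega>)"

text \<open>Values in \<open>ereal\<close>, where the infimum of the empty set is \<open>\<infinity>\<close>.\<close>

definition meeting_time :: "(nat \<Rightarrow> real \<Rightarrow> 'a \<Rightarrow> 'b) \<Rightarrow> nat \<Rightarrow> nat \<Rightarrow> 'a \<Rightarrow> ereal" where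
  "meeting_time X i j \<omega> = Inf (ereal ` {t. 0 \<le> t \<and> X i t \<omega> = X j t \<omega>})"

definition first_meeting_time :: "nat \<Rightarrow> (nat \<Rightarrow> real \<Rightarrow> 'a \<Rightarrow> 'b) \<Rightarrow> 'a \<Rightarrow> ereal" where
  "first_meeting_time k X \<omega> = Min {meeting_time X i j \<omega> | i j. 1 \<le> i \<and> i < j \<and> j \<le> k}"

definition pair_partitions :: "'i set \<Rightarrow> 'i set set set" where
  "pair_partitions I = {\<pi>. partition_on I \<pi> \<and> (\<forall>b\<in>\<pi>. card b = 2)}"

text \<open>A block \<open>{i < j}\<close> is recovered from \<open>b\<close> as \<open>i = Min b\<close>, \<open>j = Max b\<close>. Each crossing is counted
  once, since the inequalities fix the order of the two blocks.\<close>

definition crossings :: "'i::linorder set set \<Rightarrow> nat" where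
  "crossings \<pi> = card {(b, c). b \<in> \<pi> \<and> c \<in> \<pi> \<and> Min b < Min c \<and> Min c < Max b \<and> Max b < Max c}"

definition pfaffian :: "'i::linorder set \<Rightarrow> ('i \<Rightarrow> 'i \<Rightarrow> real) \<Rightarrow> real" where
  "pfaffian I a = (\<Sum>\<pi>\<in>pair_partitions I. (-1) ^ crossings \<pi> * (\<Prod>b\<in>\<pi>. a (Min b) (Max b)))"

definition skew :: "('i::linorder \<Rightarrow> 'i \<Rightarrow> real) \<Rightarrow> 'i \<Rightarrow> 'i \<Rightarrow> real" where
  "skew a i j = (if i < j then a i j else if j < i then - a j i else 0)"

definition p_entry :: "'a measure \<Rightarrow> (nat \<Rightarrow> real \<Rightarrow> 'a \<Rightarrow> real) \<Rightarrow> real \<Rightarrow> nat \<Rightarrow> nat \<Rightarrow> real" where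
  "p_entry M B t = skew (\<lambda>i j. \<P>(\<omega> in M. meeting_time (circle_proj B) i j \<omega> > ereal t))"

definition q_entry :: "'a measure \<Rightarrow> (nat \<Rightarrow> real \<Rightarrow> 'a \<Rightarrow> real) \<Rightarrow> real \<Rightarrow> nat \<Rightarrow> nat \<Rightarrow> real" where
  "q_entry M B t = skew (\<lambda>i j.
     \<P>(\<omega> in M. meeting_time (circle_proj B) i j \<omega> > ereal t)
     + 2 * \<P>(\<omega> in M. meeting_time (circle_proj B) i j \<omega> \<le> ereal t
             \<and> meeting_time (circle_proj B) i j \<omega> < meeting_time B i j \<omega>))"

end

theory Submission
  imports Defs
begin

text \<open>For a bounded function \<open>\<theta>\<close> on the line, the Pfaffian of the numbers \<open>\<theta> (y\<^sub>i - y\<^sub>j)\<close> is a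
  combination of products over disjoint pairs, so for independent Brownian motions its backward heat
  flow is the Pfaffian of the pairwise flows. Let \<open>\<theta> = 1\<close> on \<open>(0, 1)\<close> be odd and satisfy
  \<open>\<theta> (z + 1) = \<alpha> \<theta> z + \<beta>\<close>: the square wave (\<open>\<alpha> = -1\<close>, \<open>\<beta> = 0\<close>) for even \<open>k\<close>, the staircase
  \<open>2 \<lfloor>z\<rfloor> + 1\<close> (\<open>\<alpha> = 1\<close>, \<open>\<beta> = 2\<close>) for odd \<open>k\<close>, where the alternating sum of Pfaffians is one Pfaffian
  bordered by ones. When two particles meet on the circle, a row becomes a combination of another row
  and the border, and the Pfaffian vanishes; before that, the terminal value is the Pfaffian of ones,
  which is 1. Optional stopping at the first meeting therefore identifies the Pfaffian with the
  survival probability. For two particles the same argument identifies the entries.\<close>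

section \<open>Pfaffians\<close>

text \<open>Oddness and the value 1 on (0, 1) force \<beta> = 1 + \<alpha>. Without a border the
  constant must be absent, which leaves \<alpha> = -1; with a border, the border column has equal
  entries in both rows and forces \<alpha> = 1, hence \<beta> = 2. Only gaps 0 and 1 have to be
  considered at the first meeting, because all gaps start in (0, 1) and move continuously. For two
  particles with the staircase there is no border and the exit term survives: this is the origin of
  the weight 2 in q. The stopping argument meets two obstacles. Brownian motion is specified through
  finitely many increments, whereas survival concerns the whole path; it is recovered from dyadic
  grids on which a fixed positive lower bound holds. Moreover \<theta> jumps at the integers,
  exactly where meetings take place, so the heat flow is continuous at a meeting only while time
  remains; a meeting at the final time itself is discarded as a null event.\<close>

definition crosses :: "'i::linorder set \<Rightarrow> 'i set \<Rightarrow> bool" where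
  "crosses b c \<longleftrightarrow> Min b < Min c \<and> Min c < Max b \<and> Max b < Max c"

text \<open>\<open>crossings\<close> counts ordered pairs of blocks, the one that starts first in
  front. Testing both orders makes the sign usable without knowing which block starts first.\<close>

definition cross_sign :: "'i::linorder set \<Rightarrow> 'i set \<Rightarrow> real" where
  "cross_sign b c = (if crosses b c \<or> crosses c b then -1 else 1)"

lemma prod_if_minus_one:
  assumes "finite S"
  shows "(\<Prod>x\<in>S. if P x then -1 else 1 :: real) = (-1) ^ card {x\<in>S. P x}"
proof -
  have "(\<Prod>x\<in>S. if P x then -1 else 1 :: real) = (\<Prod>x\<in>S \<inter> {x. P x}. -1) * (\<Prod>x\<in>S \<inter> - {x. P x}. 1)"
    by (rule prod.If_cases[OF assms])
  also have "S \<inter> {x. P x} = {x\<in>S. P x}" by auto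
  finally show ?thesis by simp
qed

text \<open>The crossings of the larger partition are those inside \<rho> and those that involve
  \<open>P\<close>; the parity of the latter is a product of signs over the blocks of
  \<rho>.\<close>

lemma sign_crossings_insert:
  assumes "finite \<rho>" "P \<notin> \<rho>"
  shows "(-1) ^ crossings (insert P \<rho>) = (-1) ^ crossings \<rho> * (\<Prod>f\<in>\<rho>. cross_sign P f)"
proof -
  let ?X = "{(b, c). b \<in> \<rho> \<and> c \<in> \<rho> \<and> crosses b c}"
  let ?Y = "{f\<in>\<rho>. crosses P f \<or> crosses f P}"
  \<comment> \<open>A block cannot cross \<open>P\<close> in both directions, since the minima would
    be ordered both ways; \<open>?h\<close> picks the order that is counted.\<close>
  let ?h = "\<lambda>f. if crosses P f then (P, f) else (f, P)"
  have eq: "{(b, c). b \<in> insert P \<rho> \<and> c \<in> insert P \<rho> \<and> crosses b c} = ?X \<union> ?h ` ?Y"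
    by (auto simp: image_iff crosses_def)
  have fin: "finite ?X" by (rule finite_subset[of _ "\<rho> \<times> \<rho>"]) (use assms in auto)
  have inj: "inj_on ?h ?Y" using assms(2) by (auto simp: inj_on_def split: if_splits)
  have disj: "?X \<inter> ?h ` ?Y = {}" using assms(2) by (auto split: if_splits)
  have "crossings (insert P \<rho>) = card (?X \<union> ?h ` ?Y)"
    by (simp only: eq[symmetric] crossings_def) (simp only: crosses_def)
  also have "\<dots> = card ?X + card ?Y"
    using card_Un_disjoint[OF fin _ disj] assms(1) card_image[OF inj] by simp
  also have "card ?X = crossings \<rho>" by (simp add: crossings_def crosses_def)
  finally have "crossings (insert P \<rho>) = crossings \<rho> + card ?Y" .
  then show ?thesis
    unfolding cross_sign_def prod_if_minus_one[OF assms(1)] by (simp add: power_add)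
qed

definition inside_sign :: "'i::linorder set \<Rightarrow> 'i \<Rightarrow> real" where
  "inside_sign f p = (if Min f < p \<and> p < Max f then -1 else 1)"

lemma Min_Max_pair:
  "Min {p, q :: 'i::linorder} = min p q" "Max {p, q} = max p q"
  by auto

lemma cross_sign_commute: "cross_sign b c = cross_sign c b"
  by (auto simp: cross_sign_def)

text \<open>Two disjoint chords cross exactly when one end of the first lies inside the second and
  the other end outside. The sign therefore splits into one factor per end point, which turns
  products over blocks into products over points.\<close>

lemma cross_sign_pair:
  assumes "p \<noteq> q" "p \<notin> {u, v}" "q \<notin> {u, v}" "u \<noteq> v"
  shows "cross_sign {p, q} {u, v} = inside_sign {u, v} p * inside_sign {u, v} q"
proof -
  have gen: "cross_sign {p, q} {u, v} = inside_sign {u, v} p * inside_sign {u, v} q"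
    if "p < q" "u < v" "p \<notin> {u, v}" "q \<notin> {u, v}" for p q u v :: 'a
    using that
    by (cases "p < u"; cases "p < v"; cases "q < u"; cases "q < v")
       (auto simp: cross_sign_def inside_sign_def crosses_def Min_Max_pair min_def max_def
             not_less order.strict_iff_order)
  consider "p < q" "u < v" | "p < q" "v < u" | "q < p" "u < v" | "q < p" "v < u"
    using assms by (meson linorder_neqE)
  then show ?thesis
    using gen[of p q u v] gen[of p q v u] gen[of q p u v] gen[of q p v u] assms
    by cases (auto simp: insert_commute mult.commute)
qed

section \<open>Pair partitions and their recursion over the block of one point\<close>

lemma card_2_blockE:
  assumes "\<pi> \<in> pair_partitions I" "b \<in> \<pi>"
  obtains u v where "b = {u, v}" "u \<noteq> v" "u \<in> I" "v \<in> I"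
proof -
  have "card b = 2" "b \<subseteq> I"
    using assms by (auto simp: pair_partitions_def partition_on_def)
  then show ?thesis using that by (auto simp: card_2_iff)
qed

lemma pair_partitions_finite:
  assumes "finite I"
  shows "finite (pair_partitions I)" "\<pi> \<in> pair_partitions I \<Longrightarrow> finite \<pi>"
proof -
  have "pair_partitions I \<subseteq> Pow (Pow I)"
    by (auto simp: pair_partitions_def partition_on_def)
  then show "finite (pair_partitions I)"
    by (rule finite_subset) (use assms in auto)
  show "finite \<pi>" if "\<pi> \<in> pair_partitions I"
    using that finite_elements[OF assms] by (auto simp: pair_partitions_def)
qed

lemma insert_pair_partition:
  assumes "\<rho> \<in> pair_partitions (I - {m, j})" "m \<in> I" "j \<in> I" "m \<noteq> j"
  shows "insert {m, j} \<rho> \<in> pair_partitions I" "{m, j} \<notin> \<rho>"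
proof -
  have p: "partition_on (I - {m, j}) \<rho>" using assms(1) by (auto simp: pair_partitions_def)
  have "partition_on I (insert {m, j} \<rho>)"
    using p assms(2-4) by (auto simp: partition_on_def disjoint_def)
  then show "insert {m, j} \<rho> \<in> pair_partitions I"
    using assms(1,4) by (auto simp: pair_partitions_def)
  show "{m, j} \<notin> \<rho>" using p by (auto simp: partition_on_def)
qed

lemma pair_partitions_remove:
  assumes "\<pi> \<in> pair_partitions I" "{m, j} \<in> \<pi>"
  shows "\<pi> - {{m, j}} \<in> pair_partitions (I - {m, j})"
proof -
  have p: "partition_on I \<pi>" using assms(1) by (auto simp: pair_partitions_def)
  have "\<Union>(\<pi> - {{m, j}}) = I - {m, j}"
  proof (intro equalityI subsetI)
    fix z assume "z \<in> \<Union>(\<pi> - {{m, j}})"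
    then obtain b where b: "b \<in> \<pi>" "b \<noteq> {m, j}" "z \<in> b" by auto
    then have "b \<inter> {m, j} = {}" using p assms(2) by (metis disjointD partition_on_def)
    then show "z \<in> I - {m, j}" using b p by (auto simp: partition_on_def)
  qed (use p in \<open>auto simp: partition_on_def\<close>)
  then have "partition_on (I - {m, j}) (\<pi> - {{m, j}})"
    using p by (auto simp: partition_on_def disjoint_def)
  then show ?thesis using assms(1) by (auto simp: pair_partitions_def)
qed

text \<open>The block of \<open>m\<close> is {m, j} for exactly one \<open>j\<close>, and removing
  it leaves a partition of the rest. The index \<open>m\<close> is arbitrary and the signs stay
  inside \<open>g\<close>, so the same recursion serves for the smallest index and for the row of a
  meeting particle.\<close>

lemma sum_pair_partitions:
  assumes "finite I" "m \<in> I"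
  shows "(\<Sum>\<pi>\<in>pair_partitions I. g \<pi> :: real) =
    (\<Sum>j\<in>I - {m}. \<Sum>\<rho>\<in>pair_partitions (I - {m, j}). g (insert {m, j} \<rho>))"
proof -
  let ?S = "\<lambda>j. insert {m, j} ` pair_partitions (I - {m, j})"
  have inj: "inj_on (insert {m, j}) (pair_partitions (I - {m, j}))" if "j \<in> I - {m}" for j
    using that assms(2) insert_pair_partition(2)[of _ I m j]
    by (intro inj_onI) (metis DiffD1 DiffD2 insert_ident insertI1)
  have eq: "pair_partitions I = (\<Union>j\<in>I - {m}. ?S j)"
  proof (intro equalityI subsetI)
    fix \<pi> assume \<pi>: "\<pi> \<in> pair_partitions I"
    then have "m \<in> \<Union>\<pi>" using assms(2) by (auto simp: pair_partitions_def partition_on_def)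
    then obtain b where b: "b \<in> \<pi>" "m \<in> b" by auto
    obtain u v where "b = {u, v}" "u \<noteq> v" "u \<in> I" "v \<in> I"
      using \<pi> b(1) by (rule card_2_blockE)
    then obtain j where j: "b = {m, j}" "j \<noteq> m" "j \<in> I"
      using b(2) by (cases "m = u") (auto simp: insert_commute)
    then have "\<pi> = insert {m, j} (\<pi> - {{m, j}})" using b by auto
    moreover have "\<pi> - {{m, j}} \<in> pair_partitions (I - {m, j})"
      using pair_partitions_remove[OF \<pi>] b(1) j(1) by simp
    ultimately show "\<pi> \<in> (\<Union>j\<in>I - {m}. ?S j)" using j by blast
  next
    fix \<pi> assume "\<pi> \<in> (\<Union>j\<in>I - {m}. ?S j)"
    then obtain j \<rho> where "j \<in> I - {m}" "\<rho> \<in> pair_partitions (I - {m, j})" "\<pi> = insert {m, j} \<rho>"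
      by blast
    then show "\<pi> \<in> pair_partitions I"
      using insert_pair_partition(1)[of \<rho> I m j] assms(2) by auto
  qed
  have disj: "?S i \<inter> ?S j = {}" if "i \<in> I - {m}" "j \<in> I - {m}" "i \<noteq> j" for i j
  proof (rule equals0I)
    fix \<pi> assume "\<pi> \<in> ?S i \<inter> ?S j"
    then obtain \<rho> \<rho>' where \<rho>: "\<rho> \<in> pair_partitions (I - {m, i})" "\<pi> = insert {m, i} \<rho>"
      and \<rho>': "\<pi> = insert {m, j} \<rho>'" by blast
    have "{m, i} \<in> \<pi>" "{m, j} \<in> \<pi>" by (simp add: \<rho>(2)) (simp add: \<rho>')
    moreover have "\<pi> \<in> pair_partitions I"
      using insert_pair_partition(1)[OF \<rho>(1)] that(1) assms(2) \<rho>(2) by auto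
    moreover from this have "disjoint \<pi>" by (simp add: pair_partitions_def partition_on_def)
    ultimately have "{m, i} = {m, j}"
      using disjointD[of \<pi> "{m, i}" "{m, j}"] by blast
    then show False using that by (auto simp: doubleton_eq_iff)
  qed
  have "(\<Sum>\<pi>\<in>pair_partitions I. g \<pi>) = (\<Sum>j\<in>I - {m}. sum g (?S j))"
    unfolding eq
    by (rule sum.UNION_disjoint) (use assms disj in \<open>auto intro!: finite_imageI pair_partitions_finite\<close>)
  also have "\<dots> = (\<Sum>j\<in>I - {m}. \<Sum>\<rho>\<in>pair_partitions (I - {m, j}). g (insert {m, j} \<rho>))"
    by (intro sum.cong[OF refl]) (simp add: sum.reindex[OF inj])
  finally show ?thesis .
qed

lemma prod_pair_partition:
  assumes "finite I" "\<pi> \<in> pair_partitions I"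
  shows "(\<Prod>b\<in>\<pi>. \<Prod>v\<in>b. h v :: real) = (\<Prod>v\<in>I. h v)"
proof -
  have p: "\<Union>\<pi> = I" "disjoint \<pi>"
    using assms(2) by (auto simp: pair_partitions_def partition_on_def)
  have "(\<Prod>b\<in>\<pi>. \<Prod>v\<in>b. h v) = prod h (\<Union>\<pi>)"
    using p assms(1) by (intro prod.Union_disjoint[symmetric, unfolded comp_def])
      (auto simp: disjoint_def intro: finite_subset)
  then show ?thesis by (simp add: p)
qed

section \<open>Expansion along the smallest index and the Pfaffian of ones\<close>

lemma pfaffian_cong:
  assumes "\<And>i j. i \<in> I \<Longrightarrow> j \<in> I \<Longrightarrow> i < j \<Longrightarrow> a i j = b i j"
  shows "pfaffian I a = pfaffian I b"
  unfolding pfaffian_def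
proof (intro sum.cong prod.cong arg_cong2[where f="(*)"] refl)
  fix \<pi> c assume "\<pi> \<in> pair_partitions I" "c \<in> \<pi>"
  then obtain u v where "c = {u, v}" "u \<noteq> v" "u \<in> I" "v \<in> I" by (rule card_2_blockE)
  then show "a (Min c) (Max c) = b (Min c) (Max c)"
    using assms by (auto simp: Min_Max_pair min_def max_def)
qed

text \<open>Since \<open>m\<close> is smallest, a point lies inside {m, j} exactly when it is below
  \<open>j\<close>. The crossing signs of {m, j} with the other blocks thus multiply to one factor
  -1 for each point strictly between \<open>m\<close> and \<open>j\<close>.\<close>

lemma pfaffian_expand_Min:
  assumes "finite I" "m \<in> I" "\<And>i. i \<in> I \<Longrightarrow> m \<le> i"
  shows "pfaffian I a =
    (\<Sum>j\<in>I - {m}. (-1) ^ card {i\<in>I - {m}. i < j} * a m j * pfaffian (I - {m, j}) a)"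
proof -
  have *: "(-1) ^ crossings (insert {m, j} \<rho>) * (\<Prod>b\<in>insert {m, j} \<rho>. a (Min b) (Max b))
    = ((-1) ^ card {i\<in>I - {m}. i < j} * a m j) * ((-1) ^ crossings \<rho> * (\<Prod>b\<in>\<rho>. a (Min b) (Max b)))"
    if j: "j \<in> I - {m}" and \<rho>: "\<rho> \<in> pair_partitions (I - {m, j})" for j \<rho>
  proof -
    have mj: "m < j" using j assms(3) by (metis DiffD1 DiffD2 insertI1 order.not_eq_order_implies_strict)
    have fin: "finite \<rho>" using \<rho> assms(1) pair_partitions_finite(2) by blast
    have new: "{m, j} \<notin> \<rho>" using insert_pair_partition(2)[OF \<rho>] assms(2) j by auto
    have "(\<Prod>f\<in>\<rho>. cross_sign {m, j} f) = (\<Prod>f\<in>\<rho>. \<Prod>v\<in>f. if v < j then -1 else 1)"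
    proof (intro prod.cong refl)
      fix f assume "f \<in> \<rho>"
      then obtain u v where f: "f = {u, v}" "u \<noteq> v" "u \<in> I - {m, j}" "v \<in> I - {m, j}"
        using \<rho> by (elim card_2_blockE)
      moreover have "m < u" "m < v" using f assms(3) by (auto simp: order.strict_iff_order)
      ultimately have "cross_sign f {m, j} = (\<Prod>v\<in>f. if v < j then -1 else 1)"
        using mj by (simp add: cross_sign_pair inside_sign_def Min_Max_pair)
      then show "cross_sign {m, j} f = (\<Prod>v\<in>f. if v < j then -1 else 1)"
        by (simp add: cross_sign_commute)
    qed
    also have "\<dots> = (\<Prod>v\<in>I - {m, j}. if v < j then -1 else 1)"
      using assms(1) by (intro prod_pair_partition[OF _ \<rho>]) auto
    also have "\<dots> = (-1) ^ card {i\<in>I - {m, j}. i < j}"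
      using assms(1) by (intro prod_if_minus_one) auto
    also have "{i\<in>I - {m, j}. i < j} = {i\<in>I - {m}. i < j}" by auto
    finally have "(-1) ^ crossings (insert {m, j} \<rho>) = (-1) ^ crossings \<rho> * (-1::real) ^ card {i\<in>I - {m}. i < j}"
      by (simp add: sign_crossings_insert[OF fin new])
    moreover have "Min {m, j} = m" "Max {m, j} = j" using mj by auto
    ultimately show ?thesis using fin new by simp
  qed
  show ?thesis
    unfolding pfaffian_def sum_pair_partitions[OF assms(1,2)] sum_distrib_left
    by (intro sum.cong refl) (rule *)
qed

text \<open>In increasing order of \<open>j\<close> the signs are 1, -1, 1 and so on. Adding a new
  maximum leaves the ranks of the others unchanged, hence the induction from below.\<close>

lemma alternating_sum_rank:
  fixes S :: "'i::linorder set"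
  assumes "finite S"
  shows "(\<Sum>j\<in>S. (-1::real) ^ card {i\<in>S. i < j}) = (if odd (card S) then 1 else 0)"
  using assms
proof (induction rule: finite_linorder_max_induct)
  case empty
  then show ?case by simp
next
  case (insert b A)
  have b: "b \<notin> A" using insert by auto
  have "(\<Sum>j\<in>insert b A. (-1::real) ^ card {i\<in>insert b A. i < j})
      = (-1) ^ card {i\<in>insert b A. i < b} + (\<Sum>j\<in>A. (-1) ^ card {i\<in>insert b A. i < j})"
    using insert b by simp
  also have "{i\<in>insert b A. i < b} = A" using insert by auto
  also have "(\<Sum>j\<in>A. (-1::real) ^ card {i\<in>insert b A. i < j}) = (\<Sum>j\<in>A. (-1) ^ card {i\<in>A. i < j})"
  proof (intro sum.cong refl)
    fix j assume "j \<in> A"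
    then have "{i\<in>insert b A. i < j} = {i\<in>A. i < j}" using insert(2) by auto
    then show "(-1::real) ^ card {i\<in>insert b A. i < j} = (-1) ^ card {i\<in>A. i < j}" by simp
  qed
  finally show ?case using insert b by simp
qed

lemma pfaffian_empty [simp]: "pfaffian {} a = 1"
proof -
  have "pair_partitions ({} :: 'a set) = {{}}"
    by (auto simp: pair_partitions_def partition_on_def)
  then show ?thesis by (simp add: pfaffian_def crossings_def)
qed

text \<open>Expansion along the minimum leaves an alternating sum over the \<open>card I - 1\<close>
  other points, an odd number. This is the terminal Pfaffian on paths without a meeting.\<close>

lemma pfaffian_one:
  assumes "finite I" "even (card I)"
  shows "pfaffian I (\<lambda>_ _. 1) = 1"
  using assms
proof (induction "card I" arbitrary: I rule: less_induct)
  case less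
  show ?case
  proof (cases "I = {}")
    case False
    define m where "m = Min I"
    have m: "m \<in> I" "\<And>i. i \<in> I \<Longrightarrow> m \<le> i" using less False by (auto simp: m_def)
    have "pfaffian I (\<lambda>_ _. 1) = (\<Sum>j\<in>I - {m}. (-1) ^ card {i\<in>I - {m}. i < j} * pfaffian (I - {m, j}) (\<lambda>_ _. 1))"
      using pfaffian_expand_Min[OF less(2) m] by simp
    also have "\<dots> = (\<Sum>j\<in>I - {m}. (-1) ^ card {i\<in>I - {m}. i < j})"
    proof (intro sum.cong refl)
      fix j assume j: "j \<in> I - {m}"
      have 2: "card {m, j} = 2" "{m, j} \<subseteq> I" using j m by auto
      then have "card I \<ge> 2" using less(2) card_mono by metis
      moreover have "card (I - {m, j}) = card I - 2" using 2 less(2) by (simp add: card_Diff_subset)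
      ultimately have "pfaffian (I - {m, j}) (\<lambda>_ _. 1) = 1"
        using less by (intro less(1)) auto
      then show "(-1) ^ card {i\<in>I - {m}. i < j} * pfaffian (I - {m, j}) (\<lambda>_ _. 1)
          = (-1) ^ card {i\<in>I - {m}. i < j}" by simp
    qed
    also have "\<dots> = 1"
      using less m by (subst alternating_sum_rank) (auto simp: card_Diff_singleton)
    finally show ?thesis .
  qed simp
qed

section \<open>Pfaffians with linearly dependent rows\<close>

lemma inside_sign_pair:
  assumes "p \<notin> {u, v}"
  shows "inside_sign {u, v} p = (if (u < p) = (v < p) then 1 else -1)"
proof -
  have "u < p \<longleftrightarrow> \<not> p < u" "v < p \<longleftrightarrow> \<not> p < v" using assms by auto
  then show ?thesis
    unfolding inside_sign_def Min_Max_pair min_less_iff_disj less_max_iff_disj by auto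
qed

text \<open>Together with the orientation factors, the sign of the two blocks is the sign of the
  permutation that lists b, d, c, e against the natural order, and exchanging \<open>d\<close> with
  \<open>e\<close> is a transposition.\<close>

lemma pair_sign_swap:
  fixes b c d e :: "'i::linorder"
  assumes "b \<noteq> c" "b \<noteq> d" "b \<noteq> e" "c \<noteq> d" "c \<noteq> e" "d \<noteq> e"
  shows "cross_sign {b, d} {c, e} * (if b < d then 1 else -1) * (if c < e then 1 else -1) =
    - (cross_sign {b, e} {c, d} * (if b < e then 1 else -1) * (if c < d then 1 else -1))"
proof -
  have "c < b \<longleftrightarrow> \<not> b < c" "e < b \<longleftrightarrow> \<not> b < e" "d < b \<longleftrightarrow> \<not> b < d"
    "d < c \<longleftrightarrow> \<not> c < d" "e < c \<longleftrightarrow> \<not> c < e" "e < d \<longleftrightarrow> \<not> d < e"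
    using assms by auto
  then show ?thesis
    using assms by (simp add: cross_sign_pair inside_sign_pair)
qed

text \<open>Summing over the partners \<open>d\<close> of \<open>b\<close> and \<open>e\<close> of \<open>c\<close>, the summand is antisymmetric in
  \<open>d\<close> and \<open>e\<close>.\<close>

lemma pfaffian_equal_rows:
  assumes fin: "finite I" and bc: "b \<in> I" "c \<in> I" "b \<noteq> c"
    and skew: "\<And>i j. A i j = - A j i" and "A b c = 0"
    and rows: "\<And>x. x \<in> I - {b, c} \<Longrightarrow> A b x = A c x"
  shows "pfaffian I A = 0"
proof -
  define g where "g = (\<lambda>\<pi>. (-1) ^ crossings \<pi> * (\<Prod>P\<in>\<pi>. A (Min P) (Max P)))"
  define T where "T d e = (\<Sum>\<rho>\<in>pair_partitions (I - {b, c, d, e}).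
    g (insert {b, d} (insert {c, e} \<rho>)))" for d e
  \<comment> \<open>Skew-symmetry moves the order of the pair into a sign, so that entries can be
    read in rows \<open>b\<close> and \<open>c\<close> whatever the order of the indices.\<close>
  have A_pair: "A (Min {u, v}) (Max {u, v}) = (if u < v then 1 else -1) * A u v" if "u \<noteq> v" for u v
    using that skew[of u v] by (auto simp: Min_Max_pair min_def max_def)
  have "T d e = - T e d" if d: "d \<in> I - {b, c}" and e: "e \<in> I - {b, c}" and "d \<noteq> e" for d e
  proof -
    have "g (insert {b, d} (insert {c, e} \<rho>)) = - g (insert {b, e} (insert {c, d} \<rho>))"
      if \<rho>: "\<rho> \<in> pair_partitions (I - {b, c, d, e})" for \<rho>
    proof -
      have finr: "finite \<rho>" using pair_partitions_finite(2)[OF _ \<rho>] fin by blast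
      have out: "\<Union>\<rho> = I - {b, c, d, e}"
        using \<rho> by (auto simp: pair_partitions_def partition_on_def)
      have new: "{b, d} \<notin> insert {c, e} \<rho>" "{c, e} \<notin> \<rho>" "{b, e} \<notin> insert {c, d} \<rho>" "{c, d} \<notin> \<rho>"
        using out bc d e \<open>d \<noteq> e\<close> by (auto simp: doubleton_eq_iff)
      \<comment> \<open>Against a third block the signs split over the points b, c, d, e, so it does
        not matter how these four are paired.\<close>
      have swap: "(\<Prod>f\<in>\<rho>. cross_sign {b, d} f) * (\<Prod>f\<in>\<rho>. cross_sign {c, e} f) =
        (\<Prod>f\<in>\<rho>. cross_sign {b, e} f) * (\<Prod>f\<in>\<rho>. cross_sign {c, d} f)"
        unfolding prod.distrib[symmetric]
      proof (intro prod.cong refl)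
        fix f assume "f \<in> \<rho>"
        with \<rho> obtain u v where "f = {u, v}" "u \<noteq> v" "u \<in> I - {b, c, d, e}" "v \<in> I - {b, c, d, e}"
          by (rule card_2_blockE)
        then show "cross_sign {b, d} f * cross_sign {c, e} f = cross_sign {b, e} f * cross_sign {c, d} f"
          using d e bc by (auto simp: cross_sign_pair)
      qed
      have g2: "g (insert {b, p} (insert {c, q} \<rho>)) =
          (-1) ^ crossings \<rho> * (\<Prod>P\<in>\<rho>. A (Min P) (Max P)) *
          ((\<Prod>f\<in>\<rho>. cross_sign {b, p} f) * (\<Prod>f\<in>\<rho>. cross_sign {c, q} f)) * (A b p * A c q) *
          (cross_sign {b, p} {c, q} * (if b < p then 1 else -1) * (if c < q then 1 else -1))"
        if "{b, p} \<notin> insert {c, q} \<rho>" "{c, q} \<notin> \<rho>" "b \<noteq> p" "c \<noteq> q" for p q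
        using that finr by (simp add: g_def sign_crossings_insert A_pair del: Min_insert Max_insert)
      have row: "A b d * A c e = A b e * A c d" using rows d e by simp
      have sgn: "cross_sign {b, d} {c, e} * (if b < d then 1 else -1) * (if c < e then 1 else -1) =
        - (cross_sign {b, e} {c, d} * (if b < e then 1 else -1) * (if c < d then 1 else -1))"
        using bc d e \<open>d \<noteq> e\<close> by (intro pair_sign_swap) auto
      have ne: "b \<noteq> d" "c \<noteq> e" "b \<noteq> e" "c \<noteq> d" using d e by auto
      show ?thesis
        unfolding g2[OF new(1,2) ne(1,2)] g2[OF new(3,4) ne(3,4)] swap row sgn by simp
    qed
    then have "T d e = (\<Sum>\<rho>\<in>pair_partitions (I - {b, c, d, e}). - g (insert {b, e} (insert {c, d} \<rho>)))"
      unfolding T_def by (intro sum.cong refl)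
    then show ?thesis
      unfolding T_def by (simp add: sum_negf insert_commute)
  qed
  note T_swap = this
  have split: "(\<Sum>\<rho>\<in>pair_partitions (I - {b, d}). g (insert {b, d} \<rho>)) =
      (if d = c then 0 else \<Sum>e\<in>I - {b, c} - {d}. T d e)" if d: "d \<in> I - {b}" for d
  proof (cases "d = c")
    case True
    \<comment> \<open>If \<open>b\<close> is paired with \<open>c\<close>, the factor
      \<open>A b c = 0\<close> kills the term.\<close>
    have "g (insert {b, c} \<rho>) = 0" if "\<rho> \<in> pair_partitions (I - {b, c})" for \<rho>
      using that bc A_pair[of b c] \<open>A b c = 0\<close> fin pair_partitions_finite(2)[of "I - {b, c}" \<rho>]
        insert_pair_partition(2)[of \<rho> I b c] by (simp add: g_def)
    then show ?thesis using True by simp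
  next
    case False
    have "(\<Sum>\<rho>\<in>pair_partitions (I - {b, d}). g (insert {b, d} \<rho>)) =
      (\<Sum>e\<in>I - {b, d} - {c}. \<Sum>\<rho>\<in>pair_partitions (I - {b, d} - {c, e}). g (insert {b, d} (insert {c, e} \<rho>)))"
      using fin bc d False by (intro sum_pair_partitions) auto
    also have "\<dots> = (\<Sum>e\<in>I - {b, c} - {d}. T d e)"
    proof (intro sum.cong)
      show "I - {b, d} - {c} = I - {b, c} - {d}" by auto
      fix e
      have "I - {b, d} - {c, e} = I - {b, c, d, e}" by auto
      then show "(\<Sum>\<rho>\<in>pair_partitions (I - {b, d} - {c, e}). g (insert {b, d} (insert {c, e} \<rho>))) = T d e"
        by (simp add: T_def)
    qed
    finally show ?thesis using False by simp
  qed
  have "pfaffian I A = (\<Sum>d\<in>I - {b}. if d = c then 0 else \<Sum>e\<in>I - {b, c} - {d}. T d e)"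
    unfolding pfaffian_def g_def[symmetric] sum_pair_partitions[OF fin bc(1), of g]
    using sum_pair_partitions[OF fin bc(1), of g] split
    by (simp add: g_def)
  also have "\<dots> = (\<Sum>d\<in>I - {b, c}. \<Sum>e\<in>I - {b, c} - {d}. T d e)"
    using fin bc by (intro sum.mono_neutral_cong_right) auto
  also have "\<dots> = (\<Sum>d\<in>I - {b, c}. \<Sum>e\<in>I - {b, c}. if d = e then 0 else T d e)"
    using fin by (intro sum.cong refl sum.mono_neutral_cong_left) auto
  finally have S: "pfaffian I A = (\<Sum>d\<in>I - {b, c}. \<Sum>e\<in>I - {b, c}. if d = e then 0 else T d e)" .
  also have "\<dots> = (\<Sum>e\<in>I - {b, c}. \<Sum>d\<in>I - {b, c}. if d = e then 0 else T d e)"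
    by (rule sum.swap)
  also have "\<dots> = (\<Sum>e\<in>I - {b, c}. \<Sum>d\<in>I - {b, c}. - (if e = d then 0 else T e d))"
  proof (intro sum.cong refl)
    fix e d assume "e \<in> I - {b, c}" "d \<in> I - {b, c}"
    then show "(if d = e then 0 else T d e) = - (if e = d then 0 else T e d)"
      using T_swap[of d e] by auto
  qed
  also have "\<dots> = - pfaffian I A" unfolding S by (simp add: sum_negf)
  finally show ?thesis by simp
qed

text \<open>The Pfaffian is linear in row \<open>b\<close> when column \<open>b\<close> follows by
  skew-symmetry. Splitting the row leaves Pfaffians in which row \<open>b\<close> copies row
  \<open>c\<close> or row \<open>d\<close>, and these vanish. Taking \<open>d = c\<close> with
  \<beta> = 0 covers a plain multiple of one row.\<close>

lemma pfaffian_dependent_row: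
  assumes fin: "finite I" and "b \<in> I" "c \<in> I" "d \<in> I" "b \<noteq> c" "b \<noteq> d"
    and skew: "\<And>i j. A i j = - A j i"
    and row: "\<And>x. x \<in> I - {b} \<Longrightarrow> A b x = \<alpha> * A c x + \<beta> * A d x"
  shows "pfaffian I A = 0"
proof -
  \<comment> \<open>Row \<open>b\<close> becomes \<open>v\<close> and column \<open>b\<close>
    becomes \<open>- v\<close>, with 0 kept on the diagonal, so skew-symmetry is preserved.\<close>
  define R where "R v i j = (if i = b then if j = b then 0 else v j else if j = b then - v i else A i j)"
    for v and i j
  \<comment> \<open>The cofactor of the entry (b, j), oriented by the order of \<open>b\<close> and
    \<open>j\<close>; it does not involve row \<open>b\<close>.\<close>
  define C where "C j = (\<Sum>\<rho>\<in>pair_partitions (I - {b, j}).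
    (-1) ^ crossings (insert {b, j} \<rho>) * (if b < j then 1 else -1) * (\<Prod>P\<in>\<rho>. A (Min P) (Max P)))" for j
  have expand: "pfaffian I (R v) = (\<Sum>j\<in>I - {b}. C j * v j)" for v
    unfolding pfaffian_def sum_pair_partitions[OF fin \<open>b \<in> I\<close>] C_def sum_distrib_right
  proof (intro sum.cong refl)
    fix j \<rho> assume j: "j \<in> I - {b}" and \<rho>: "\<rho> \<in> pair_partitions (I - {b, j})"
    have "{b, j} \<notin> \<rho>" "finite \<rho>"
      using insert_pair_partition(2)[OF \<rho>] pair_partitions_finite(2)[OF _ \<rho>] j fin \<open>b \<in> I\<close> by auto
    moreover have "R v (Min {b, j}) (Max {b, j}) = (if b < j then 1 else -1) * v j"
      using j by (auto simp: R_def Min_Max_pair min_def max_def)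
    moreover have "(\<Prod>P\<in>\<rho>. R v (Min P) (Max P)) = (\<Prod>P\<in>\<rho>. A (Min P) (Max P))"
    proof (intro prod.cong refl)
      fix P assume "P \<in> \<rho>"
      with \<rho> obtain p q where "P = {p, q}" "p \<in> I - {b, j}" "q \<in> I - {b, j}" by (rule card_2_blockE)
      then show "R v (Min P) (Max P) = A (Min P) (Max P)"
        by (auto simp: R_def Min_Max_pair min_def max_def)
    qed
    ultimately show "(-1) ^ crossings (insert {b, j} \<rho>) * (\<Prod>P\<in>insert {b, j} \<rho>. R v (Min P) (Max P)) =
      (-1) ^ crossings (insert {b, j} \<rho>) * (if b < j then 1 else -1) * (\<Prod>P\<in>\<rho>. A (Min P) (Max P)) * v j"
      by simp
  qed
  have zero: "pfaffian I (R (A c)) = 0" if "c \<in> I" "b \<noteq> c" for c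
  proof (rule pfaffian_equal_rows[OF fin \<open>b \<in> I\<close> that])
    show "R (A c) i j = - R (A c) j i" for i j using skew[of i j] by (auto simp: R_def)
    show "R (A c) b c = 0" using skew[of c c] by (simp add: R_def)
    show "R (A c) b x = R (A c) c x" if "x \<in> I - {b, c}" for x
      using that \<open>b \<noteq> c\<close> by (auto simp: R_def)
  qed
  have "A i j = R (A b) i j" for i j
    using skew[of b b] skew[of i b] by (simp add: R_def)
  then have "A = R (A b)" by (intro ext)
  then have "pfaffian I A = (\<Sum>j\<in>I - {b}. C j * A b j)" using expand by metis
  also have "\<dots> = (\<Sum>j\<in>I - {b}. \<alpha> * (C j * A c j) + \<beta> * (C j * A d j))"
    using row by (intro sum.cong refl) (simp add: algebra_simps)
  also have "\<dots> = \<alpha> * pfaffian I (R (A c)) + \<beta> * pfaffian I (R (A d))"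
    by (simp add: expand sum.distrib sum_distrib_left)
  finally show ?thesis using zero assms(2-6) by simp
qed

text \<open>Expansion along the border index 0, which is the minimum: \<open>l\<close> has
  \<open>l - 1\<close> indices of {1..k} below it, and \<open>l - 1\<close> has the parity of
  \<open>l + 1\<close>. The alternating sum becomes one Pfaffian, to which dependence of rows can be
  applied.\<close>

lemma bordered_pfaffian:
  assumes "\<And>j. j \<in> {1..k} \<Longrightarrow> a' 0 j = 1"
    and "\<And>i j. 1 \<le> i \<Longrightarrow> i < j \<Longrightarrow> j \<le> k \<Longrightarrow> a' i j = a i j"
  shows "pfaffian {0..k::nat} a' = (\<Sum>l = 1..k. (-1) ^ (l + 1) * pfaffian ({1..k} - {l}) a)"
proof -
  have 0: "{0..k} - {0} = {1..k}" by auto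
  have "pfaffian {0..k} a' =
    (\<Sum>l\<in>{1..k}. (-1) ^ card {i\<in>{1..k}. i < l} * a' 0 l * pfaffian ({0..k} - {0, l}) a')"
    using pfaffian_expand_Min[of "{0..k}" 0 a'] unfolding 0 by simp
  also have "\<dots> = (\<Sum>l = 1..k. (-1) ^ (l + 1) * pfaffian ({1..k} - {l}) a)"
  proof (intro sum.cong refl)
    fix l assume l: "l \<in> {1..k}"
    have 1: "{0..k} - {0, l} = {1..k} - {l}" by auto
    have "{i\<in>{1..k}. i < l} = {1..<l}" using l by auto
    then have "(-1::real) ^ card {i\<in>{1..k}. i < l} = (-1) ^ (l + 1)"
      using l by (cases l) auto
    moreover have "pfaffian ({1..k} - {l}) a' = pfaffian ({1..k} - {l}) a"
      using assms(2) by (intro pfaffian_cong) auto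
    ultimately show "(-1) ^ card {i\<in>{1..k}. i < l} * a' 0 l * pfaffian ({0..k} - {0, l}) a' =
      (-1) ^ (l + 1) * pfaffian ({1..k} - {l}) a"
      using l assms(1) unfolding 1 by simp
  qed
  finally show ?thesis .
qed

section \<open>Gaussian averages\<close>

definition std_normal :: "real measure" where
  "std_normal = density lborel std_normal_density"

lemma prob_space_std_normal: "prob_space std_normal"
  unfolding std_normal_def by (rule prob_space_normal_density) simp

lemma sets_std_normal [measurable_cong, simp]: "sets std_normal = sets borel"
  by (simp add: std_normal_def)

text \<open>The expectation of \<theta> at the difference of two independent Brownian motions after
  a further time \<open>r\<close>, when the difference is now \<open>d\<close>. The 2 is the
  variance of that difference per unit of time.\<close>

definition gauss_avg :: "(real \<Rightarrow> real) \<Rightarrow> real \<Rightarrow> real \<Rightarrow> real" where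
  "gauss_avg \<theta> d r = (\<integral>z. \<theta> (d + sqrt (2 * r) * z) \<partial>std_normal)"

lemma gauss_avg_zero [simp]: "gauss_avg \<theta> d 0 = \<theta> d"
  using prob_space.prob_space[OF prob_space_std_normal] by (simp add: gauss_avg_def)

lemma borel_measurable_gauss_avg [measurable]:
  assumes [measurable]: "\<theta> \<in> borel_measurable borel"
  shows "(\<lambda>d. gauss_avg \<theta> d r) \<in> borel_measurable borel"
proof -
  interpret prob_space std_normal by (rule prob_space_std_normal)
  show ?thesis unfolding gauss_avg_def by measurable
qed

lemma abs_gauss_avg_le:
  assumes [measurable]: "\<theta> \<in> borel_measurable borel" and "\<And>z. \<bar>\<theta> z\<bar> \<le> C"
  shows "\<bar>gauss_avg \<theta> d r\<bar> \<le> C"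
proof -
  interpret prob_space std_normal by (rule prob_space_std_normal)
  have "integrable std_normal (\<lambda>z. \<theta> (d + sqrt (2 * r) * z))"
    using assms(2) by (intro integrable_const_bound[where B=C]) auto
  then have "\<bar>gauss_avg \<theta> d r\<bar> \<le> (\<integral>z. \<bar>\<theta> (d + sqrt (2 * r) * z)\<bar> \<partial>std_normal)"
    unfolding gauss_avg_def by (intro integral_abs_bound)
  also have "\<dots> \<le> C"
    using assms(2) by (intro integral_le_const integrable_const_bound[where B=C]) auto
  finally show ?thesis .
qed

text \<open>Applied to the integers, where the wave functions jump: a non-degenerate Gaussian law
  gives no mass to a countable set.\<close>

lemma AE_std_normal_affine_notin:
  assumes "countable A" "c \<noteq> 0"
  shows "AE z in std_normal. d + c * z \<notin> A"
proof -
  have "countable ((\<lambda>a. (a - d) / c) ` A)" using assms(1) by simp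
  then have "AE z in lborel. z \<notin> (\<lambda>a. (a - d) / c) ` A"
    by (intro AE_not_in countable_imp_null_set_lborel)
  then have "AE z in lborel. d + c * z \<notin> A"
  proof eventually_elim
    case (elim z)
    then show ?case using assms(2) by (force simp: image_iff field_simps)
  qed
  then show ?thesis unfolding std_normal_def by (subst AE_density) auto
qed

lemma countable_Ints: "countable (\<int> :: real set)"
  unfolding Ints_def by simp

lemma gauss_avg_cong_AE:
  assumes [measurable]: "\<theta> \<in> borel_measurable borel" "\<eta> \<in> borel_measurable borel"
    and eq: "\<And>z. z \<notin> \<int> \<Longrightarrow> \<theta> z = \<eta> z" and "r > 0"
  shows "gauss_avg \<theta> d r = gauss_avg \<eta> d r"
  unfolding gauss_avg_def
proof (rule integral_cong_AE)
  have "sqrt (2 * r) \<noteq> 0" using \<open>r > 0\<close> by simp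
  then have "AE z in std_normal. d + sqrt (2 * r) * z \<notin> \<int>"
    by (intro AE_std_normal_affine_notin countable_Ints)
  then show "AE z in std_normal. \<theta> (d + sqrt (2 * r) * z) = \<eta> (d + sqrt (2 * r) * z)"
    by eventually_elim (rule eq)
qed measurable

text \<open>For \<open>r0 > 0\<close> the limiting Gaussian misses the jumps almost surely, and
  dominated convergence applies. For \<open>r0 = 0\<close> and an integer \<open>d0\<close>
  continuity can fail; this is why exits at the final time are later excluded.\<close>

lemma tendsto_gauss_avg:
  assumes [measurable]: "\<theta> \<in> borel_measurable borel" and bound: "\<And>z. \<bar>\<theta> z\<bar> \<le> C"
    and cont: "\<And>z. z \<notin> \<int> \<Longrightarrow> isCont \<theta> z"
    and lim: "d \<longlonglongrightarrow> d0" "r \<longlonglongrightarrow> r0" and "r0 > 0"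
  shows "(\<lambda>n. gauss_avg \<theta> (d n) (r n)) \<longlonglongrightarrow> gauss_avg \<theta> d0 r0"
  unfolding gauss_avg_def
proof (rule integral_dominated_convergence[where w = "\<lambda>_. C"])
  interpret prob_space std_normal by (rule prob_space_std_normal)
  have "sqrt (2 * r0) \<noteq> 0" using \<open>r0 > 0\<close> by simp
  then have "AE z in std_normal. d0 + sqrt (2 * r0) * z \<notin> \<int>"
    by (intro AE_std_normal_affine_notin countable_Ints)
  then show "AE z in std_normal. (\<lambda>n. \<theta> (d n + sqrt (2 * r n) * z)) \<longlonglongrightarrow> \<theta> (d0 + sqrt (2 * r0) * z)"
  proof eventually_elim
    case (elim z)
    have "(\<lambda>n. d n + sqrt (2 * r n) * z) \<longlonglongrightarrow> d0 + sqrt (2 * r0) * z"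
      by (intro tendsto_intros lim)
    then show ?case by (rule isCont_tendsto_compose[OF cont[OF elim]])
  qed
  show "integrable std_normal (\<lambda>_. C)" by simp
  show "AE z in std_normal. norm (\<theta> (d n + sqrt (2 * r n) * z)) \<le> C" for n using bound by simp
qed measurable

lemma integral_std_normal_reflect:
  assumes "f \<in> borel_measurable borel"
  shows "(\<integral>z. f (- z) \<partial>std_normal) = (\<integral>z. f z \<partial>std_normal :: real)"
proof -
  have [measurable]: "f \<in> borel_measurable borel" by fact
  have "(\<integral>z. f z \<partial>std_normal) = (\<integral>z. std_normal_density z *\<^sub>R f z \<partial>lborel)"
    unfolding std_normal_def by (subst integral_density) auto
  also have "\<dots> = (\<integral>z. std_normal_density (- z) *\<^sub>R f (- z) \<partial>lborel)"
    by (subst lborel_integral_real_affine[where c = "-1" and t = 0]) auto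
  also have "\<dots> = (\<integral>z. f (- z) \<partial>std_normal)"
    unfolding std_normal_def by (subst integral_density) (auto simp: normal_density_def)
  finally show ?thesis by simp
qed

text \<open>The standard normal law is symmetric. Oddness is asked only off the integers because
  \<open>staircase\<close> is 1 at 0; a positive \<open>r\<close> makes the difference
  invisible.\<close>

lemma gauss_avg_odd:
  assumes [measurable]: "\<theta> \<in> borel_measurable borel"
    and odd: "\<And>z. z \<notin> \<int> \<Longrightarrow> \<theta> (- z) = - \<theta> z" and "r > 0"
  shows "gauss_avg \<theta> (- d) r = - gauss_avg \<theta> d r"
proof -
  have "gauss_avg \<theta> (- d) r = (\<integral>z. \<theta> (- d + sqrt (2 * r) * (- z)) \<partial>std_normal)"
    unfolding gauss_avg_def by (rule integral_std_normal_reflect[symmetric]) simp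
  also have "\<dots> = gauss_avg (\<lambda>z. \<theta> (- z)) d r" by (simp add: gauss_avg_def algebra_simps)
  also have "\<dots> = gauss_avg (\<lambda>z. - \<theta> z) d r"
    using odd \<open>r > 0\<close> by (intro gauss_avg_cong_AE) auto
  also have "\<dots> = - gauss_avg \<theta> d r" by (simp add: gauss_avg_def)
  finally show ?thesis .
qed

text \<open>Integrability is assumed in place of a bound so that the unbounded
  \<open>staircase\<close> is included.\<close>

lemma gauss_avg_shift:
  assumes int: "\<And>d. integrable std_normal (\<lambda>z. \<theta> (d + sqrt (2 * r) * z))"
    and shift: "\<And>z. \<theta> (z + 1) = \<alpha> * \<theta> z + \<beta>"
  shows "gauss_avg \<theta> (d + 1) r = \<alpha> * gauss_avg \<theta> d r + \<beta>"
proof -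
  interpret prob_space std_normal by (rule prob_space_std_normal)
  have "gauss_avg \<theta> (d + 1) r = (\<integral>z. \<alpha> * \<theta> (d + sqrt (2 * r) * z) + \<beta> \<partial>std_normal)"
    unfolding gauss_avg_def shift[symmetric] by (simp add: add_ac)
  also have "\<dots> = \<alpha> * gauss_avg \<theta> d r + \<beta>"
    using int[of d] by (simp add: gauss_avg_def prob_space)
  finally show ?thesis .
qed

section \<open>The square wave and the staircase\<close>

definition square_wave :: "real \<Rightarrow> real" where
  "square_wave z = sgn (sin (z * pi))"

definition staircase :: "real \<Rightarrow> real" where
  "staircase z = 2 * of_int \<lfloor>z\<rfloor> + 1"

text \<open>Optional stopping is available for bounded functions only, so the staircase is reached as the
  limit \<open>N \<rightarrow> \<infinity>\<close> of its truncations, which still equal 1 on \<open>(0, 1)\<close>.\<close>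

definition clamped_staircase :: "nat \<Rightarrow> real \<Rightarrow> real" where
  "clamped_staircase N z = max (- real N) (min (real N) (staircase z))"

lemma borel_measurable_waves [measurable]:
  "square_wave \<in> borel_measurable borel"
  "staircase \<in> borel_measurable borel"
  "clamped_staircase N \<in> borel_measurable borel"
  unfolding square_wave_def staircase_def clamped_staircase_def by measurable

lemma isCont_square_wave: "z \<notin> \<int> \<Longrightarrow> isCont square_wave z"
  unfolding square_wave_def by (intro continuous_intros) (simp add: sin_times_pi_eq_0)

lemma isCont_clamped_staircase:
  assumes "z \<notin> \<int>"
  shows "isCont (clamped_staircase N) z"
proof -
  have "isCont (\<lambda>z. real_of_int \<lfloor>z\<rfloor>) z"
    using continuous_floor[OF assms] by (simp add: comp_def)
  then have "isCont staircase z" unfolding staircase_def by (intro continuous_intros)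
  then show ?thesis
    unfolding clamped_staircase_def continuous_at by (intro tendsto_max tendsto_min tendsto_const)
qed

lemma abs_square_wave_le: "\<bar>square_wave z\<bar> \<le> 1"
  by (simp add: square_wave_def sgn_if)

lemma abs_clamped_staircase_le: "\<bar>clamped_staircase N z\<bar> \<le> real N"
  by (auto simp: clamped_staircase_def)

lemma abs_staircase_le: "\<bar>staircase z\<bar> \<le> 2 * \<bar>z\<bar> + 1"
  unfolding staircase_def by linarith

lemma abs_clamped_staircase_le_linear: "\<bar>clamped_staircase N z\<bar> \<le> 2 * \<bar>z\<bar> + 1"
  using abs_staircase_le[of z] by (auto simp: clamped_staircase_def)

lemma tendsto_clamped_staircase: "(\<lambda>N. clamped_staircase N z) \<longlonglongrightarrow> staircase z"
proof (rule tendsto_eventually)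
  have "\<forall>\<^sub>F N in sequentially. \<bar>staircase z\<bar> \<le> real N"
    by (rule eventually_sequentiallyI[of "nat \<lceil>\<bar>staircase z\<bar>\<rceil>"]) linarith
  then show "\<forall>\<^sub>F N in sequentially. clamped_staircase N z = staircase z"
    by eventually_elim (auto simp: clamped_staircase_def)
qed

lemma square_wave_unit: "0 < z \<Longrightarrow> z < 1 \<Longrightarrow> square_wave z = 1"
  using sin_gt_zero[of "z * pi"] by (simp add: square_wave_def)

lemma clamped_staircase_unit: "0 < z \<Longrightarrow> z < 1 \<Longrightarrow> 0 < N \<Longrightarrow> clamped_staircase N z = 1"
  using floor_unique[of 0 z] by (simp add: clamped_staircase_def staircase_def)

lemma staircase_unit: "0 < z \<Longrightarrow> z < 1 \<Longrightarrow> staircase z = 1"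
  using floor_unique[of 0 z] by (simp add: staircase_def)

lemma square_wave_odd: "square_wave (- z) = - square_wave z"
  by (simp add: square_wave_def sgn_minus)

lemma staircase_odd: "z \<notin> \<int> \<Longrightarrow> staircase (- z) = - staircase z"
  by (simp add: staircase_def floor_minus ceiling_altdef) (auto simp: Ints_def)

lemma square_wave_shift: "square_wave (z + 1) = - 1 * square_wave z + 0"
  by (simp add: square_wave_def distrib_right sgn_minus)

lemma staircase_shift: "staircase (z + 1) = 1 * staircase z + 2"
  by (simp add: staircase_def)

lemma integrable_abs_std_normal: "integrable std_normal (\<lambda>z. \<bar>z\<bar>)"
  unfolding std_normal_def using integrable_std_normal_moment_abs[of 1]
  by (subst integrable_density) auto

lemma integrable_staircase: "integrable std_normal (\<lambda>z. staircase (d + c * z))"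
proof (rule Bochner_Integration.integrable_bound)
  interpret prob_space std_normal by (rule prob_space_std_normal)
  show "integrable std_normal (\<lambda>z. 2 * (\<bar>d\<bar> + \<bar>c\<bar> * \<bar>z\<bar>) + 1)"
    using integrable_abs_std_normal by simp
  have "\<bar>staircase (d + c * z)\<bar> \<le> 2 * (\<bar>d\<bar> + \<bar>c\<bar> * \<bar>z\<bar>) + 1" for z
    using abs_staircase_le[of "d + c * z"] abs_triangle_ineq[of d "c * z"] by (simp add: abs_mult)
  then show "AE z in std_normal. norm (staircase (d + c * z)) \<le> norm (2 * (\<bar>d\<bar> + \<bar>c\<bar> * \<bar>z\<bar>) + 1)"
    by (intro AE_I2) (simp add: order_trans[OF _ abs_ge_self])
qed measurable

lemma tendsto_gauss_avg_clamped:
  "(\<lambda>N. gauss_avg (clamped_staircase N) d r) \<longlonglongrightarrow> gauss_avg staircase d r"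
  unfolding gauss_avg_def
proof (rule integral_dominated_convergence[where w = "\<lambda>z. 2 * (\<bar>d\<bar> + \<bar>sqrt (2 * r)\<bar> * \<bar>z\<bar>) + 1"])
  interpret prob_space std_normal by (rule prob_space_std_normal)
  show "integrable std_normal (\<lambda>z. 2 * (\<bar>d\<bar> + \<bar>sqrt (2 * r)\<bar> * \<bar>z\<bar>) + 1)"
    using integrable_abs_std_normal by simp
  have "\<bar>clamped_staircase N (d + c * z)\<bar> \<le> 2 * (\<bar>d\<bar> + \<bar>c\<bar> * \<bar>z\<bar>) + 1" for N c z
    using abs_clamped_staircase_le_linear[of N "d + c * z"] abs_triangle_ineq[of d "c * z"] by (simp add: abs_mult)
  then show "AE z in std_normal. norm (clamped_staircase N (d + sqrt (2 * r) * z)) \<le>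
      2 * (\<bar>d\<bar> + \<bar>sqrt (2 * r)\<bar> * \<bar>z\<bar>) + 1" for N
    by (intro AE_I2) simp
  show "AE z in std_normal. (\<lambda>N. clamped_staircase N (d + sqrt (2 * r) * z)) \<longlonglongrightarrow> staircase (d + sqrt (2 * r) * z)"
    by (intro AE_I2 tendsto_clamped_staircase)
qed measurable

text \<open>The truncations grow at most linearly, uniformly in the level, and |z| is integrable for
  the Gaussian law. At the exit the gaps lie in [0, 1], so this constant dominates the passage from
  the truncated to the full staircase.\<close>

lemma gauss_avg_clamped_bounded:
  obtains C where "\<And>N d r. \<bar>d\<bar> \<le> 1 \<Longrightarrow> 0 \<le> r \<Longrightarrow> r \<le> t \<Longrightarrow> \<bar>gauss_avg (clamped_staircase N) d r\<bar> \<le> C"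
proof
  interpret prob_space std_normal by (rule prob_space_std_normal)
  let ?w = "\<lambda>z. 2 * (1 + sqrt (2 * t) * \<bar>z\<bar>) + 1"
  fix N :: nat and d r :: real
  assume d: "\<bar>d\<bar> \<le> 1" and r: "0 \<le> r" "r \<le> t"
  have le: "\<bar>clamped_staircase N (d + sqrt (2 * r) * z)\<bar> \<le> ?w z" for z
  proof -
    have "sqrt (2 * r) * \<bar>z\<bar> \<le> sqrt (2 * t) * \<bar>z\<bar>" using r by (intro mult_right_mono) auto
    then show ?thesis
      using abs_clamped_staircase_le_linear[of N "d + sqrt (2 * r) * z"]
        abs_triangle_ineq[of d "sqrt (2 * r) * z"] d r by (simp add: abs_mult)
  qed
  have "integrable std_normal ?w" using integrable_abs_std_normal by simp
  moreover have "integrable std_normal (\<lambda>z. clamped_staircase N (d + sqrt (2 * r) * z))"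
    by (rule Bochner_Integration.integrable_bound[OF calculation])
      (use le in \<open>auto intro!: AE_I2 order_trans[OF _ abs_ge_self]\<close>)
  ultimately have "(\<integral>z. \<bar>clamped_staircase N (d + sqrt (2 * r) * z)\<bar> \<partial>std_normal) \<le> (\<integral>z. ?w z \<partial>std_normal)"
    using le by (intro integral_mono) auto
  then show "\<bar>gauss_avg (clamped_staircase N) d r\<bar> \<le> (\<integral>z. ?w z \<partial>std_normal)"
    unfolding gauss_avg_def by (rule order_trans[OF integral_abs_bound])
qed

lemma integrable_square_wave: "integrable std_normal (\<lambda>z. square_wave (d + c * z))"
proof -
  interpret prob_space std_normal by (rule prob_space_std_normal)
  show ?thesis by (rule integrable_const_bound[where B = 1]) (simp_all add: abs_square_wave_le)
qed

section \<open>The Markov property along a time grid\<close>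

text \<open>A rectangle event factors over the rows by \<open>outer\<close> and within each row by
  \<open>inner\<close>. This joins independence of the paths to independence of the increments of
  each path.\<close>

lemma (in prob_space) indep_vars_nested:
  assumes fin: "finite K" "finite L"
    and outer: "indep_vars (\<lambda>i. PiM L (\<lambda>_. N)) (\<lambda>i \<omega>. \<lambda>l\<in>L. X i l \<omega>) K"
    and inner: "\<And>i. i \<in> K \<Longrightarrow> indep_vars (\<lambda>_. N) (X i) L"
  shows "indep_vars (\<lambda>_. N) (\<lambda>(i, l). X i l) (K \<times> L)"
proof (cases "K \<times> L = {}")
  case True
  show ?thesis unfolding indep_vars_def indep_sets_def True by simp
next
  case False
  then have ne: "K \<noteq> {}" "L \<noteq> {}" by auto
  have rv: "random_variable N (X i l)" if "i \<in> K" "l \<in> L" for i l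
    using inner[OF that(1)] that(2) by (auto simp: indep_vars_def)
  let ?X = "\<lambda>(i, l). X i l"
  let ?F = "\<lambda>p. {?X p -` A \<inter> space M | A. A \<in> sets N}"
  have "indep_sets ?F (K \<times> L)"
  proof (subst indep_sets_finite)
    show "K \<times> L \<noteq> {}" "finite (K \<times> L)" using False fin by auto
    show "?F p \<subseteq> events" if "p \<in> K \<times> L" for p using that rv by (auto intro: measurable_sets)
    show "space M \<in> ?F p" if "p \<in> K \<times> L" for p
    proof -
      have "?X p -` space N \<inter> space M = space M"
        using that rv by (auto dest: measurable_space)
      then show ?thesis by blast
    qed
    show "\<forall>A\<in>Pi (K \<times> L) ?F. prob (\<Inter>p\<in>K \<times> L. A p) = (\<Prod>p\<in>K \<times> L. prob (A p))"
    proof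
      fix A assume "A \<in> Pi (K \<times> L) ?F"
      then have "\<forall>p\<in>K \<times> L. \<exists>C. A p = ?X p -` C \<inter> space M \<and> C \<in> sets N" by (auto simp: Pi_iff)
      then obtain C where C: "\<And>p. p \<in> K \<times> L \<Longrightarrow> A p = ?X p -` C p \<inter> space M"
        "\<And>p. p \<in> K \<times> L \<Longrightarrow> C p \<in> sets N" by metis
      let ?P = "\<lambda>i. (\<lambda>\<omega>. \<lambda>l\<in>L. X i l \<omega>) -` (\<Pi>\<^sub>E l\<in>L. C (i, l)) \<inter> space M"
      have P: "?P i = (\<Inter>l\<in>L. X i l -` C (i, l) \<inter> space M)" for i
        using ne by (auto simp: PiE_iff)
      have "(\<Inter>p\<in>K \<times> L. A p) = (\<Inter>i\<in>K. ?P i)"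
      proof -
        have "(\<Inter>p\<in>K \<times> L. A p) = (\<Inter>p\<in>K \<times> L. ?X p -` C p \<inter> space M)"
          using C(1) by (intro INF_cong) auto
        then show ?thesis unfolding P by auto
      qed
      also have "prob \<dots> = (\<Prod>i\<in>K. prob (?P i))"
        using C(2) fin ne by (intro indep_varsD_finite[OF outer] sets_PiM_I_finite) auto
      also have "\<dots> = (\<Prod>i\<in>K. \<Prod>l\<in>L. prob (A (i, l)))"
      proof (intro prod.cong refl)
        fix i assume i: "i \<in> K"
        have "prob (?P i) = (\<Prod>l\<in>L. prob (X i l -` C (i, l) \<inter> space M))"
          unfolding P by (rule indep_varsD_finite[OF inner[OF i]]) (use C(2) fin ne i in auto)
        also have "\<dots> = (\<Prod>l\<in>L. prob (A (i, l)))" using C(1) i by (intro prod.cong refl) auto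
        finally show "prob (?P i) = (\<Prod>l\<in>L. prob (A (i, l)))" .
      qed
      also have "\<dots> = (\<Prod>p\<in>K \<times> L. prob (A p))" by (simp add: prod.cartesian_product)
      finally show "prob (\<Inter>p\<in>K \<times> L. A p) = (\<Prod>p\<in>K \<times> L. prob (A p))" .
    qed
  qed
  then show ?thesis using rv by (auto simp: indep_vars_def2)
qed

lemma (in prob_space) indep_vars_imp_indep_var:
  assumes "indep_vars (\<lambda>_. N) X I" "i \<in> I" "j \<in> I" "i \<noteq> j"
  shows "indep_var N (X i) N (X j)"
proof -
  have "indep_var N ((\<lambda>f. f i) \<circ> (\<lambda>\<omega>. restrict (\<lambda>i. X i \<omega>) {i}))
    N ((\<lambda>f. f j) \<circ> (\<lambda>\<omega>. restrict (\<lambda>i. X i \<omega>) {j}))"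
    using assms by (intro indep_var_compose[OF indep_var_restrict[OF assms(1)]]) auto
  then show ?thesis by (simp add: comp_def)
qed

text \<open>Smaller index minus larger, as in the entries that enter \<open>pfaffian\<close>; with
  starting points that decrease in the index these differences start positive.\<close>

definition gap :: "nat set \<Rightarrow> (nat \<Rightarrow> real) \<Rightarrow> real" where
  "gap b y = y (Min b) - y (Max b)"

text \<open>The index set is any finite set because the argument is run both for all particles and
  for a single pair.\<close>

locale brownian_family = prob_space M for M :: "'a measure" +
  fixes K :: "nat set" and x :: "nat \<Rightarrow> real" and B :: "nat \<Rightarrow> real \<Rightarrow> 'a \<Rightarrow> real"
  assumes finite_K: "finite K"
    and brownian: "\<And>n. n \<in> K \<Longrightarrow> brownian_motion M (x n) (B n)"
    and independent: "independent_processes M K B"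
begin

lemma measurable_B: "n \<in> K \<Longrightarrow> 0 \<le> s \<Longrightarrow> B n s \<in> borel_measurable M"
  and AE_start: "n \<in> K \<Longrightarrow> AE \<omega> in M. B n 0 \<omega> = x n"
  and increment_normal: "n \<in> K \<Longrightarrow> 0 \<le> r \<Longrightarrow> r < s \<Longrightarrow>
    distributed M lborel (\<lambda>\<omega>. B n s \<omega> - B n r \<omega>) (normal_density 0 (sqrt (s - r)))"
  and indep_increments: "n \<in> K \<Longrightarrow> 0 \<le> g 0 \<Longrightarrow> strict_mono_on {..m} g \<Longrightarrow>
    indep_vars (\<lambda>_. borel) (\<lambda>l \<omega>. B n (g (Suc l)) \<omega> - B n (g l) \<omega>) {..<m}"
  and continuous_B: "n \<in> K \<Longrightarrow> \<omega> \<in> space M \<Longrightarrow> continuous_on {0..} (\<lambda>s. B n s \<omega>)"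
  using brownian[of n] by (simp_all add: brownian_motion_def)

lemma AE_start_all: "AE \<omega> in M. \<forall>i\<in>K. B i 0 \<omega> = x i"
  using AE_start finite_K by (intro AE_finite_allI)

text \<open>The vector of grid increments is a measurable function of the path, so independence of
  the paths passes to these vectors.\<close>

lemma indep_all_increments:
  assumes "0 \<le> g 0" "strict_mono_on {..m} g"
  shows "indep_vars (\<lambda>_. borel) (\<lambda>(i, l) \<omega>. B i (g (Suc l)) \<omega> - B i (g l) \<omega>) (K \<times> {..<m})"
proof (rule indep_vars_nested[OF finite_K])
  have pos: "0 \<le> g l" if "l \<le> m" for l
    using assms strict_mono_on_leD[OF assms(2), of 0 l] that by auto
  let ?inc = "\<lambda>f. \<lambda>l\<in>{..<m}. f (g (Suc l)) - f (g l) :: real"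
  have "indep_vars (\<lambda>_. PiM {..<m} (\<lambda>_. borel)) (\<lambda>i \<omega>. ?inc (\<lambda>t\<in>{0..}. B i t \<omega>)) K"
    using independent unfolding independent_processes_def
  proof (rule indep_vars_compose2)
    show "?inc \<in> PiM {0..} (\<lambda>_. borel) \<rightarrow>\<^sub>M PiM {..<m} (\<lambda>_. borel)"
      using pos by (intro measurable_restrict borel_measurable_diff measurable_component_singleton) auto
  qed
  moreover have "?inc (\<lambda>t\<in>{0..}. B i t \<omega>) = (\<lambda>l\<in>{..<m}. B i (g (Suc l)) \<omega> - B i (g l) \<omega>)" for i \<omega>
    using pos by (auto simp: fun_eq_iff)
  ultimately show "indep_vars (\<lambda>_. PiM {..<m} (\<lambda>_. borel))
    (\<lambda>i \<omega>. \<lambda>l\<in>{..<m}. B i (g (Suc l)) \<omega> - B i (g l) \<omega>) K" by simp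
qed (use indep_increments assms in auto)

text \<open>The last increments are independent of the past, on which \<open>h\<close> depends.
  Across disjoint pairs their differences are independent centred Gaussians of variance
  \<open>2 * (g (Suc m) - g m)\<close>, so integrating them out turns a product of values of
  \<theta> into a product of averages.\<close>

lemma markov_grid:
  fixes \<theta> :: "real \<Rightarrow> real" and h :: "(nat \<times> nat \<Rightarrow> real) \<Rightarrow> real"
  assumes g: "g 0 = 0" "strict_mono_on {..Suc m} g"
    and \<pi>: "finite \<pi>" "\<And>b. b \<in> \<pi> \<Longrightarrow> b \<subseteq> K \<and> card b = 2" "disjoint \<pi>"
    and \<theta> [measurable]: "\<theta> \<in> borel_measurable borel" and \<theta>_le: "\<And>z. \<bar>\<theta> z\<bar> \<le> C"
    and h [measurable]: "h \<in> borel_measurable (PiM (K \<times> {..m}) (\<lambda>_. borel))" and h_le: "\<And>y. \<bar>h y\<bar> \<le> C'"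
  shows "(\<integral>\<omega>. (\<Prod>b\<in>\<pi>. \<theta> (gap b (\<lambda>i. B i (g (Suc m)) \<omega>))) * h (\<lambda>(i, l)\<in>K \<times> {..m}. B i (g l) \<omega>) \<partial>M) =
    (\<integral>\<omega>. (\<Prod>b\<in>\<pi>. gauss_avg \<theta> (gap b (\<lambda>i. B i (g m) \<omega>)) (g (Suc m) - g m)) *
      h (\<lambda>(i, l)\<in>K \<times> {..m}. B i (g l) \<omega>) \<partial>M)"
proof (cases "\<pi> = {}")
  case False
  define s where "s = g m"
  define t where "t = g (Suc m)"
  have st: "s < t" unfolding s_def t_def using g(2) by (rule strict_mono_onD) auto
  have g_nonneg: "0 \<le> g l" if "l \<le> Suc m" for l
    using g strict_mono_on_leD[OF g(2), of 0 l] that by auto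
  \<comment> \<open>The standard deviation of the difference of two independent increments from
    \<open>s\<close> to \<open>t\<close>.\<close>
  define c where "c = sqrt (2 * (t - s))"
  have c: "c > 0" using st by (simp add: c_def)
  have ends: "Min b \<in> K" "Max b \<in> K" "Min b \<in> b" "Max b \<in> b" "Min b \<noteq> Max b" if "b \<in> \<pi>" for b
  proof -
    have b: "b \<subseteq> K" "card b = 2" using \<pi>(2)[OF that] by auto
    then have "finite b" "b \<noteq> {}" by (auto intro: card_ge_0_finite)
    then show "Min b \<in> b" "Max b \<in> b" by auto
    then show "Min b \<in> K" "Max b \<in> K" using b by auto
    show "Min b \<noteq> Max b" using b(2) by (auto simp: card_2_iff min_def max_def split: if_splits)
  qed
  define inc where "inc = (\<lambda>(i, l) \<omega>. B i (g (Suc l)) \<omega> - B i (g l) \<omega>)"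
  have ind: "indep_vars (\<lambda>_. borel) inc (K \<times> {..<Suc m})"
    unfolding inc_def using g by (intro indep_all_increments) auto
  \<comment> \<open>\<open>V\<close> collects the increments up to time \<open>s\<close>; increment
    number \<open>m\<close>, from \<open>s\<close> to \<open>t\<close>, goes into
    \<open>W\<close>.\<close>
  define V where "V = (\<lambda>\<omega>. \<lambda>p\<in>K \<times> {..<m}. inc p \<omega>)"
  define W where "W = (\<lambda>\<omega>. \<lambda>p\<in>K \<times> {m}. inc p \<omega>)"
  define Z where "Z = (\<lambda>b \<omega>. (inc (Min b, m) \<omega> - inc (Max b, m) \<omega>) / c)"
  define Zt where "Zt = (\<lambda>\<omega>. \<lambda>b\<in>\<pi>. Z b \<omega>)"
  let ?PV = "PiM (K \<times> {..<m}) (\<lambda>_. borel :: real measure)"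
  let ?P\<pi> = "PiM \<pi> (\<lambda>_. borel :: real measure)"

  have VW: "indep_var ?PV V (PiM (K \<times> {m}) (\<lambda>_. borel)) W"
    unfolding V_def W_def by (intro indep_var_restrict[OF ind]) auto
  let ?PW = "PiM (K \<times> {m}) (\<lambda>_. borel :: real measure)"
  \<comment> \<open>The normalised differences \<open>Zt\<close> are a function of \<open>W\<close>,
    so independence of \<open>V\<close> and \<open>W\<close> separates them from the past.\<close>
  define scaled where "scaled w = (\<lambda>b\<in>\<pi>. (w (Min b, m) - w (Max b, m)) / c)" for w :: "nat \<times> nat \<Rightarrow> real"
  have scaled_meas [measurable]: "scaled \<in> measurable ?PW ?P\<pi>"
    unfolding scaled_def using ends(1,2) by (intro measurable_restrict borel_measurable_divide
        borel_measurable_diff measurable_component_singleton borel_measurable_const) simp_all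
  have scaled_W: "scaled (W \<omega>) = Zt \<omega>" for \<omega>
    using ends(1,2) by (simp add: fun_eq_iff W_def Zt_def Z_def scaled_def)

  have rv_inc: "inc p \<in> borel_measurable M" if "p \<in> K \<times> {..m}" for p
    using ind that by (auto simp: indep_vars_def)
  have Z_distr: "distr M borel (Z b) = std_normal" if b: "b \<in> \<pi>" for b
  proof -
    have normal: "distributed M lborel (inc (i, m)) (normal_density 0 (sqrt (t - s)))" if "i \<in> K" for i
      unfolding inc_def s_def t_def prod.case using that st g_nonneg
      by (intro increment_normal) (auto simp: s_def t_def)
    have "distributed M lborel (\<lambda>\<omega>. inc (Min b, m) \<omega> - inc (Max b, m) \<omega>)
      (normal_density (0 - 0) (sqrt ((sqrt (t - s))\<^sup>2 + (sqrt (t - s))\<^sup>2)))"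
      using ends[OF b] st normal by (intro diff_indep_normal indep_vars_imp_indep_var[OF ind]) auto
    also have "sqrt ((sqrt (t - s))\<^sup>2 + (sqrt (t - s))\<^sup>2) = c"
      using st by (simp add: c_def)
    finally have "distributed M lborel (Z b) std_normal_density"
      using normal_standard_normal_convert[OF c, of "\<lambda>\<omega>. inc (Min b, m) \<omega> - inc (Max b, m) \<omega>" 0]
      by (simp add: Z_def)
    then have "distr M lborel (Z b) = std_normal"
      by (simp add: distributed_def std_normal_def)
    then show ?thesis by (metis distr_cong sets_lborel)
  qed
  have rv_Z: "Z b \<in> borel_measurable M" if "b \<in> \<pi>" for b
    unfolding Z_def using ends[OF that] rv_inc by (intro borel_measurable_divide borel_measurable_diff) auto
  \<comment> \<open>Disjoint blocks use disjoint sets of last increments, so the variables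
    \<open>Z b\<close> are independent.\<close>
  have "disjoint_family_on (\<lambda>b. b \<times> {m}) \<pi>"
    unfolding disjoint_family_on_def using disjointD[OF \<pi>(3)] by (simp add: Times_Int_Times)
  moreover have "b \<times> {m} \<subseteq> K \<times> {..<Suc m}" if "b \<in> \<pi>" for b using \<pi>(2)[OF that] by auto
  ultimately have "indep_vars (\<lambda>b. PiM (b \<times> {m}) (\<lambda>_. borel)) (\<lambda>b \<omega>. \<lambda>p\<in>b \<times> {m}. inc p \<omega>) \<pi>"
    by (intro indep_vars_restrict[OF ind])
  then have "indep_vars (\<lambda>_. borel)
    (\<lambda>b \<omega>. (\<lambda>w. (w (Min b, m) - w (Max b, m)) / c) (\<lambda>p\<in>b \<times> {m}. inc p \<omega>)) \<pi>"
    by (rule indep_vars_compose2)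
      (use ends(3,4) in \<open>intro borel_measurable_divide borel_measurable_diff measurable_component_singleton
        borel_measurable_const; simp\<close>)
  also have "?this \<longleftrightarrow> indep_vars (\<lambda>_. borel) Z \<pi>"
    using ends(3,4) by (intro indep_vars_cong) (simp_all add: Z_def fun_eq_iff)
  finally have "distr M ?P\<pi> Zt = PiM \<pi> (\<lambda>b. distr M borel (Z b))"
    unfolding Zt_def using indep_vars_iff_distr_eq_PiM'[OF False, where M' = "\<lambda>_. borel" and X = Z] rv_Z by simp
  also have "\<dots> = PiM \<pi> (\<lambda>_. std_normal)" using Z_distr by (intro PiM_cong) auto
  finally have Zt_distr: "distr M ?P\<pi> Zt = PiM \<pi> (\<lambda>_. std_normal)" .

  have rv_V [measurable]: "V \<in> measurable M ?PV" and rv_W [measurable]: "W \<in> measurable M ?PW"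
    using VW by (auto simp: indep_var_distribution_eq)
  have rv_Zt [measurable]: "Zt \<in> measurable M ?P\<pi>"
    unfolding scaled_W[symmetric] by measurable

  \<comment> \<open>Grid positions rebuilt from increments with the deterministic start
    \<open>x\<close>. They agree with the true positions only almost surely, because the starting
    value is prescribed almost surely.\<close>
  define pos where "pos v = (\<lambda>(i, l)\<in>K \<times> {..m}. x i + (\<Sum>l'<l. v (i, l')))" for v :: "nat \<times> nat \<Rightarrow> real"
  have pos_component: "(\<lambda>v. pos v (i, l)) \<in> borel_measurable ?PV" if "i \<in> K" "l \<le> m" for i l
  proof -
    have "(\<lambda>v. x i + (\<Sum>l'<l. v (i, l'))) \<in> borel_measurable ?PV"
      using that by (intro borel_measurable_add borel_measurable_const borel_measurable_sum
          measurable_component_singleton) auto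
    then show ?thesis using that by (simp add: pos_def)
  qed
  have pos_meas [measurable]: "pos \<in> measurable ?PV (PiM (K \<times> {..m}) (\<lambda>_. borel))"
    unfolding pos_def
    by (intro measurable_restrict)
      (auto intro!: borel_measurable_add borel_measurable_sum measurable_component_singleton)
  have AE_pos: "AE \<omega> in M. (\<lambda>(i, l)\<in>K \<times> {..m}. B i (g l) \<omega>) = pos (V \<omega>)"
  proof -
    from AE_start_all show ?thesis
    proof eventually_elim
      case (elim \<omega>)
      have "B i (g l) \<omega> = x i + (\<Sum>l'<l. inc (i, l') \<omega>)" if "i \<in> K" for i l
        using elim g(1) that sum_lessThan_telescope[of "\<lambda>l. B i (g l) \<omega>" l] by (simp add: inc_def)
      then show ?case by (auto simp: pos_def V_def fun_eq_iff intro!: sum.cong)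
    qed
  qed
  define G where "G b v = pos v (Min b, m) - pos v (Max b, m)" for b v
  have G_meas [measurable]: "G b \<in> borel_measurable ?PV" if "b \<in> \<pi>" for b
    unfolding G_def using ends[OF that] by (intro borel_measurable_diff pos_component) auto
  define f where "f = (\<lambda>(v, z). (\<Prod>b\<in>\<pi>. \<theta> (G b v + c * z b)) * h (pos v))"
  have f_meas [measurable]: "f \<in> borel_measurable (?PV \<Otimes>\<^sub>M ?P\<pi>)"
  proof -
    have "(\<lambda>p. \<theta> (G b (fst p) + c * snd p b)) \<in> borel_measurable (?PV \<Otimes>\<^sub>M ?P\<pi>)" if [simp]: "b \<in> \<pi>" for b
      using G_meas[OF that] by measurable
    then show ?thesis
      unfolding f_def case_prod_beta by (intro borel_measurable_times borel_measurable_prod) measurable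
  qed
  have f_le: "\<bar>f p\<bar> \<le> C ^ card \<pi> * C'" for p
  proof -
    have "\<bar>\<Prod>b\<in>\<pi>. \<theta> (G b v + c * z b)\<bar> \<le> C ^ card \<pi>" for v z
      unfolding abs_prod using \<theta>_le prod_mono[of \<pi> "\<lambda>b. \<bar>\<theta> (G b v + c * z b)\<bar>" "\<lambda>_. C"] by simp
    moreover have "0 \<le> C" using \<theta>_le[of 0] by linarith
    ultimately show ?thesis
      unfolding f_def case_prod_beta abs_mult using h_le by (intro mult_mono) auto
  qed
  interpret PV: prob_space "distr M ?PV V" by (rule prob_space_distr[OF rv_V])
  interpret PW: prob_space "distr M ?PW W" by (rule prob_space_distr[OF rv_W])
  interpret N: prob_space std_normal by (rule prob_space_std_normal)
  interpret NP: product_prob_space "\<lambda>_. std_normal" \<pi> ..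
  interpret PP: pair_prob_space "distr M ?PV V" "distr M ?PW W" ..
  define F where "F = (\<lambda>(v, w). f (v, scaled w))"
  have F_meas [measurable]: "F \<in> borel_measurable (?PV \<Otimes>\<^sub>M ?PW)"
    unfolding F_def by measurable
  have F_int: "integrable (distr M ?PV V \<Otimes>\<^sub>M distr M ?PW W) F"
    using f_le by (intro PP.integrable_const_bound[where B="C ^ card \<pi> * C'"]) (auto simp: F_def)
  \<comment> \<open>With the past frozen at \<open>v\<close>, the integral over the last increments
    splits over the blocks, since \<open>Zt\<close> has a product law.\<close>
  have inner: "(\<integral>w. F (v, w) \<partial>distr M ?PW W) =
      (\<Prod>b\<in>\<pi>. gauss_avg \<theta> (G b v) (t - s)) * h (pos v)" if "v \<in> space ?PV" for v
  proof -
    have fv: "(\<lambda>z. f (v, z)) \<in> borel_measurable ?P\<pi>"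
      by (rule measurable_compose[OF measurable_Pair1'[OF that] f_meas])
    have "(\<integral>w. F (v, w) \<partial>distr M ?PW W) = (\<integral>\<omega>. f (v, Zt \<omega>) \<partial>M)"
      unfolding scaled_W[symmetric] F_def prod.case
      by (intro integral_distr[OF rv_W] measurable_compose[OF scaled_meas fv])
    also have "\<dots> = (\<integral>z. f (v, z) \<partial>PiM \<pi> (\<lambda>_. std_normal))"
      unfolding Zt_distr[symmetric] by (rule integral_distr[symmetric, OF rv_Zt fv])
    also have "\<dots> = (\<integral>z. (\<Prod>b\<in>\<pi>. \<theta> (G b v + c * z b)) \<partial>PiM \<pi> (\<lambda>_. std_normal)) * h (pos v)"
      by (simp add: f_def)
    also have "(\<integral>z. (\<Prod>b\<in>\<pi>. \<theta> (G b v + c * z b)) \<partial>PiM \<pi> (\<lambda>_. std_normal)) =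
        (\<Prod>b\<in>\<pi>. \<integral>z. \<theta> (G b v + c * z) \<partial>std_normal)"
    proof (rule NP.product_integral_prod[OF \<pi>(1), where f = "\<lambda>b z. \<theta> (G b v + c * z)"])
      show "integrable std_normal (\<lambda>z. \<theta> (G b v + c * z))" for b
      proof (rule N.integrable_const_bound[where B=C])
        show "AE z in std_normal. norm (\<theta> (G b v + c * z)) \<le> C" by (simp add: \<theta>_le)
        show "(\<lambda>z. \<theta> (G b v + c * z)) \<in> borel_measurable std_normal" by measurable
      qed
    qed
    finally show ?thesis by (simp add: gauss_avg_def c_def)
  qed
  let ?Q = "\<lambda>\<omega>. \<lambda>(i, l)\<in>K \<times> {..m}. B i (g l) \<omega>"
  have gapV: "gap b (\<lambda>i. B i (g m) \<omega>) = G b (V \<omega>)" if "?Q \<omega> = pos (V \<omega>)" "b \<in> \<pi>" for b \<omega>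
    unfolding G_def that(1)[symmetric] using ends[OF that(2)] by (simp add: gap_def)
  have gapZ: "gap b (\<lambda>i. B i (g (Suc m)) \<omega>) = G b (V \<omega>) + c * Zt \<omega> b" if "?Q \<omega> = pos (V \<omega>)" "b \<in> \<pi>" for b \<omega>
    unfolding gapV[OF that, symmetric] using c that(2) by (simp add: gap_def Zt_def Z_def inc_def)
  have rv_Q: "?Q \<in> measurable M (PiM (K \<times> {..m}) (\<lambda>_. borel))"
    using measurable_B g_nonneg by (intro measurable_restrict) auto
  have rv_gap: "(\<lambda>\<omega>. gap b (\<lambda>i. B i (g l) \<omega>)) \<in> borel_measurable M" if "b \<in> \<pi>" "l \<le> Suc m" for b l
    unfolding gap_def using ends[OF that(1)] g_nonneg[OF that(2)] by (intro borel_measurable_diff measurable_B)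
  have "(\<integral>\<omega>. (\<Prod>b\<in>\<pi>. \<theta> (gap b (\<lambda>i. B i (g (Suc m)) \<omega>))) * h (?Q \<omega>) \<partial>M) = (\<integral>\<omega>. f (V \<omega>, Zt \<omega>) \<partial>M)"
  proof (rule integral_cong_AE)
    show "(\<lambda>\<omega>. (\<Prod>b\<in>\<pi>. \<theta> (gap b (\<lambda>i. B i (g (Suc m)) \<omega>))) * h (?Q \<omega>)) \<in> borel_measurable M"
      by (intro borel_measurable_times borel_measurable_prod measurable_compose[OF rv_gap \<theta>] measurable_compose[OF rv_Q h]) auto
    show "AE \<omega> in M. (\<Prod>b\<in>\<pi>. \<theta> (gap b (\<lambda>i. B i (g (Suc m)) \<omega>))) * h (?Q \<omega>) = f (V \<omega>, Zt \<omega>)"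
      using AE_pos by eventually_elim (simp add: f_def gapZ)
  qed measurable
  also have "\<dots> = (\<integral>\<omega>. F (V \<omega>, W \<omega>) \<partial>M)" by (simp add: F_def scaled_W)
  also have "\<dots> = integral\<^sup>L (distr M (?PV \<Otimes>\<^sub>M ?PW) (\<lambda>\<omega>. (V \<omega>, W \<omega>))) F"
    by (subst integral_distr) auto
  also have "distr M (?PV \<Otimes>\<^sub>M ?PW) (\<lambda>\<omega>. (V \<omega>, W \<omega>)) = distr M ?PV V \<Otimes>\<^sub>M distr M ?PW W"
    using VW unfolding indep_var_distribution_eq by simp
  also have "integral\<^sup>L \<dots> F = (\<integral>v. \<integral>w. F (v, w) \<partial>distr M ?PW W \<partial>distr M ?PV V)"
    by (rule PP.integral_fst'[OF F_int, symmetric])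
  also have "\<dots> = (\<integral>v. (\<Prod>b\<in>\<pi>. gauss_avg \<theta> (G b v) (t - s)) * h (pos v) \<partial>distr M ?PV V)"
    by (intro Bochner_Integration.integral_cong refl inner) simp
  also have "\<dots> = (\<integral>\<omega>. (\<Prod>b\<in>\<pi>. gauss_avg \<theta> (G b (V \<omega>)) (t - s)) * h (pos (V \<omega>)) \<partial>M)"
    by (rule integral_distr[OF rv_V])
      (intro borel_measurable_times borel_measurable_prod measurable_compose[OF G_meas] borel_measurable_gauss_avg \<theta>
        measurable_compose[OF pos_meas h])
  also have "\<dots> = (\<integral>\<omega>. (\<Prod>b\<in>\<pi>. gauss_avg \<theta> (gap b (\<lambda>i. B i (g m) \<omega>)) (t - s)) * h (?Q \<omega>) \<partial>M)"
  proof (rule integral_cong_AE)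
    show "(\<lambda>\<omega>. (\<Prod>b\<in>\<pi>. gauss_avg \<theta> (G b (V \<omega>)) (t - s)) * h (pos (V \<omega>))) \<in> borel_measurable M"
      by (intro borel_measurable_times borel_measurable_prod measurable_compose[OF rv_V]
          measurable_compose[OF G_meas] borel_measurable_gauss_avg \<theta> measurable_compose[OF pos_meas h])
    show "(\<lambda>\<omega>. (\<Prod>b\<in>\<pi>. gauss_avg \<theta> (gap b (\<lambda>i. B i (g m) \<omega>)) (t - s)) * h (?Q \<omega>)) \<in> borel_measurable M"
      by (intro borel_measurable_times borel_measurable_prod measurable_compose[OF rv_gap]
          borel_measurable_gauss_avg \<theta> measurable_compose[OF rv_Q h]) auto
    show "AE \<omega> in M. (\<Prod>b\<in>\<pi>. gauss_avg \<theta> (G b (V \<omega>)) (t - s)) * h (pos (V \<omega>)) =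
      (\<Prod>b\<in>\<pi>. gauss_avg \<theta> (gap b (\<lambda>i. B i (g m) \<omega>)) (t - s)) * h (?Q \<omega>)"
      using AE_pos by eventually_elim (simp add: gapV)
  qed
  finally show ?thesis unfolding s_def t_def .
qed simp

end

section \<open>Survival without a meeting\<close>

text \<open>Dominated convergence is applied twice, along the decreasing sets in \<open>n\<close>
  and then the increasing ones in \<open>m\<close>. Sets of this shape describe strict positivity of
  a continuous path on an interval.\<close>

lemma integral_Union_Inter_eq:
  fixes f g :: "'a \<Rightarrow> real"
  assumes int: "integrable M f" "integrable M g"
    and A: "\<And>m n. A m n \<in> sets M"
    and dec: "\<And>m. decseq (A m)" and inc: "incseq (\<lambda>m. \<Inter>n. A m n)"
    and eq: "\<And>m n. (\<integral>\<omega>. f \<omega> * indicator (A m n) \<omega> \<partial>M) = (\<integral>\<omega>. g \<omega> * indicator (A m n) \<omega> \<partial>M)"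
  shows "(\<integral>\<omega>. f \<omega> * indicator (\<Union>m. \<Inter>n. A m n) \<omega> \<partial>M) = (\<integral>\<omega>. g \<omega> * indicator (\<Union>m. \<Inter>n. A m n) \<omega> \<partial>M)"
proof -
  have lim: "(\<lambda>n. \<integral>\<omega>. h \<omega> * indicator (X n) \<omega> \<partial>M) \<longlonglongrightarrow> (\<integral>\<omega>. h \<omega> * indicator Y \<omega> \<partial>M)"
    if "integrable M h" "\<And>n. X n \<in> sets M" "Y \<in> sets M"
      and conv: "\<And>\<omega>. (\<lambda>n. indicator (X n) \<omega> :: real) \<longlonglongrightarrow> indicator Y \<omega>" for h :: "'a \<Rightarrow> real" and X Y
  proof (rule integral_dominated_convergence[where w = "\<lambda>\<omega>. \<bar>h \<omega>\<bar>"])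
    show "AE \<omega> in M. (\<lambda>n. h \<omega> * indicator (X n) \<omega>) \<longlonglongrightarrow> h \<omega> * indicator Y \<omega>"
      using conv by (intro AE_I2 tendsto_mult tendsto_const)
  qed (use that in \<open>auto split: split_indicator\<close>)
  have Int: "(\<integral>\<omega>. f \<omega> * indicator (\<Inter>n. A m n) \<omega> \<partial>M) = (\<integral>\<omega>. g \<omega> * indicator (\<Inter>n. A m n) \<omega> \<partial>M)" for m
    using lim[OF int(1), of "A m" "\<Inter>n. A m n"] lim[OF int(2), of "A m" "\<Inter>n. A m n"] eq A
      LIMSEQ_indicator_decseq[OF dec, of m] by (auto intro: LIMSEQ_unique)
  have sets: "(\<Inter>n. A m n) \<in> sets M" "(\<Union>m. \<Inter>n. A m n) \<in> sets M" for m
    using A by auto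
  have conv: "(\<lambda>m. indicator (\<Inter>n. A m n) \<omega> :: real) \<longlonglongrightarrow> indicator (\<Union>m. \<Inter>n. A m n) \<omega>" for \<omega>
    using inc by (rule LIMSEQ_indicator_incseq)
  have f: "(\<lambda>m. \<integral>\<omega>. f \<omega> * indicator (\<Inter>n. A m n) \<omega> \<partial>M) \<longlonglongrightarrow> (\<integral>\<omega>. f \<omega> * indicator (\<Union>m. \<Inter>n. A m n) \<omega> \<partial>M)"
    by (rule lim[OF int(1) sets conv])
  have g: "(\<lambda>m. \<integral>\<omega>. g \<omega> * indicator (\<Inter>n. A m n) \<omega> \<partial>M) \<longlonglongrightarrow> (\<integral>\<omega>. g \<omega> * indicator (\<Union>m. \<Inter>n. A m n) \<omega> \<partial>M)"
    by (rule lim[OF int(2) sets conv])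
  show ?thesis using f[unfolded Int] g by (rule LIMSEQ_unique)
qed

lemma abs_prod_le_power:
  fixes f :: "'b \<Rightarrow> real"
  assumes "\<And>b. \<bar>f b\<bar> \<le> C"
  shows "\<bar>\<Prod>b\<in>\<pi>. f b\<bar> \<le> C ^ card \<pi>"
  unfolding abs_prod using assms prod_mono[of \<pi> "\<lambda>b. \<bar>f b\<bar>" "\<lambda>_. C"] by simp

text \<open>Positivity at grid points alone would not exclude a zero between them; a fixed bound
  \<open>1 / real (Suc m)\<close> survives the limit of finer grids. The grid divides [0, s] rather
  than [0, r], so that \<open>s\<close>, from which the Markov property continues, is a grid
  point.\<close>

definition grid_positive :: "'a measure \<Rightarrow> (real \<Rightarrow> 'a \<Rightarrow> real) \<Rightarrow> real \<Rightarrow> real \<Rightarrow> nat \<Rightarrow> nat \<Rightarrow> 'a set" where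
  "grid_positive M f s r m n = {\<omega>\<in>space M. \<forall>j\<le>2^n. s * real j / 2^n \<le> r \<longrightarrow> 1 / real (Suc m) \<le> f (s * real j / 2^n) \<omega>}"

lemma sets_grid_positive:
  assumes "0 < s" and meas: "\<And>u. 0 \<le> u \<Longrightarrow> f u \<in> borel_measurable M"
  shows "grid_positive M f s r m n \<in> sets M"
proof -
  have [measurable]: "f (s * real j / 2^n) \<in> borel_measurable M" for j
    using assms(1) by (intro meas) auto
  show ?thesis unfolding grid_positive_def by measurable
qed

lemma decseq_grid_positive: "decseq (grid_positive M f s r m)"
proof (rule decseq_SucI, rule subsetI)
  fix n \<omega> assume \<omega>: "\<omega> \<in> grid_positive M f s r m (Suc n)"
  have "1 / real (Suc m) \<le> f (s * real j / 2^n) \<omega>" if "j \<le> 2^n" "s * real j / 2^n \<le> r" for j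
  proof -
    have "s * real (2 * j) / 2 ^ Suc n = s * real j / 2^n" "2 * j \<le> 2 ^ Suc n"
      using that(1) by simp_all
    moreover have "s * real (2 * j) / 2 ^ Suc n \<le> r \<longrightarrow>
      1 / real (Suc m) \<le> f (s * real (2 * j) / 2 ^ Suc n) \<omega>" if "2 * j \<le> 2 ^ Suc n"
      using \<omega> that unfolding grid_positive_def by blast
    ultimately show ?thesis using that(2) by simp
  qed
  then show "\<omega> \<in> grid_positive M f s r m n" using \<omega> by (simp add: grid_positive_def)
qed

lemma incseq_grid_positive: "incseq (\<lambda>m. \<Inter>n. grid_positive M f s r m n)"
proof (rule incseq_SucI)
  fix m
  have "1 / real (Suc (Suc m)) \<le> 1 / real (Suc m)" by (simp add: frac_le)
  then show "(\<Inter>n. grid_positive M f s r m n) \<subseteq> (\<Inter>n. grid_positive M f s r (Suc m) n)"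
    unfolding grid_positive_def by (auto 0 3 intro: order_trans)
qed

text \<open>A continuous positive path attains a positive minimum on the compact interval, which
  gives \<open>m\<close>. Conversely, a lower bound on dense grid points passes to limits.\<close>

lemma positive_on_eq_grid:
  fixes f :: "real \<Rightarrow> 'b \<Rightarrow> real"
  assumes "0 \<le> r" "r \<le> s" "0 < s"
    and path: "\<And>\<omega>. \<omega> \<in> space M \<Longrightarrow> continuous_on {0..} (\<lambda>u. f u \<omega>)"
  shows "{\<omega>\<in>space M. \<forall>u\<in>{0..r}. 0 < f u \<omega>} = (\<Union>m. \<Inter>n. grid_positive M f s r m n)"
proof (intro equalityI subsetI)
  fix \<omega> assume \<omega>: "\<omega> \<in> {\<omega>\<in>space M. \<forall>u\<in>{0..r}. 0 < f u \<omega>}"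
  then have sp: "\<omega> \<in> space M" by simp
  have cont: "continuous_on {0..r} (\<lambda>u. f u \<omega>)"
    using path[OF sp] by (rule continuous_on_subset) auto
  have "{0..r} \<noteq> {}" using assms by auto
  then obtain u where u: "u \<in> {0..r}" "\<And>v. v \<in> {0..r} \<Longrightarrow> f u \<omega> \<le> f v \<omega>"
    using continuous_attains_inf[OF compact_Icc _ cont] by blast
  then have "0 < f u \<omega>" using \<omega> by simp
  then obtain m where m: "1 / real (Suc m) < f u \<omega>"
    using nat_approx_posE by metis
  have "\<omega> \<in> grid_positive M f s r m n" for n
    unfolding grid_positive_def
  proof (intro CollectI conjI sp allI impI)
    fix j assume "s * real j / 2^n \<le> r"
    then have "s * real j / 2^n \<in> {0..r}" using assms by simp
    then have "f u \<omega> \<le> f (s * real j / 2^n) \<omega>" by (rule u(2))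
    then show "1 / real (Suc m) \<le> f (s * real j / 2^n) \<omega>" using m by linarith
  qed
  then show "\<omega> \<in> (\<Union>m. \<Inter>n. grid_positive M f s r m n)" by blast
next
  fix \<omega> assume "\<omega> \<in> (\<Union>m. \<Inter>n. grid_positive M f s r m n)"
  then obtain m where m: "\<And>n. \<omega> \<in> grid_positive M f s r m n" by blast
  then have sp: "\<omega> \<in> space M" by (simp add: grid_positive_def)
  have "0 < f u \<omega>" if u: "u \<in> {0..r}" for u
  proof -
    \<comment> \<open>The last grid point not after \<open>u\<close>: approximation from below keeps
      \<open>v n \<le> r\<close>, where the grid condition applies.\<close>
    define j where "j n = nat \<lfloor>u / s * 2^n\<rfloor>" for n :: nat
    define v where "v n = s * real (j n) / 2^n" for n
    have j: "real (j n) \<le> u / s * 2^n" "u / s * 2^n < real (j n) + 1" for n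
      using u assms unfolding j_def by (auto simp: of_nat_nat)
    have v: "v n \<le> u" "u - s / 2^n \<le> v n" "0 \<le> v n" for n
    proof -
      have u_eq: "u = s * (u / s * 2^n) / 2^n" using assms by simp
      show "v n \<le> u"
        unfolding v_def by (subst u_eq) (use j(1)[of n] assms in \<open>intro divide_right_mono mult_left_mono; simp\<close>)
      have "u \<le> s * (real (j n) + 1) / 2^n"
        by (subst u_eq) (use j(2)[of n] assms in \<open>intro divide_right_mono mult_left_mono; simp\<close>)
      then show "u - s / 2^n \<le> v n" by (simp add: v_def distrib_left add_divide_distrib)
      show "0 \<le> v n" using assms by (simp add: v_def)
    qed
    have "(\<lambda>n. u - s / 2^n) \<longlonglongrightarrow> u - s * 0"
      unfolding divide_inverse power_inverse[symmetric]
      by (intro tendsto_intros LIMSEQ_realpow_zero) auto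
    then have low: "(\<lambda>n. u - s / 2^n) \<longlonglongrightarrow> u" by simp
    have "\<forall>\<^sub>F n in sequentially. u - s / 2^n \<le> v n" "\<forall>\<^sub>F n in sequentially. v n \<le> u"
      using v by simp_all
    then have lim: "v \<longlonglongrightarrow> u" by (rule tendsto_sandwich[OF _ _ low tendsto_const])
    have "(\<lambda>n. f (v n) \<omega>) \<longlonglongrightarrow> f u \<omega>"
      by (rule continuous_on_tendsto_compose[OF path[OF sp] lim]) (use u v(3) in simp_all)
    moreover have "1 / real (Suc m) \<le> f (v n) \<omega>" for n
    proof -
      have "real (j n) \<le> 2^n"
      proof -
        have "u / s * 2^n \<le> 1 * 2^n" using u assms by (intro mult_right_mono) auto
        then show ?thesis using j(1)[of n] by linarith
      qed
      then have "j n \<le> 2^n" by (metis of_nat_le_iff of_nat_numeral of_nat_power)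
      moreover have "s * real (j n) / 2^n \<le> r" using v(1)[of n] u by (simp add: v_def)
      ultimately show ?thesis using m[of n] by (simp add: grid_positive_def v_def)
    qed
    ultimately have "1 / real (Suc m) \<le> f u \<omega>" by (intro LIMSEQ_le_const) auto
    then show ?thesis by (rule less_le_trans[rotated]) simp
  qed
  then show "\<omega> \<in> {\<omega>\<in>space M. \<forall>u\<in>{0..r}. 0 < f u \<omega>}" using sp by simp
qed

lemma sets_positive_on:
  fixes f :: "real \<Rightarrow> 'b \<Rightarrow> real"
  assumes meas: "\<And>u. 0 \<le> u \<Longrightarrow> f u \<in> borel_measurable M"
    and path: "\<And>\<omega>. \<omega> \<in> space M \<Longrightarrow> continuous_on {0..} (\<lambda>u. f u \<omega>)"
  shows "{\<omega>\<in>space M. \<forall>u\<in>{0..r}. 0 < f u \<omega>} \<in> sets M"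
proof (cases "0 \<le> r")
  case True
  \<comment> \<open>Length \<open>r + 1\<close> keeps the grid non-degenerate also for
    \<open>r = 0\<close>.\<close>
  then have "{\<omega>\<in>space M. \<forall>u\<in>{0..r}. 0 < f u \<omega>} = (\<Union>m. \<Inter>n. grid_positive M f (r + 1) r m n)"
    using path by (intro positive_on_eq_grid) auto
  then show ?thesis using sets_grid_positive[OF _ meas, of "r + 1"] True by auto
qed simp

section \<open>The survival event and the Markov property on it\<close>

context brownian_family
begin

text \<open>A single continuous function of the configuration whose zeros are the collisions on the
  circle, since sin (\<pi> z) vanishes exactly at the integers. It reduces all pairwise meetings to
  the zeros of one scalar path.\<close>

definition separation :: "(nat \<Rightarrow> real) \<Rightarrow> real" where
  "separation y = (\<Prod>(i, j)\<in>{(i, j)\<in>K \<times> K. i < j}. \<bar>sin ((y i - y j) * pi)\<bar>)"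

abbreviation sep :: "real \<Rightarrow> 'a \<Rightarrow> real" where
  "sep s \<omega> \<equiv> separation (\<lambda>i. B i s \<omega>)"

lemma finite_pairs: "finite {(i, j)\<in>K \<times> K. i < j}"
  by (rule finite_subset[of _ "K \<times> K"]) (use finite_K in auto)

lemma separation_nonneg: "0 \<le> separation y"
  unfolding separation_def by (intro prod_nonneg) auto

lemma separation_eq_0_iff:
  "separation y = 0 \<longleftrightarrow> (\<exists>i\<in>K. \<exists>j\<in>K. i < j \<and> y i - y j \<in> \<int>)"
  unfolding separation_def using finite_pairs by (auto simp: sin_times_pi_eq_0)

lemma separation_pos_iff:
  "0 < separation y \<longleftrightarrow> (\<forall>i\<in>K. \<forall>j\<in>K. i < j \<longrightarrow> y i - y j \<notin> \<int>)"
  using separation_nonneg[of y] separation_eq_0_iff[of y] by (auto simp: less_le)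

lemma separation_cong: "(\<And>i. i \<in> K \<Longrightarrow> y i = z i) \<Longrightarrow> separation y = separation z"
  unfolding separation_def by (intro prod.cong) auto

lemma borel_measurable_separation:
  assumes "\<And>i. i \<in> K \<Longrightarrow> (\<lambda>y. f y i) \<in> borel_measurable N"
  shows "(\<lambda>y. separation (f y)) \<in> borel_measurable N"
  unfolding separation_def
proof (rule borel_measurable_prod)
  fix p assume "p \<in> {(i, j)\<in>K \<times> K. i < j}"
  then obtain i j where p: "p = (i, j)" "i \<in> K" "j \<in> K" by auto
  note [measurable] = assms[OF p(2)] assms[OF p(3)]
  show "(\<lambda>y. case p of (i, j) \<Rightarrow> \<bar>sin ((f y i - f y j) * pi)\<bar>) \<in> borel_measurable N"
    unfolding p(1) prod.case by measurable
qed

lemma measurable_sep: "0 \<le> s \<Longrightarrow> sep s \<in> borel_measurable M"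
  by (intro borel_measurable_separation measurable_B)

lemma continuous_sep: "\<omega> \<in> space M \<Longrightarrow> continuous_on {0..} (\<lambda>s. sep s \<omega>)"
  unfolding separation_def case_prod_beta
  by (intro continuous_on_prod continuous_intros continuous_B) auto

definition apart :: "real \<Rightarrow> 'a set" where
  "apart r = {\<omega>\<in>space M. \<forall>u\<in>{0..r}. 0 < sep u \<omega>}"

lemma sets_apart: "apart r \<in> sets M"
  unfolding apart_def by (intro sets_positive_on measurable_sep continuous_sep)

lemma pair_ends_in:
  assumes "b \<subseteq> K" "card b = 2"
  shows "Min b \<in> K" "Max b \<in> K"
proof -
  have "finite b" "b \<noteq> {}" using assms by (auto intro: card_ge_0_finite)
  then show "Min b \<in> K" "Max b \<in> K" using assms(1) Min_in Max_in by blast+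
qed

lemma measurable_gap:
  assumes "b \<subseteq> K" "card b = 2" "0 \<le> u"
  shows "(\<lambda>\<omega>. gap b (\<lambda>i. B i u \<omega>)) \<in> borel_measurable M"
  using pair_ends_in[OF assms(1,2)] assms(3) unfolding gap_def by (intro borel_measurable_diff measurable_B)

text \<open>Survival up to \<open>r \<le> s\<close> belongs to the past of \<open>s\<close> but
  involves uncountably many times. The one-step property applies on each grid event, and
  \<open>apart r\<close> is reached from these by monotone limits.\<close>

lemma markov_apart:
  fixes \<theta> :: "real \<Rightarrow> real"
  assumes r: "0 \<le> r" "r \<le> s" and st: "0 < s" "s \<le> t"
    and \<pi>: "finite \<pi>" "\<And>b. b \<in> \<pi> \<Longrightarrow> b \<subseteq> K \<and> card b = 2" "disjoint \<pi>"
    and \<theta> [measurable]: "\<theta> \<in> borel_measurable borel" and \<theta>_le: "\<And>z. \<bar>\<theta> z\<bar> \<le> C"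
  shows "(\<integral>\<omega>. (\<Prod>b\<in>\<pi>. \<theta> (gap b (\<lambda>i. B i t \<omega>))) * indicator (apart r) \<omega> \<partial>M) =
    (\<integral>\<omega>. (\<Prod>b\<in>\<pi>. gauss_avg \<theta> (gap b (\<lambda>i. B i s \<omega>)) (t - s)) * indicator (apart r) \<omega> \<partial>M)"
proof (cases "s = t")
  case False
  then have "s < t" using st by simp
  have meas_gap: "(\<lambda>\<omega>. gap b (\<lambda>i. B i u \<omega>)) \<in> borel_measurable M" if "b \<in> \<pi>" "0 \<le> u" for b u
    using \<pi>(2)[OF that(1)] that(2) by (intro measurable_gap) auto
  have prod_le: "\<bar>\<Prod>b\<in>\<pi>. f b :: real\<bar> \<le> C ^ card \<pi>" if "\<And>b. \<bar>f b\<bar> \<le> C" for f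
    using that by (rule abs_prod_le_power)
  have int: "integrable M (\<lambda>\<omega>. \<Prod>b\<in>\<pi>. \<theta> (gap b (\<lambda>i. B i t \<omega>)))"
    "integrable M (\<lambda>\<omega>. \<Prod>b\<in>\<pi>. gauss_avg \<theta> (gap b (\<lambda>i. B i s \<omega>)) (t - s))"
  proof -
    have "(\<lambda>\<omega>. \<Prod>b\<in>\<pi>. \<theta> (gap b (\<lambda>i. B i t \<omega>))) \<in> borel_measurable M"
      using st by (intro borel_measurable_prod measurable_compose[OF meas_gap \<theta>]) auto
    then show "integrable M (\<lambda>\<omega>. \<Prod>b\<in>\<pi>. \<theta> (gap b (\<lambda>i. B i t \<omega>)))"
      by (rule integrable_const_bound[where B = "C ^ card \<pi>", rotated]) (simp add: prod_le \<theta>_le)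
    have "(\<lambda>\<omega>. \<Prod>b\<in>\<pi>. gauss_avg \<theta> (gap b (\<lambda>i. B i s \<omega>)) (t - s)) \<in> borel_measurable M"
      using st by (intro borel_measurable_prod measurable_compose[OF meas_gap] borel_measurable_gauss_avg \<theta>) auto
    then show "integrable M (\<lambda>\<omega>. \<Prod>b\<in>\<pi>. gauss_avg \<theta> (gap b (\<lambda>i. B i s \<omega>)) (t - s))"
      by (rule integrable_const_bound[where B = "C ^ card \<pi>", rotated])
        (simp add: prod_le abs_gauss_avg_le[OF \<theta> \<theta>_le])
  qed
  have grid: "(\<integral>\<omega>. (\<Prod>b\<in>\<pi>. \<theta> (gap b (\<lambda>i. B i t \<omega>))) * indicator (grid_positive M sep s r m n) \<omega> \<partial>M) =
    (\<integral>\<omega>. (\<Prod>b\<in>\<pi>. gauss_avg \<theta> (gap b (\<lambda>i. B i s \<omega>)) (t - s)) * indicator (grid_positive M sep s r m n) \<omega> \<partial>M)" for m n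
  proof -
    \<comment> \<open>The dyadic grid of [0, s] with \<open>t\<close> as one further point, so that
      the last increment runs from \<open>s\<close> to \<open>t\<close>.\<close>
    define g where "g l = (if l \<le> 2^n then s * real l / 2^n else t)" for l :: nat
    define h where "h y = (if \<forall>l\<in>{..2^n}. s * real l / 2^n \<le> r \<longrightarrow>
      1 / real (Suc m) \<le> separation (\<lambda>i. y (i, l)) then 1 else 0 :: real)" for y :: "nat \<times> nat \<Rightarrow> real"
    have g0: "g 0 = 0" and g1: "g (2^n) = s" and g2: "g (Suc (2^n)) = t" by (simp_all add: g_def)
    have g_lt: "g a < g b" if "a < b" "b \<le> Suc (2^n)" for a b
    proof (cases "b \<le> 2^n")
      case True
      then show ?thesis using that st by (simp add: g_def divide_strict_right_mono)
    next
      case False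
      then have "a \<le> 2^n" "g b = t" using that by (auto simp: g_def)
      moreover have "s * real a / 2^n \<le> s"
      proof -
        have "real a \<le> 2^n" using \<open>a \<le> 2^n\<close> by (metis of_nat_le_iff of_nat_numeral of_nat_power)
        then show ?thesis using st by (simp add: field_simps)
      qed
      ultimately show ?thesis using \<open>s < t\<close> by (simp add: g_def)
    qed
    have mono: "strict_mono_on {..Suc (2^n)} g" by (rule strict_mono_onI) (use g_lt in auto)
    have h: "h \<in> borel_measurable (PiM (K \<times> {..2^n}) (\<lambda>_. borel))"
    proof -
      have [measurable]: "(\<lambda>y. separation (\<lambda>i. y (i, l))) \<in> borel_measurable (PiM (K \<times> {..2^n}) (\<lambda>_. borel))"
        if "l \<in> {..2^n}" for l
        using that by (intro borel_measurable_separation measurable_component_singleton) auto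
      show ?thesis unfolding h_def by measurable
    qed
    have "h (\<lambda>(i, l)\<in>K \<times> {..2^n}. B i (g l) \<omega>) = indicator (grid_positive M sep s r m n) \<omega>" if "\<omega> \<in> space M" for \<omega>
    proof -
      have "separation (\<lambda>i. (\<lambda>(i, l)\<in>K \<times> {..2^n}. B i (g l) \<omega>) (i, l)) = sep (s * real l / 2^n) \<omega>" if "l \<le> 2^n" for l
        using that by (intro separation_cong) (simp add: g_def)
      then show ?thesis using that by (auto simp: h_def grid_positive_def indicator_def)
    qed
    then have h_eq: "(\<integral>\<omega>. f \<omega> * h (\<lambda>(i, l)\<in>K \<times> {..2^n}. B i (g l) \<omega>) \<partial>M) =
        (\<integral>\<omega>. f \<omega> * indicator (grid_positive M sep s r m n) \<omega> \<partial>M)" for f :: "'a \<Rightarrow> real"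
      by (intro Bochner_Integration.integral_cong refl) simp
    have "\<bar>h y\<bar> \<le> 1" for y by (simp add: h_def)
    from markov_grid[OF g0 mono \<pi> \<theta> \<theta>_le h this]
    show ?thesis unfolding h_eq g1 g2 .
  qed
  have apart_eq: "apart r = (\<Union>m. \<Inter>n. grid_positive M sep s r m n)"
    unfolding apart_def by (intro positive_on_eq_grid r st continuous_sep)
  show ?thesis
    unfolding apart_eq
    by (rule integral_Union_Inter_eq[OF int sets_grid_positive[OF st(1) measurable_sep]
          decseq_grid_positive incseq_grid_positive grid])
qed simp

end

section \<open>Optional stopping at the first meeting\<close>

context brownian_family
begin

text \<open>A real number, and therefore meaningful only for paths that do meet; wherever its value
  matters, \<omega> lies outside some \<open>apart t\<close>.\<close>

definition hit :: "'a \<Rightarrow> real" where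
  "hit \<omega> = Inf {r\<in>{0..}. sep r \<omega> = 0}"

text \<open>By continuity the zero set of \<open>sep\<close> is closed, so the infimum is attained;
  absence of a meeting at time 0 makes it positive.\<close>

lemma hit:
  assumes "\<omega> \<in> apart 0" "\<omega> \<notin> apart t"
  shows "0 < hit \<omega>" "hit \<omega> \<le> t" "sep (hit \<omega>) \<omega> = 0"
    and apart_iff_less_hit: "\<And>r. 0 \<le> r \<Longrightarrow> \<omega> \<in> apart r \<longleftrightarrow> r < hit \<omega>"
proof -
  let ?S = "{r\<in>{0..}. sep r \<omega> = 0}"
  have sp: "\<omega> \<in> space M" using assms(1) by (simp add: apart_def)
  have closed: "closed ?S"
    using continuous_sep[OF sp] by (intro continuous_closed_preimage_constant) auto
  have bdd: "bdd_below ?S" by (rule bdd_belowI[of _ 0]) auto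
  have in_S: "u \<in> ?S" if "0 \<le> u" "\<not> 0 < sep u \<omega>" for u
    using that separation_nonneg[of "\<lambda>i. B i u \<omega>"] by simp
  obtain u where u: "u \<in> {0..t}" "\<not> 0 < sep u \<omega>" using assms(2) sp by (auto simp: apart_def)
  have "?S \<noteq> {}" using in_S[of u] u by auto
  then have hS: "hit \<omega> \<in> ?S" unfolding hit_def by (rule closed_contains_Inf[OF _ bdd closed])
  have le: "hit \<omega> \<le> v" if "v \<in> ?S" for v
    unfolding hit_def using that bdd by (rule cInf_lower)
  have "0 < sep 0 \<omega>" using assms(1) by (simp add: apart_def)
  then have "hit \<omega> \<noteq> 0" using hS by auto
  then show "0 < hit \<omega>" using hS by auto
  show "hit \<omega> \<le> t" using le[OF in_S[of u]] u by auto
  show "sep (hit \<omega>) \<omega> = 0" using hS by simp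
  show "\<omega> \<in> apart r \<longleftrightarrow> r < hit \<omega>" if "0 \<le> r" for r
  proof
    assume "\<omega> \<in> apart r"
    show "r < hit \<omega>"
    proof (rule ccontr)
      assume "\<not> r < hit \<omega>"
      then have "hit \<omega> \<in> {0..r}" using hS by auto
      then have "0 < sep (hit \<omega>) \<omega>" using \<open>\<omega> \<in> apart r\<close> unfolding apart_def by blast
      then show False using hS by simp
    qed
  next
    assume r: "r < hit \<omega>"
    have "0 < sep v \<omega>" if "v \<in> {0..r}" for v
    proof (rule ccontr)
      assume "\<not> 0 < sep v \<omega>"
      then have "hit \<omega> \<le> v" using that by (intro le in_S) auto
      then show False using that r by auto
    qed
    then show "\<omega> \<in> apart r" using sp by (simp add: apart_def)
  qed
qed

text \<open>The Markov property on the grid consisting of 0 and \<open>t\<close>, with the constant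
  1 as function of the past.\<close>

lemma integral_terminal:
  fixes \<theta> :: "real \<Rightarrow> real"
  assumes "0 < t"
    and \<pi>: "finite \<pi>" "\<And>b. b \<in> \<pi> \<Longrightarrow> b \<subseteq> K \<and> card b = 2" "disjoint \<pi>"
    and \<theta> [measurable]: "\<theta> \<in> borel_measurable borel" and \<theta>_le: "\<And>z. \<bar>\<theta> z\<bar> \<le> C"
  shows "(\<integral>\<omega>. (\<Prod>b\<in>\<pi>. \<theta> (gap b (\<lambda>i. B i t \<omega>))) \<partial>M) = (\<Prod>b\<in>\<pi>. gauss_avg \<theta> (gap b x) t)"
proof -
  define g where "g l = t * real l" for l
  have g: "g 0 = 0" "strict_mono_on {..Suc 0} g" and g1: "g (Suc 0) = t"
    using \<open>0 < t\<close> by (auto simp: g_def strict_mono_on_def)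
  have "(\<integral>\<omega>. (\<Prod>b\<in>\<pi>. \<theta> (gap b (\<lambda>i. B i t \<omega>))) \<partial>M) =
      (\<integral>\<omega>. (\<Prod>b\<in>\<pi>. gauss_avg \<theta> (gap b (\<lambda>i. B i 0 \<omega>)) t) \<partial>M)"
    using markov_grid[OF g \<pi> \<theta> \<theta>_le, where h = "\<lambda>_. 1" and C' = 1] unfolding g1 g(1) by simp
  also have "\<dots> = (\<integral>\<omega>. (\<Prod>b\<in>\<pi>. gauss_avg \<theta> (gap b x) t) \<partial>M)"
  proof (rule integral_cong_AE)
    from AE_start_all show "AE \<omega> in M. (\<Prod>b\<in>\<pi>. gauss_avg \<theta> (gap b (\<lambda>i. B i 0 \<omega>)) t) = (\<Prod>b\<in>\<pi>. gauss_avg \<theta> (gap b x) t)"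
    proof eventually_elim
      case (elim \<omega>)
      then show ?case using \<pi>(2) pair_ends_in by (intro prod.cong refl) (simp add: gap_def)
    qed
    show "(\<lambda>\<omega>. \<Prod>b\<in>\<pi>. gauss_avg \<theta> (gap b (\<lambda>i. B i 0 \<omega>)) t) \<in> borel_measurable M"
    proof (rule borel_measurable_prod)
      fix b assume "b \<in> \<pi>"
      then have "(\<lambda>\<omega>. gap b (\<lambda>i. B i 0 \<omega>)) \<in> borel_measurable M" using \<pi>(2) by (intro measurable_gap) auto
      then show "(\<lambda>\<omega>. gauss_avg \<theta> (gap b (\<lambda>i. B i 0 \<omega>)) t) \<in> borel_measurable M"
        by (rule measurable_compose) measurable
    qed
  qed simp
  finally show ?thesis by (simp add: prob_space)
qed

text \<open>For each pair, the indicator of the integers is taken as \<theta>: its Gaussian average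
  at a positive time is 0.\<close>

lemma AE_sep_pos:
  assumes "0 < t"
  shows "AE \<omega> in M. 0 < sep t \<omega>"
proof -
  have "AE \<omega> in M. i < j \<longrightarrow> B i t \<omega> - B j t \<omega> \<notin> \<int>" if ij: "i \<in> K" "j \<in> K" for i j
  proof (cases "i < j")
    case True
    have [measurable]: "(\<int> :: real set) \<in> sets borel" by (intro borel_closed closed_Ints)
    have [measurable]: "B i t \<in> borel_measurable M" "B j t \<in> borel_measurable M"
      using ij assms by (auto intro: measurable_B)
    let ?\<theta> = "indicator \<int> :: real \<Rightarrow> real"
    have "(\<integral>\<omega>. (\<Prod>b\<in>{{i, j}}. ?\<theta> (gap b (\<lambda>i. B i t \<omega>))) \<partial>M) = (\<Prod>b\<in>{{i, j}}. gauss_avg ?\<theta> (gap b x) t)"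
      using True ij assms by (intro integral_terminal[where C = 1]) (auto simp: disjoint_def)
    also have "\<dots> = 0"
      using gauss_avg_cong_AE[of ?\<theta> "\<lambda>_. 0" t] assms by (simp add: gauss_avg_def)
    finally have "(\<integral>\<omega>. (\<Prod>b\<in>{{i, j}}. ?\<theta> (gap b (\<lambda>i. B i t \<omega>))) \<partial>M) = 0" .
    moreover have "(\<integral>\<omega>. (\<Prod>b\<in>{{i, j}}. ?\<theta> (gap b (\<lambda>i. B i t \<omega>))) \<partial>M) =
        (\<integral>\<omega>. indicator {\<omega>\<in>space M. B i t \<omega> - B j t \<omega> \<in> \<int>} \<omega> \<partial>M)"
      using True by (intro Bochner_Integration.integral_cong refl)
        (simp add: gap_def indicator_def min_def max_def)
    ultimately have "prob {\<omega>\<in>space M. B i t \<omega> - B j t \<omega> \<in> \<int>} = 0" by simp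
    then have "{\<omega>\<in>space M. B i t \<omega> - B j t \<omega> \<in> \<int>} \<in> null_sets M"
      by (intro null_setsI) (simp_all add: emeasure_eq_measure)
    then show ?thesis by (auto dest: AE_not_in)
  qed simp
  then have "AE \<omega> in M. \<forall>i\<in>K. \<forall>j\<in>K. i < j \<longrightarrow> B i t \<omega> - B j t \<omega> \<notin> \<int>"
    using finite_K by (intro AE_finite_allI)
  then show ?thesis by (simp add: separation_pos_iff)
qed

text \<open>The condition at time \<open>t\<close> costs only a null set and ensures a positive
  remaining time \<open>t - hit \<omega>\<close>, at which \<open>gauss_avg\<close> is
  continuous.\<close>

definition exits :: "real \<Rightarrow> 'a set" where
  "exits t = {\<omega>\<in>apart 0. \<omega> \<notin> apart t \<and> 0 < sep t \<omega>}"

lemma hit_less: "\<omega> \<in> exits t \<Longrightarrow> hit \<omega> < t"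
  using hit(2)[of \<omega> t] hit(3)[of \<omega> t] by (cases "hit \<omega> = t") (auto simp: exits_def)

definition stopped :: "(real \<Rightarrow> real) \<Rightarrow> nat set set \<Rightarrow> real \<Rightarrow> 'a \<Rightarrow> real" where
  "stopped \<theta> \<pi> t \<omega> = (\<Prod>b\<in>\<pi>. gauss_avg \<theta> (gap b (\<lambda>i. B i (hit \<omega>) \<omega>)) (t - hit \<omega>)) * indicator (exits t) \<omega>"

lemma AE_apart_0:
  assumes "0 < separation x"
  shows "AE \<omega> in M. \<omega> \<in> apart 0"
proof -
  from AE_start_all show ?thesis
  proof (rule AE_mp, intro AE_I2 impI)
    fix \<omega> assume "\<omega> \<in> space M" "\<forall>i\<in>K. B i 0 \<omega> = x i"
    moreover from this have "sep 0 \<omega> = separation x" by (intro separation_cong) auto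
    ultimately show "\<omega> \<in> apart 0" using assms by (simp add: apart_def)
  qed
qed

text \<open>Optional stopping at \<open>hit\<close> for the backward heat flow of a product of pair functions. The
  time \<open>hit\<close> is approximated from above by its discretisations, to which the Markov property
  applies.\<close>

lemma optional_stopping:
  fixes \<theta> :: "real \<Rightarrow> real"
  assumes "0 < t" and x: "0 < separation x"
    and \<pi>: "finite \<pi>" "\<And>b. b \<in> \<pi> \<Longrightarrow> b \<subseteq> K \<and> card b = 2" "disjoint \<pi>"
    and \<theta> [measurable]: "\<theta> \<in> borel_measurable borel" and \<theta>_le: "\<And>z. \<bar>\<theta> z\<bar> \<le> C"
    and cont: "\<And>z. z \<notin> \<int> \<Longrightarrow> isCont \<theta> z"
  shows "integrable M (stopped \<theta> \<pi> t)"
    and "(\<Prod>b\<in>\<pi>. gauss_avg \<theta> (gap b x) t) =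
      (\<integral>\<omega>. (\<Prod>b\<in>\<pi>. \<theta> (gap b (\<lambda>i. B i t \<omega>))) * indicator (apart t) \<omega> \<partial>M) + (\<integral>\<omega>. stopped \<theta> \<pi> t \<omega> \<partial>M)"
proof -
  define U where "U u \<omega> = (\<Prod>b\<in>\<pi>. gauss_avg \<theta> (gap b (\<lambda>i. B i u \<omega>)) (t - u))" for u \<omega>
  define \<sigma> where "\<sigma> n j = t * real j / real (Suc n)" for n j
  \<comment> \<open>A path whose first meeting comes after \<open>\<sigma> n j\<close> and not after
    \<open>\<sigma> n (Suc j)\<close> contributes the flow at the right end, so \<open>R n\<close>
    is the flow stopped at the first meeting rounded up to the grid. Paths without a meeting up to
    \<open>t\<close> contribute 0.\<close>
  define R where "R n \<omega> = (\<Sum>j<Suc n. U (\<sigma> n (Suc j)) \<omega> *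
    (indicator (apart (\<sigma> n j)) \<omega> - indicator (apart (\<sigma> n (Suc j))) \<omega>))" for n \<omega>
  have C: "0 \<le> C" using \<theta>_le[of 0] by linarith
  have \<sigma>_nonneg: "0 \<le> \<sigma> n j" for n j using \<open>0 < t\<close> by (simp add: \<sigma>_def)
  have \<sigma>_0: "\<sigma> n 0 = 0" and \<sigma>_last: "\<sigma> n (Suc n) = t" for n by (simp_all add: \<sigma>_def)
  have \<sigma>_mono: "\<sigma> n i \<le> \<sigma> n j" if "i \<le> j" for n i j
    using that \<open>0 < t\<close> by (simp add: \<sigma>_def divide_right_mono)
  have U_meas: "U u \<in> borel_measurable M" if "0 \<le> u" for u
    unfolding U_def
  proof (rule borel_measurable_prod)
    fix b assume "b \<in> \<pi>"
    then have "(\<lambda>\<omega>. gap b (\<lambda>i. B i u \<omega>)) \<in> borel_measurable M" using \<pi>(2) that by (intro measurable_gap) auto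
    then show "(\<lambda>\<omega>. gauss_avg \<theta> (gap b (\<lambda>i. B i u \<omega>)) (t - u)) \<in> borel_measurable M"
      by (rule measurable_compose) measurable
  qed
  have U_le: "\<bar>U u \<omega>\<bar> \<le> C ^ card \<pi>" for u \<omega>
    unfolding U_def by (rule abs_prod_le_power) (rule abs_gauss_avg_le[OF \<theta> \<theta>_le])
  have U_ind: "integrable M (\<lambda>\<omega>. U u \<omega> * indicator (apart r) \<omega>)" if "0 \<le> u" "0 \<le> r" for u r
  proof (rule integrable_const_bound[where B = "C ^ card \<pi>"])
    show "AE \<omega> in M. norm (U u \<omega> * indicator (apart r) \<omega>) \<le> C ^ card \<pi>"
      using U_le C by (auto split: split_indicator)
    show "(\<lambda>\<omega>. U u \<omega> * indicator (apart r) \<omega>) \<in> borel_measurable M"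
      using U_meas[OF that(1)] sets_apart[of r] by measurable
  qed

  have R_int: "(\<integral>\<omega>. R n \<omega> \<partial>M) = (\<integral>\<omega>. U t \<omega> * indicator (apart 0) \<omega> \<partial>M) - (\<integral>\<omega>. U t \<omega> * indicator (apart t) \<omega> \<partial>M)" for n
  proof -
    let ?e = "\<lambda>j. \<integral>\<omega>. U t \<omega> * indicator (apart (\<sigma> n j)) \<omega> \<partial>M"
    \<comment> \<open>Both \<open>apart (\<sigma> n j)\<close> and
      \<open>apart (\<sigma> n (Suc j))\<close> belong to the past of
      \<open>\<sigma> n (Suc j)\<close>; on them the Markov property replaces the flow by its
      terminal value \<open>U t\<close>, and the sum telescopes.\<close>
    have step: "(\<integral>\<omega>. U (\<sigma> n (Suc j)) \<omega> * indicator (apart (\<sigma> n i)) \<omega> \<partial>M) = ?e i"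
      if "j < Suc n" "i \<le> Suc j" for i j
    proof -
      have "\<sigma> n (Suc j) \<le> t" using \<sigma>_mono[of "Suc j" "Suc n" n] that \<sigma>_last by simp
      moreover have "0 < \<sigma> n (Suc j)" using \<open>0 < t\<close> by (simp add: \<sigma>_def)
      ultimately show ?thesis
        using markov_apart[OF \<sigma>_nonneg \<sigma>_mono[OF that(2)] _ _ \<pi> \<theta> \<theta>_le, of n t] by (simp add: U_def)
    qed
    have "(\<integral>\<omega>. R n \<omega> \<partial>M) = (\<Sum>j<Suc n. \<integral>\<omega>. U (\<sigma> n (Suc j)) \<omega> * indicator (apart (\<sigma> n j)) \<omega> -
        U (\<sigma> n (Suc j)) \<omega> * indicator (apart (\<sigma> n (Suc j))) \<omega> \<partial>M)"
      unfolding R_def right_diff_distrib using U_ind \<sigma>_nonneg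
      by (intro Bochner_Integration.integral_sum Bochner_Integration.integrable_diff U_ind \<sigma>_nonneg)
    also have "\<dots> = (\<Sum>j<Suc n. ?e j - ?e (Suc j))"
      using U_ind \<sigma>_nonneg step by (intro sum.cong refl) (simp add: Bochner_Integration.integral_diff)
    also have "\<dots> = ?e 0 - ?e (Suc n)" by (rule sum_lessThan_telescope')
    finally show ?thesis by (simp add: \<sigma>_0 \<sigma>_last)
  qed

  have R_zero: "R n \<omega> = 0" if "\<omega> \<in> space M" "\<omega> \<notin> apart 0 \<or> \<omega> \<in> apart t" for n \<omega>
  proof -
    have anti: "\<omega> \<in> apart r" if "\<omega> \<in> apart s" "r \<le> s" for r s
      using that by (auto simp: apart_def)
    have "indicator (apart (\<sigma> n j)) \<omega> = (indicator (apart t) \<omega> :: real)" if "j \<le> Suc n" for j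
      using \<sigma>_mono[OF that, of n] \<sigma>_nonneg[of n j] \<open>\<omega> \<notin> apart 0 \<or> \<omega> \<in> apart t\<close> anti \<open>0 < t\<close>
      unfolding \<sigma>_last by (auto simp: indicator_def)
    then show ?thesis by (simp add: R_def)
  qed
  have R_eval: "R n \<omega> = U (t * \<lceil>hit \<omega> * real (Suc n) / t\<rceil> / real (Suc n)) \<omega>"
    if \<omega>: "\<omega> \<in> apart 0" "\<omega> \<notin> apart t" for n \<omega>
  proof -
    define q where "q = hit \<omega> * real (Suc n) / t"
    have "hit \<omega> * real (Suc n) \<le> t * real (Suc n)" using hit(2)[OF \<omega>] by (intro mult_right_mono) auto
    then have q: "0 < q" "q \<le> real (Suc n)"
      using hit(1)[OF \<omega>] \<open>0 < t\<close> by (simp_all add: q_def pos_divide_le_eq mult.commute del: of_nat_Suc)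
    \<comment> \<open>The grid interval that contains the hit is open on the left and closed on the
      right, hence the ceiling minus one.\<close>
    define j0 where "j0 = nat \<lceil>q\<rceil> - 1"
    have ceil: "\<lceil>q\<rceil> = int (Suc j0)" using q(1) unfolding j0_def by (simp add: Suc_diff_1 zero_less_nat_eq)
    have "\<lceil>q\<rceil> \<le> int (Suc n)" using q(2) by (simp add: ceiling_le_iff del: of_nat_Suc)
    then have j0: "j0 < Suc n" using ceil by simp
    have lt: "\<omega> \<in> apart (\<sigma> n j) \<longleftrightarrow> real j < q" for j
      using apart_iff_less_hit[OF \<omega> \<sigma>_nonneg, of n j] \<open>0 < t\<close> by (simp add: \<sigma>_def q_def field_simps)
    have "indicator (apart (\<sigma> n j)) \<omega> - indicator (apart (\<sigma> n (Suc j))) \<omega> = (if j = j0 then 1 else 0 :: real)" for j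
    proof -
      have "j = j0 \<longleftrightarrow> \<lceil>q\<rceil> = int j + 1" using ceil by auto
      also have "\<dots> \<longleftrightarrow> real j < q \<and> \<not> real (Suc j) < q" by (auto simp: ceiling_eq_iff)
      finally show ?thesis using lt[of j] lt[of "Suc j"] by (auto simp: indicator_def)
    qed
    then have "R n \<omega> = (\<Sum>j<Suc n. if j = j0 then U (\<sigma> n (Suc j)) \<omega> else 0)"
      unfolding R_def by (intro sum.cong refl) simp
    also have "\<dots> = U (\<sigma> n (Suc j0)) \<omega>"
      using j0 by (simp add: sum.delta del: sum.lessThan_Suc)
    finally have "R n \<omega> = U (\<sigma> n (Suc j0)) \<omega>" .
    moreover have "\<sigma> n (Suc j0) = t * real_of_int \<lceil>q\<rceil> / real (Suc n)"
      unfolding ceil by (simp add: \<sigma>_def)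
    ultimately show ?thesis unfolding q_def by simp
  qed

  have R_lim: "(\<lambda>n. R n \<omega>) \<longlonglongrightarrow> U (hit \<omega>) \<omega>" if \<omega>: "\<omega> \<in> exits t" for \<omega>
  proof -
    have ap: "\<omega> \<in> apart 0" "\<omega> \<notin> apart t" and sp: "\<omega> \<in> space M"
      using \<omega> by (auto simp: exits_def apart_def)
    define v where "v n = t * \<lceil>hit \<omega> * real (Suc n) / t\<rceil> / real (Suc n)" for n
    have v_bounds: "hit \<omega> \<le> v n" "v n \<le> hit \<omega> + t * inverse (real (Suc n))" for n
    proof -
      define q where "q = hit \<omega> * real (Suc n) / t"
      have "hit \<omega> = t * q / real (Suc n)" using \<open>0 < t\<close> by (simp add: q_def)
      moreover have "t * q / real (Suc n) \<le> t * real_of_int \<lceil>q\<rceil> / real (Suc n)"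
        using \<open>0 < t\<close> by (intro divide_right_mono mult_left_mono) auto
      moreover have "t * real_of_int \<lceil>q\<rceil> / real (Suc n) \<le> t * (q + 1) / real (Suc n)"
        using \<open>0 < t\<close> by (intro divide_right_mono mult_left_mono) (auto simp: of_int_ceiling_le_add_one)
      moreover have "t * (q + 1) / real (Suc n) = t * q / real (Suc n) + t * inverse (real (Suc n))"
        by (simp add: distrib_left distrib_right divide_inverse)
      ultimately show "hit \<omega> \<le> v n" "v n \<le> hit \<omega> + t * inverse (real (Suc n))"
        unfolding v_def q_def[symmetric] by linarith+
    qed
    have upper: "(\<lambda>n. hit \<omega> + t * inverse (real (Suc n))) \<longlonglongrightarrow> hit \<omega>"
      using tendsto_add[OF tendsto_const tendsto_mult[OF tendsto_const LIMSEQ_inverse_real_of_nat], of "hit \<omega>" t] by simp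
    have "\<forall>\<^sub>F n in sequentially. hit \<omega> \<le> v n" "\<forall>\<^sub>F n in sequentially. v n \<le> hit \<omega> + t * inverse (real (Suc n))"
      using v_bounds by simp_all
    then have v_lim: "v \<longlonglongrightarrow> hit \<omega>" by (rule tendsto_sandwich[OF _ _ tendsto_const upper])
    have pos: "0 < hit \<omega>" using hit(1)[OF ap] .
    have B_lim: "(\<lambda>n. B i (v n) \<omega>) \<longlonglongrightarrow> B i (hit \<omega>) \<omega>" if "i \<in> K" for i
    proof (rule continuous_on_tendsto_compose[OF continuous_B[OF that sp] v_lim])
      have "0 \<le> v n" for n using v_bounds(1)[of n] pos by linarith
      then show "\<forall>\<^sub>F n in sequentially. v n \<in> {0..}" by simp
    qed (use pos in simp)
    have "(\<lambda>n. U (v n) \<omega>) \<longlonglongrightarrow> U (hit \<omega>) \<omega>"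
      unfolding U_def
    proof (rule tendsto_prod)
      fix b assume "b \<in> \<pi>"
      then have "Min b \<in> K" "Max b \<in> K" using \<pi>(2) pair_ends_in by blast+
      then have "(\<lambda>n. gap b (\<lambda>i. B i (v n) \<omega>)) \<longlonglongrightarrow> gap b (\<lambda>i. B i (hit \<omega>) \<omega>)"
        unfolding gap_def by (intro tendsto_diff B_lim)
      then show "(\<lambda>n. gauss_avg \<theta> (gap b (\<lambda>i. B i (v n) \<omega>)) (t - v n))
          \<longlonglongrightarrow> gauss_avg \<theta> (gap b (\<lambda>i. B i (hit \<omega>) \<omega>)) (t - hit \<omega>)"
        using hit_less[OF \<omega>] by (intro tendsto_gauss_avg[OF \<theta> \<theta>_le cont] tendsto_diff tendsto_const v_lim) auto
    qed
    then show ?thesis using R_eval[OF ap] by (simp add: v_def)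
  qed

  have R_le: "\<bar>R n \<omega>\<bar> \<le> C ^ card \<pi>" if "\<omega> \<in> space M" for n \<omega>
    using R_zero[OF that] R_eval[of \<omega>] U_le C by (cases "\<omega> \<notin> apart 0 \<or> \<omega> \<in> apart t") auto
  have [measurable]: "R n \<in> borel_measurable M" for n
    unfolding R_def
    by (intro borel_measurable_sum borel_measurable_times borel_measurable_diff borel_measurable_indicator
        U_meas sets_apart \<sigma>_nonneg)
  have [measurable]: "sep t \<in> borel_measurable M" using \<open>0 < t\<close> by (intro measurable_sep) simp
  \<comment> \<open>A meeting exactly at \<open>t\<close> would leave no time for smoothing, so
    pointwise convergence is claimed only after such paths are set to 0; almost surely nothing
    changes.\<close>
  let ?R = "\<lambda>n \<omega>. R n \<omega> * (if 0 < sep t \<omega> then 1 else 0)"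
  have lim: "(\<lambda>n. ?R n \<omega>) \<longlonglongrightarrow> stopped \<theta> \<pi> t \<omega>" if "\<omega> \<in> space M" for \<omega>
  proof (cases "\<omega> \<in> exits t")
    case True
    then show ?thesis using R_lim[OF True] by (simp add: stopped_def U_def exits_def)
  next
    case False
    then have "?R n \<omega> = 0" for n using R_zero[OF that] by (auto simp: exits_def)
    then have R0: "(\<lambda>n. ?R n \<omega>) = (\<lambda>_. 0)" by (intro ext)
    show ?thesis unfolding R0 using False by (simp add: stopped_def)
  qed
  have meas: "stopped \<theta> \<pi> t \<in> borel_measurable M"
    by (rule borel_measurable_LIMSEQ_real[OF lim]) measurable
  show "integrable M (stopped \<theta> \<pi> t)"
  proof (rule integrable_const_bound[OF _ meas, where B = "C ^ card \<pi>"])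
    show "AE \<omega> in M. norm (stopped \<theta> \<pi> t \<omega>) \<le> C ^ card \<pi>"
      using U_le C by (auto simp: stopped_def U_def split: split_indicator)
  qed
  have AE_R: "AE \<omega> in M. ?R n \<omega> = R n \<omega>" for n
    using AE_sep_pos[OF \<open>0 < t\<close>] by eventually_elim simp
  have "(\<lambda>n. \<integral>\<omega>. ?R n \<omega> \<partial>M) \<longlonglongrightarrow> (\<integral>\<omega>. stopped \<theta> \<pi> t \<omega> \<partial>M)"
  proof (rule integral_dominated_convergence[where w = "\<lambda>_. C ^ card \<pi>"])
    show "AE \<omega> in M. (\<lambda>n. ?R n \<omega>) \<longlonglongrightarrow> stopped \<theta> \<pi> t \<omega>" by (intro AE_I2 lim)
    show "AE \<omega> in M. norm (?R n \<omega>) \<le> C ^ card \<pi>" for n using R_le C by (intro AE_I2) simp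
  qed (use meas in auto)
  also have "(\<lambda>n. \<integral>\<omega>. ?R n \<omega> \<partial>M) = (\<lambda>n. \<integral>\<omega>. R n \<omega> \<partial>M)"
    using AE_R by (intro ext integral_cong_AE) auto
  finally have "(\<integral>\<omega>. stopped \<theta> \<pi> t \<omega> \<partial>M) =
      (\<integral>\<omega>. U t \<omega> * indicator (apart 0) \<omega> \<partial>M) - (\<integral>\<omega>. U t \<omega> * indicator (apart t) \<omega> \<partial>M)"
    unfolding R_int by (metis LIMSEQ_const_iff)
  moreover have "(\<integral>\<omega>. U t \<omega> * indicator (apart 0) \<omega> \<partial>M) = (\<integral>\<omega>. U t \<omega> \<partial>M)"
  proof (rule integral_cong_AE)
    show "AE \<omega> in M. U t \<omega> * indicator (apart 0) \<omega> = U t \<omega>"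
      using AE_apart_0[OF x] by eventually_elim simp
  qed (use U_meas[of t] U_ind[of t 0] \<open>0 < t\<close> in auto)
  moreover have "(\<integral>\<omega>. U t \<omega> \<partial>M) = (\<Prod>b\<in>\<pi>. gauss_avg \<theta> (gap b x) t)"
    using integral_terminal[OF \<open>0 < t\<close> \<pi> \<theta> \<theta>_le] by (simp add: U_def)
  ultimately show "(\<Prod>b\<in>\<pi>. gauss_avg \<theta> (gap b x) t) =
      (\<integral>\<omega>. (\<Prod>b\<in>\<pi>. \<theta> (gap b (\<lambda>i. B i t \<omega>))) * indicator (apart t) \<omega> \<partial>M) + (\<integral>\<omega>. stopped \<theta> \<pi> t \<omega> \<partial>M)"
    by (simp add: U_def)
qed

end

section \<open>Vanishing at the exit time\<close>

lemma tendsto_pfaffian: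
  assumes "\<And>i j. ((\<lambda>n. a n i j) \<longlongrightarrow> b i j) F"
  shows "((\<lambda>n. pfaffian I (a n)) \<longlongrightarrow> pfaffian I b) F"
  unfolding pfaffian_def by (intro tendsto_intros assms)

lemma abs_pfaffian_le:
  assumes "\<And>i j. i \<in> I \<Longrightarrow> j \<in> I \<Longrightarrow> i < j \<Longrightarrow> \<bar>a i j\<bar> \<le> C"
  shows "\<bar>pfaffian I a\<bar> \<le> (\<Sum>\<pi>\<in>pair_partitions I. C ^ card \<pi>)"
  unfolding pfaffian_def
proof (rule order_trans[OF sum_abs sum_mono])
  fix \<pi> assume \<pi>: "\<pi> \<in> pair_partitions I"
  have "\<bar>a (Min c) (Max c)\<bar> \<le> C" if "c \<in> \<pi>" for c
  proof -
    obtain u v where "c = {u, v}" "u \<noteq> v" "u \<in> I" "v \<in> I" using \<pi> \<open>c \<in> \<pi>\<close> by (rule card_2_blockE)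
    then show ?thesis using assms by (auto simp: Min_Max_pair min_def max_def)
  qed
  then have "(\<Prod>c\<in>\<pi>. \<bar>a (Min c) (Max c)\<bar>) \<le> (\<Prod>c\<in>\<pi>. C)" by (intro prod_mono) auto
  then show "\<bar>(-1) ^ crossings \<pi> * (\<Prod>c\<in>\<pi>. a (Min c) (Max c))\<bar> \<le> C ^ card \<pi>"
    by (simp add: abs_mult power_abs abs_prod)
qed

lemma unit_interval_notin_Ints: "0 < z \<Longrightarrow> z < 1 \<Longrightarrow> z \<notin> \<int>" for z :: real
  by (auto elim!: Ints_cases)

lemma Ints_unit_interval: "z \<in> \<int> \<Longrightarrow> 0 \<le> z \<Longrightarrow> z \<le> 1 \<Longrightarrow> z = 0 \<or> z = 1" for z :: real
  by (auto elim!: Ints_cases)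

text \<open>The chain of strict inequalities on the starting points, in a pairwise form that passes
  to subsets of the indices.\<close>

locale circular_family = brownian_family +
  assumes start_gap: "\<And>i j. i \<in> K \<Longrightarrow> j \<in> K \<Longrightarrow> i < j \<Longrightarrow> 0 < x i - x j \<and> x i - x j < 1"
begin

lemma separation_start: "0 < separation x"
  using start_gap unit_interval_notin_Ints by (auto simp: separation_pos_iff)

text \<open>A gap that leaves [0, 1] has crossed 0 or 1 before, by the intermediate value theorem.
  The bounds are not strict because \<open>r\<close> may itself be the meeting time.\<close>

lemma gap_before_meeting:
  assumes \<omega>: "\<omega> \<in> space M" "\<forall>i\<in>K. B i 0 \<omega> = x i"
    and ij: "i \<in> K" "j \<in> K" "i < j"
    and "0 \<le> r" and before: "\<And>u. 0 \<le> u \<Longrightarrow> u < r \<Longrightarrow> B i u \<omega> - B j u \<omega> \<notin> \<int>"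
  shows "0 \<le> B i r \<omega> - B j r \<omega>" "B i r \<omega> - B j r \<omega> \<le> 1"
proof -
  let ?D = "\<lambda>u. B i u \<omega> - B j u \<omega>"
  have cont: "continuous_on {0..r} ?D"
    by (intro continuous_on_diff continuous_on_subset[OF continuous_B] \<omega> ij) auto
  have D0: "0 < ?D 0" "?D 0 < 1" using \<omega>(2) ij start_gap by auto
  show "0 \<le> ?D r"
  proof (rule ccontr)
    assume neg: "\<not> 0 \<le> ?D r"
    then obtain u where u: "0 \<le> u" "u \<le> r" "?D u = 0"
      using IVT2'[of ?D r 0 0] D0 cont \<open>0 \<le> r\<close> by auto
    then have "u \<noteq> r" using neg by auto
    then show False using before[of u] u by auto
  qed
  show "?D r \<le> 1"
  proof (rule ccontr)
    assume gt: "\<not> ?D r \<le> 1"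
    then obtain u where u: "0 \<le> u" "u \<le> r" "?D u = 1"
      using IVT'[of ?D 0 1 r] D0 cont \<open>0 \<le> r\<close> by auto
    then have "u \<noteq> r" using gt by auto
    then show False using before[of u] u by auto
  qed
qed

lemma apartD:
  assumes "\<omega> \<in> apart r" "0 \<le> u" "u \<le> r" "i \<in> K" "j \<in> K" "i < j"
  shows "B i u \<omega> - B j u \<omega> \<notin> \<int>"
  using assms by (auto simp: apart_def separation_pos_iff)

lemma gap_apart:
  assumes \<omega>: "\<omega> \<in> apart r" "\<forall>i\<in>K. B i 0 \<omega> = x i"
    and ij: "i \<in> K" "j \<in> K" "i < j" and "0 \<le> r"
  shows "0 < B i r \<omega> - B j r \<omega>" "B i r \<omega> - B j r \<omega> < 1"
proof -
  have "\<omega> \<in> space M" using \<omega>(1) by (simp add: apart_def)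
  then have "0 \<le> B i r \<omega> - B j r \<omega>" "B i r \<omega> - B j r \<omega> \<le> 1"
    using gap_before_meeting[OF _ \<omega>(2) ij \<open>0 \<le> r\<close>] apartD[OF \<omega>(1) _ _ ij] by auto
  moreover have "B i r \<omega> - B j r \<omega> \<notin> \<int>" using apartD[OF \<omega>(1) \<open>0 \<le> r\<close> _ ij] by simp
  then have "B i r \<omega> - B j r \<omega> \<noteq> 0" "B i r \<omega> - B j r \<omega> \<noteq> 1" by (metis Ints_0, metis Ints_1)
  ultimately show "0 < B i r \<omega> - B j r \<omega>" "B i r \<omega> - B j r \<omega> < 1" by linarith+
qed

lemma exitsD:
  assumes "\<omega> \<in> exits t"
  shows "\<omega> \<in> space M" "\<omega> \<in> apart 0" "\<omega> \<notin> apart t"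
  using assms by (auto simp: exits_def apart_def)

lemma gap_exit:
  assumes \<omega>: "\<omega> \<in> exits t" "\<forall>i\<in>K. B i 0 \<omega> = x i"
    and ij: "i \<in> K" "j \<in> K" "i < j"
  shows "0 \<le> B i (hit \<omega>) \<omega> - B j (hit \<omega>) \<omega>" "B i (hit \<omega>) \<omega> - B j (hit \<omega>) \<omega> \<le> 1"
proof -
  note e = exitsD[OF \<omega>(1)]
  have "B i u \<omega> - B j u \<omega> \<notin> \<int>" if "0 \<le> u" "u < hit \<omega>" for u
    using apart_iff_less_hit[OF e(2,3) that(1)] that apartD[of \<omega> u u] ij by blast
  then show "0 \<le> B i (hit \<omega>) \<omega> - B j (hit \<omega>) \<omega>" "B i (hit \<omega>) \<omega> - B j (hit \<omega>) \<omega> \<le> 1"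
    using gap_before_meeting[OF e(1) \<omega>(2) ij] hit(1)[OF e(2,3)] by auto
qed

text \<open>The integer gap at the exit lies in [0, 1] by continuity. The value 0 is a meeting on
  the line, the value 1 a meeting on the circle only.\<close>

lemma exit_pairE:
  assumes "\<omega> \<in> exits t" "\<forall>i\<in>K. B i 0 \<omega> = x i"
  obtains i j where "i \<in> K" "j \<in> K" "i < j"
    "B i (hit \<omega>) \<omega> - B j (hit \<omega>) \<omega> = 0 \<or> B i (hit \<omega>) \<omega> - B j (hit \<omega>) \<omega> = 1"
proof -
  have "sep (hit \<omega>) \<omega> = 0" using hit(3) exitsD[OF assms(1)] by blast
  then obtain i j where "i \<in> K" "j \<in> K" "i < j" "B i (hit \<omega>) \<omega> - B j (hit \<omega>) \<omega> \<in> \<int>"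
    by (auto simp: separation_eq_0_iff)
  then show ?thesis using that gap_exit[OF assms] Ints_unit_interval by blast
qed

lemma AE_not_apart_iff_exits:
  assumes "0 < t"
  shows "AE \<omega> in M. \<omega> \<notin> apart t \<longleftrightarrow> \<omega> \<in> exits t"
  using AE_sep_pos[OF assms] AE_apart_0[OF separation_start]
  by eventually_elim (auto simp: exits_def)

definition exit_pfaffian :: "(real \<Rightarrow> real) \<Rightarrow> nat set \<Rightarrow> real \<Rightarrow> 'a \<Rightarrow> real" where
  "exit_pfaffian \<theta> I t \<omega> =
    pfaffian I (\<lambda>i j. gauss_avg \<theta> (B i (hit \<omega>) \<omega> - B j (hit \<omega>) \<omega>) (t - hit \<omega>)) * indicator (exits t) \<omega>"

lemma exit_pfaffian_eq_sum:
  "exit_pfaffian \<theta> I t = (\<lambda>\<omega>. \<Sum>\<pi>\<in>pair_partitions I. (-1) ^ crossings \<pi> * stopped \<theta> \<pi> t \<omega>)"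
  by (intro ext) (simp add: exit_pfaffian_def pfaffian_def stopped_def gap_def sum_distrib_right mult.assoc)

text \<open>Optional stopping is summed over the pair partitions of \<open>I\<close> with their
  signs. Survivors have all gaps in (0, 1), so each product of values of \<theta> is 1 there, and
  the signed number of partitions is 1. Survival and exit refer to all of \<open>K\<close> even when
  \<open>I\<close> omits an index, as the odd case requires.\<close>

lemma survival_pfaffian:
  assumes "0 < t" "I \<subseteq> K" "even (card I)"
    and \<theta>: "\<theta> \<in> borel_measurable borel" "\<And>z. \<bar>\<theta> z\<bar> \<le> C" "\<And>z. z \<notin> \<int> \<Longrightarrow> isCont \<theta> z"
    and unit: "\<And>z. 0 < z \<Longrightarrow> z < 1 \<Longrightarrow> \<theta> z = 1"
  shows "integrable M (exit_pfaffian \<theta> I t)"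
    and "pfaffian I (\<lambda>i j. gauss_avg \<theta> (x i - x j) t) = prob (apart t) + (\<integral>\<omega>. exit_pfaffian \<theta> I t \<omega> \<partial>M)"
proof -
  have finI: "finite I" using assms(2) finite_K finite_subset by blast
  have \<pi>: "finite \<pi>" "\<And>b. b \<in> \<pi> \<Longrightarrow> b \<subseteq> K \<and> card b = 2" "disjoint \<pi>" if "\<pi> \<in> pair_partitions I" for \<pi>
    using that assms(2) pair_partitions_finite(2)[OF finI that]
    by (auto simp: pair_partitions_def partition_on_def)
  have int: "integrable M (stopped \<theta> \<pi> t)" if "\<pi> \<in> pair_partitions I" for \<pi>
    using optional_stopping(1)[OF \<open>0 < t\<close> separation_start \<pi>[OF that] \<theta>] .
  have eq: "(\<Prod>b\<in>\<pi>. gauss_avg \<theta> (gap b x) t) = prob (apart t) + (\<integral>\<omega>. stopped \<theta> \<pi> t \<omega> \<partial>M)"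
    if p: "\<pi> \<in> pair_partitions I" for \<pi>
  proof -
    have "(\<integral>\<omega>. (\<Prod>b\<in>\<pi>. \<theta> (gap b (\<lambda>i. B i t \<omega>))) * indicator (apart t) \<omega> \<partial>M) = (\<integral>\<omega>. indicator (apart t) \<omega> \<partial>M)"
    proof (rule integral_cong_AE)
      show "AE \<omega> in M. (\<Prod>b\<in>\<pi>. \<theta> (gap b (\<lambda>i. B i t \<omega>))) * indicator (apart t) \<omega> = indicator (apart t) \<omega>"
        using AE_start_all
      proof eventually_elim
        case (elim \<omega>)
        have "\<theta> (gap b (\<lambda>i. B i t \<omega>)) = 1" if mem: "b \<in> \<pi>" "\<omega> \<in> apart t" for b
        proof -
          obtain u v where b: "b = {u, v}" "u \<noteq> v" "u \<in> I" "v \<in> I"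
            using p mem(1) by (rule card_2_blockE)
          then have "Min b \<in> K" "Max b \<in> K" "Min b < Max b"
            using assms(2) by (auto simp: Min_Max_pair min_def max_def)
          then show ?thesis
            using gap_apart[OF mem(2) elim] \<open>0 < t\<close> unfolding gap_def by (intro unit) auto
        qed
        then show ?case by (simp add: indicator_def)
      qed
      have "(\<lambda>\<omega>. \<theta> (gap b (\<lambda>i. B i t \<omega>))) \<in> borel_measurable M" if "b \<in> \<pi>" for b
        using \<pi>(2)[OF p that] \<open>0 < t\<close> by (intro measurable_compose[OF measurable_gap \<theta>(1)]) auto
      then show "(\<lambda>\<omega>. (\<Prod>b\<in>\<pi>. \<theta> (gap b (\<lambda>i. B i t \<omega>))) * indicator (apart t) \<omega>) \<in> borel_measurable M"
        by (intro borel_measurable_times borel_measurable_prod borel_measurable_indicator sets_apart)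
    qed (intro borel_measurable_indicator sets_apart)
    also have "\<dots> = prob (apart t)"
      using sets.Int_space_eq2[OF sets_apart[of t]] by simp
    finally show ?thesis
      using optional_stopping(2)[OF \<open>0 < t\<close> separation_start \<pi>[OF p] \<theta>] by simp
  qed
  show "integrable M (exit_pfaffian \<theta> I t)"
    unfolding exit_pfaffian_eq_sum using int by (intro Bochner_Integration.integrable_sum integrable_mult_right)
  have "pfaffian I (\<lambda>i j. gauss_avg \<theta> (x i - x j) t) =
      (\<Sum>\<pi>\<in>pair_partitions I. (-1) ^ crossings \<pi> * (\<Prod>b\<in>\<pi>. gauss_avg \<theta> (gap b x) t))"
    by (simp add: pfaffian_def gap_def)
  also have "\<dots> = (\<Sum>\<pi>\<in>pair_partitions I. (-1) ^ crossings \<pi> * prob (apart t) + (-1) ^ crossings \<pi> * (\<integral>\<omega>. stopped \<theta> \<pi> t \<omega> \<partial>M))"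
    by (intro sum.cong refl) (simp add: eq distrib_left)
  also have "\<dots> = pfaffian I (\<lambda>_ _. 1) * prob (apart t) +
      (\<Sum>\<pi>\<in>pair_partitions I. (-1) ^ crossings \<pi> * (\<integral>\<omega>. stopped \<theta> \<pi> t \<omega> \<partial>M))"
    by (simp add: sum.distrib pfaffian_def sum_distrib_right)
  also have "pfaffian I (\<lambda>_ _. 1) = 1" by (rule pfaffian_one[OF finI assms(3)])
  also have "(\<Sum>\<pi>\<in>pair_partitions I. (-1) ^ crossings \<pi> * (\<integral>\<omega>. stopped \<theta> \<pi> t \<omega> \<partial>M)) = (\<integral>\<omega>. exit_pfaffian \<theta> I t \<omega> \<partial>M)"
    unfolding exit_pfaffian_eq_sum using int by (subst Bochner_Integration.integral_sum) simp_all
  finally show "pfaffian I (\<lambda>i j. gauss_avg \<theta> (x i - x j) t) = prob (apart t) + (\<integral>\<omega>. exit_pfaffian \<theta> I t \<omega> \<partial>M)"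
    by simp
qed

lemma survival_even:
  assumes "0 < t" "even (card K)"
  shows "prob (apart t) = pfaffian K (\<lambda>i j. gauss_avg square_wave (x i - x j) t)"
proof -
  have "AE \<omega> in M. exit_pfaffian square_wave K t \<omega> = 0"
    using AE_start_all
  proof eventually_elim
    case (elim \<omega>)
    show ?case
    proof (cases "\<omega> \<in> exits t")
      case True
      define r where "r = t - hit \<omega>"
      have "0 < r" using hit_less[OF True] by (simp add: r_def)
      define A where "A i j = gauss_avg square_wave (B i (hit \<omega>) \<omega> - B j (hit \<omega>) \<omega>) r" for i j
      have skew: "A i j = - A j i" for i j
        using gauss_avg_odd[OF borel_measurable_waves(1) square_wave_odd \<open>0 < r\<close>, of "B j (hit \<omega>) \<omega> - B i (hit \<omega>) \<omega>"]
        by (simp add: A_def)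
      obtain i j where ij: "i \<in> K" "j \<in> K" "i < j"
        and D: "B i (hit \<omega>) \<omega> - B j (hit \<omega>) \<omega> = 0 \<or> B i (hit \<omega>) \<omega> - B j (hit \<omega>) \<omega> = 1"
        using True elim by (rule exit_pairE)
      \<comment> \<open>At gap 0 the two rows agree, at gap 1 they are opposite. The second multiple
        is a dummy, with \<beta> = 0 and \<open>j\<close> used twice.\<close>
      have "\<exists>\<alpha>. \<forall>z. A i z = \<alpha> * A j z + 0 * A j z"
        using D
      proof
        assume "B i (hit \<omega>) \<omega> - B j (hit \<omega>) \<omega> = 0"
        then have "A i z = 1 * A j z + 0 * A j z" for z by (simp add: A_def)
        then show ?thesis by blast
      next
        assume "B i (hit \<omega>) \<omega> - B j (hit \<omega>) \<omega> = 1"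
        then have "B i (hit \<omega>) \<omega> = B j (hit \<omega>) \<omega> + 1" by simp
        then have "A i z = - 1 * A j z + 0 * A j z" for z
          using gauss_avg_shift[OF integrable_square_wave square_wave_shift, of "B j (hit \<omega>) \<omega> - B z (hit \<omega>) \<omega>" r]
          by (simp add: A_def add_diff_eq diff_add_eq)
        then show ?thesis by blast
      qed
      then obtain \<alpha> where row: "\<And>z. A i z = \<alpha> * A j z + 0 * A j z" by blast
      have "i \<noteq> j" using ij by simp
      have "pfaffian K A = 0"
        by (rule pfaffian_dependent_row[OF finite_K ij(1,2,2) \<open>i \<noteq> j\<close> \<open>i \<noteq> j\<close> skew row])
      then show ?thesis by (simp add: exit_pfaffian_def A_def[abs_def] r_def)
    qed (simp add: exit_pfaffian_def)
  qed
  then have "(\<integral>\<omega>. exit_pfaffian square_wave K t \<omega> \<partial>M) = 0" by (rule integral_eq_zero_AE)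
  then show ?thesis
    using survival_pfaffian(2)[OF assms(1) subset_refl assms(2) borel_measurable_waves(1) abs_square_wave_le
        isCont_square_wave square_wave_unit] by simp
qed

end

lemma pfaffian_pair:
  fixes i j :: "'i::linorder"
  assumes "i < j"
  shows "pfaffian {i, j} a = a i j"
proof -
  have min: "i \<le> v" if "v \<in> {i, j}" for v using that assms by auto
  have sets: "{i, j} - {i} = {j}" "{v\<in>{j}. v < j} = {}" "{i, j} - {i, j} = {}" using assms by auto
  have "pfaffian {i, j} a =
      (\<Sum>l\<in>{i, j} - {i}. (-1) ^ card {v\<in>{i, j} - {i}. v < l} * a i l * pfaffian ({i, j} - {i, l}) a)"
    by (rule pfaffian_expand_Min[OF _ _ min]) simp_all
  also have "\<dots> = (\<Sum>l\<in>{j}. (-1) ^ card {v\<in>{j}. v < l} * a i l * pfaffian ({i, j} - {i, l}) a)"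
    unfolding sets(1) ..
  also have "\<dots> = (-1) ^ card {v\<in>{j}. v < j} * a i j * pfaffian ({i, j} - {i, j}) a" by simp
  also have "\<dots> = a i j" unfolding sets by simp
  finally show ?thesis .
qed

lemma alternating_sum_odd:
  assumes "odd k"
  shows "(\<Sum>l = 1..k. (-1) ^ (l + 1)) = (1::real)"
  using assms by (induction k rule: induct_nat_012) auto

section \<open>Meeting times on the circle and on the line\<close>

lemma circle_proj_eq_iff:
  "circle_proj B i r \<omega> = circle_proj B j r \<omega> \<longleftrightarrow> B i r \<omega> - B j r \<omega> \<in> \<int>"
proof -
  have "circle_proj B i r \<omega> = circle_proj B j r \<omega> \<longleftrightarrow>
      (\<exists>n::int. \<i> * 2 * pi * B i r \<omega> = \<i> * 2 * pi * B j r \<omega> + (of_int (2 * n) * pi) * \<i>)"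
    unfolding circle_proj_def exp_eq ..
  also have "\<dots> \<longleftrightarrow> (\<exists>n::int. B i r \<omega> = B j r \<omega> + of_int n)"
  proof (rule ex_cong1)
    fix n :: int
    have "\<i> * 2 * pi * B j r \<omega> + (of_int (2 * n) * pi) * \<i> = \<i> * 2 * pi * complex_of_real (B j r \<omega> + of_int n)"
      by (simp add: algebra_simps)
    then show "(\<i> * 2 * pi * B i r \<omega> = \<i> * 2 * pi * B j r \<omega> + (of_int (2 * n) * pi) * \<i>) =
        (B i r \<omega> = B j r \<omega> + of_int n)"
      by (simp del: of_real_add)
  qed
  also have "\<dots> \<longleftrightarrow> B i r \<omega> - B j r \<omega> \<in> \<int>"
    by (auto simp: Ints_def image_iff algebra_simps)
  finally show ?thesis .
qed

text \<open>A closed meeting set contains its infimum, so having no meeting up to and including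
  \<open>t\<close> makes the infimum strictly larger than \<open>t\<close>; without any meeting it
  is \<infinity>.\<close>

lemma meeting_time_greater_iff:
  assumes "closed {r. 0 \<le> r \<and> X i r \<omega> = X j r \<omega>}"
  shows "meeting_time X i j \<omega> > ereal t \<longleftrightarrow> (\<forall>r\<in>{0..t}. X i r \<omega> \<noteq> X j r \<omega>)"
proof
  assume gt: "meeting_time X i j \<omega> > ereal t"
  show "\<forall>r\<in>{0..t}. X i r \<omega> \<noteq> X j r \<omega>"
  proof (intro ballI notI)
    fix r assume "r \<in> {0..t}" "X i r \<omega> = X j r \<omega>"
    then have "meeting_time X i j \<omega> \<le> ereal r" "ereal r \<le> ereal t"
      unfolding meeting_time_def by (auto intro: Inf_lower)
    then have "meeting_time X i j \<omega> \<le> ereal t" by (rule order_trans)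
    then show False using gt by (simp add: leD)
  qed
next
  assume none: "\<forall>r\<in>{0..t}. X i r \<omega> \<noteq> X j r \<omega>"
  let ?S = "{r. 0 \<le> r \<and> X i r \<omega> = X j r \<omega>}"
  show "meeting_time X i j \<omega> > ereal t"
  proof (cases "?S = {}")
    case True
    then show ?thesis unfolding meeting_time_def True by (simp add: top_ereal_def)
  next
    case False
    have bdd: "bdd_below ?S" by (rule bdd_belowI[of _ 0]) auto
    have "Inf ?S \<in> ?S" by (rule closed_contains_Inf[OF False bdd assms])
    then have "t < Inf ?S" using none by force
    moreover have "ereal (Inf ?S) \<le> meeting_time X i j \<omega>"
      unfolding meeting_time_def using cInf_lower[OF _ bdd] by (intro Inf_greatest) auto
    ultimately show ?thesis using less_le_trans[of "ereal t" "ereal (Inf ?S)"] by simp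
  qed
qed

lemma meeting_time_nonneg: "0 \<le> meeting_time X i j \<omega>"
  unfolding meeting_time_def by (rule Inf_greatest) auto

context circular_family
begin

lemma closed_meetings:
  assumes "\<omega> \<in> space M" "i \<in> K" "j \<in> K"
  shows "closed {r. 0 \<le> r \<and> B i r \<omega> = B j r \<omega>}"
    "closed {r. 0 \<le> r \<and> circle_proj B i r \<omega> = circle_proj B j r \<omega>}"
proof -
  have cont: "continuous_on {0..} (\<lambda>r. B i r \<omega> - B j r \<omega>)"
    by (intro continuous_on_diff continuous_B assms)
  have "closed {r\<in>{0..}. B i r \<omega> - B j r \<omega> = 0}"
    by (intro continuous_closed_preimage_constant cont) auto
  also have "{r\<in>{0..}. B i r \<omega> - B j r \<omega> = 0} = {r. 0 \<le> r \<and> B i r \<omega> = B j r \<omega>}" by auto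
  finally show "closed {r. 0 \<le> r \<and> B i r \<omega> = B j r \<omega>}" .
  have "closed {r\<in>{0..}. sin ((B i r \<omega> - B j r \<omega>) * pi) = 0}"
    by (intro continuous_closed_preimage_constant continuous_on_sin continuous_on_mult cont continuous_on_const) auto
  also have "{r\<in>{0..}. sin ((B i r \<omega> - B j r \<omega>) * pi) = 0} =
      {r. 0 \<le> r \<and> circle_proj B i r \<omega> = circle_proj B j r \<omega>}"
    by (auto simp: sin_times_pi_eq_0 circle_proj_eq_iff)
  finally show "closed {r. 0 \<le> r \<and> circle_proj B i r \<omega> = circle_proj B j r \<omega>}" .
qed

lemma meeting_circle_greater_iff:
  assumes "\<omega> \<in> space M" "i \<in> K" "j \<in> K"
  shows "meeting_time (circle_proj B) i j \<omega> > ereal t \<longleftrightarrow> (\<forall>r\<in>{0..t}. B i r \<omega> - B j r \<omega> \<notin> \<int>)"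
  using meeting_time_greater_iff[where X = "circle_proj B", OF closed_meetings(2)[OF assms]]
  by (simp add: circle_proj_eq_iff)

lemma apart_iff_meeting:
  assumes "\<omega> \<in> space M"
  shows "\<omega> \<in> apart t \<longleftrightarrow> (\<forall>i\<in>K. \<forall>j\<in>K. i < j \<longrightarrow> meeting_time (circle_proj B) i j \<omega> > ereal t)"
  using assms by (auto simp: apart_def separation_pos_iff meeting_circle_greater_iff)

text \<open>Each set {1..k} - {l} has even size, and the alternating sum of the exit terms is a
  bordered Pfaffian. Its vanishing rests on the shift rule of the full staircase, which truncation
  destroys; the exit terms therefore disappear in the limit rather than for each
  \<open>N\<close>.\<close>

lemma survival_odd:
  assumes "0 < t" "odd k" and K: "K = {1..k}"
  shows "prob (apart t) =
    (\<Sum>l = 1..k. (-1) ^ (l + 1) * pfaffian ({1..k} - {l}) (\<lambda>i j. gauss_avg staircase (x i - x j) t))"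
proof -
  let ?I = "\<lambda>l. {1..k} - {l}"
  let ?E = "\<lambda>N \<omega>. \<Sum>l = 1..k. (-1) ^ (l + 1) * exit_pfaffian (clamped_staircase N) (?I l) t \<omega>"
  let ?S = "\<lambda>\<theta>. \<Sum>l = 1..k. (-1) ^ (l + 1) * pfaffian (?I l) (\<lambda>i j. gauss_avg \<theta> (x i - x j) t)"
  have card: "even (card (?I l))" if "l \<in> {1..k}" for l
    using that \<open>odd k\<close> by (simp add: card_Diff_singleton)
  have surv: "integrable M (exit_pfaffian (clamped_staircase N) (?I l) t)"
    "pfaffian (?I l) (\<lambda>i j. gauss_avg (clamped_staircase N) (x i - x j) t) =
      prob (apart t) + (\<integral>\<omega>. exit_pfaffian (clamped_staircase N) (?I l) t \<omega> \<partial>M)"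
    if "l \<in> {1..k}" "0 < N" for l N
    using survival_pfaffian[OF \<open>0 < t\<close> _ card[OF that(1)] borel_measurable_waves(3)[of N] abs_clamped_staircase_le
        isCont_clamped_staircase clamped_staircase_unit[OF _ _ that(2)]] K by auto
  \<comment> \<open>\<open>Suc N\<close>, because the truncation at level 0 is the zero function and
    not 1 on (0, 1).\<close>
  have clamped: "?S (clamped_staircase (Suc N)) = prob (apart t) + (\<integral>\<omega>. ?E (Suc N) \<omega> \<partial>M)" for N
  proof -
    have "?S (clamped_staircase (Suc N)) = (\<Sum>l = 1..k. (-1) ^ (l + 1) * prob (apart t) +
        (-1) ^ (l + 1) * (\<integral>\<omega>. exit_pfaffian (clamped_staircase (Suc N)) (?I l) t \<omega> \<partial>M))"
      using surv(2)[of _ "Suc N"] by (intro sum.cong refl) (simp add: distrib_left)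
    also have "\<dots> = (\<Sum>l = 1..k. (-1) ^ (l + 1)) * prob (apart t) +
        (\<Sum>l = 1..k. (-1) ^ (l + 1) * (\<integral>\<omega>. exit_pfaffian (clamped_staircase (Suc N)) (?I l) t \<omega> \<partial>M))"
      by (simp only: sum.distrib sum_distrib_right)
    also have "(\<Sum>l = 1..k. (-1) ^ (l + 1) * (\<integral>\<omega>. exit_pfaffian (clamped_staircase (Suc N)) (?I l) t \<omega> \<partial>M)) =
        (\<integral>\<omega>. ?E (Suc N) \<omega> \<partial>M)"
    proof -
      have "integrable M (\<lambda>\<omega>. (-1) ^ (l + 1) * exit_pfaffian (clamped_staircase (Suc N)) (?I l) t \<omega>)"
        if "l \<in> {1..k}" for l
        using surv(1)[OF that, of "Suc N"] by simp
      then show ?thesis by (subst Bochner_Integration.integral_sum) simp_all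
    qed
    finally show ?thesis using alternating_sum_odd[OF \<open>odd k\<close>] by simp
  qed
  obtain C where C: "\<And>N d r. \<bar>d\<bar> \<le> 1 \<Longrightarrow> 0 \<le> r \<Longrightarrow> r \<le> t \<Longrightarrow> \<bar>gauss_avg (clamped_staircase N) d r\<bar> \<le> C"
    using gauss_avg_clamped_bounded by blast
  define c where "c l = \<bar>\<Sum>\<pi>\<in>pair_partitions (?I l). C ^ card \<pi>\<bar>" for l
  have bound: "\<bar>exit_pfaffian (clamped_staircase N) (?I l) t \<omega>\<bar> \<le> c l"
    if "\<forall>i\<in>K. B i 0 \<omega> = x i" for N l \<omega>
  proof (cases "\<omega> \<in> exits t")
    case True
    have "0 \<le> t - hit \<omega>" "t - hit \<omega> \<le> t"
      using hit_less[OF True] hit(1)[OF exitsD(2,3)[OF True]] by auto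
    moreover have "\<bar>B i (hit \<omega>) \<omega> - B j (hit \<omega>) \<omega>\<bar> \<le> 1" if "i \<in> ?I l" "j \<in> ?I l" "i < j" for i j
      using gap_exit[OF True \<open>\<forall>i\<in>K. B i 0 \<omega> = x i\<close>, of i j] that K by auto
    ultimately have "\<bar>pfaffian (?I l) (\<lambda>i j. gauss_avg (clamped_staircase N) (B i (hit \<omega>) \<omega> - B j (hit \<omega>) \<omega>) (t - hit \<omega>))\<bar>
        \<le> (\<Sum>\<pi>\<in>pair_partitions (?I l). C ^ card \<pi>)"
      by (intro abs_pfaffian_le C) auto
    then show ?thesis using True by (simp add: exit_pfaffian_def c_def)
  qed (simp add: exit_pfaffian_def c_def)
  have lim_0: "(\<lambda>N. ?E (Suc N) \<omega>) \<longlonglongrightarrow> 0" if start: "\<forall>i\<in>K. B i 0 \<omega> = x i" for \<omega>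
  proof (cases "\<omega> \<in> exits t")
    case True
    define r where "r = t - hit \<omega>"
    have "0 < r" using hit_less[OF True] by (simp add: r_def)
    define y where "y i = B i (hit \<omega>) \<omega>" for i
    \<comment> \<open>Index 0 is the border, with a row of ones and a column of -1; it is free since
      the particles are numbered from 1.\<close>
    define A where "A i j = (if i = 0 then if j = 0 then 0 else 1 else if j = 0 then - 1
      else gauss_avg staircase (y i - y j) r)" for i j :: nat
    have skew: "A i j = - A j i" for i j
      using gauss_avg_odd[OF borel_measurable_waves(2) staircase_odd \<open>0 < r\<close>, of "y j - y i"]
      by (simp add: A_def)
    obtain i j where ij: "i \<in> K" "j \<in> K" "i < j" and D: "y i - y j = 0 \<or> y i - y j = 1"
      using exit_pairE[OF True start] unfolding y_def by metis
    have pos: "i \<noteq> 0" "j \<noteq> 0" using ij K by auto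
    \<comment> \<open>At gap 0 the rows agree and \<beta> = 0; at gap 1 row \<open>i\<close> exceeds
      row \<open>j\<close> by 2 in every particle column, which is twice the border row. In the
      border column both rows have -1 and \<open>A 0 0 = 0\<close>, so the relation holds there as
      well.\<close>
    have "\<exists>\<beta>. \<forall>z. A i z = 1 * A j z + \<beta> * A 0 z"
      using D
    proof
      assume "y i - y j = 0"
      then have "A i z = 1 * A j z + 0 * A 0 z" for z using pos by (simp add: A_def)
      then show ?thesis by blast
    next
      assume "y i - y j = 1"
      then have "y i = y j + 1" by simp
      then have "A i z = 1 * A j z + 2 * A 0 z" for z
        using gauss_avg_shift[OF integrable_staircase staircase_shift, of "y j - y z" r] pos
        by (simp add: A_def add_diff_eq diff_add_eq)
      then show ?thesis by blast
    qed
    then obtain \<beta> where row: "\<And>z. A i z = 1 * A j z + \<beta> * A 0 z" by blast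
    have mem: "i \<in> {0..k}" "j \<in> {0..k}" "0 \<in> {0..k}" and ne: "i \<noteq> j" using ij K by auto
    have "pfaffian {0..k} A = 0"
      by (rule pfaffian_dependent_row[OF finite_atLeastAtMost mem ne pos(1) skew row])
    moreover have "pfaffian {0..k} A =
        (\<Sum>l = 1..k. (-1) ^ (l + 1) * pfaffian (?I l) (\<lambda>i j. gauss_avg staircase (y i - y j) r))"
      by (rule bordered_pfaffian) (auto simp: A_def)
    ultimately have zero: "(\<Sum>l = 1..k. (-1) ^ (l + 1) * pfaffian (?I l) (\<lambda>i j. gauss_avg staircase (y i - y j) r)) = 0"
      by simp
    have "(\<lambda>N. \<Sum>l = 1..k. (-1) ^ (l + 1) *
        pfaffian (?I l) (\<lambda>i j. gauss_avg (clamped_staircase (Suc N)) (y i - y j) r))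
      \<longlonglongrightarrow> (\<Sum>l = 1..k. (-1) ^ (l + 1) * pfaffian (?I l) (\<lambda>i j. gauss_avg staircase (y i - y j) r))"
      by (intro tendsto_sum tendsto_mult tendsto_const tendsto_pfaffian LIMSEQ_Suc[OF tendsto_gauss_avg_clamped])
    then show ?thesis unfolding zero using True by (simp add: exit_pfaffian_def y_def r_def)
  qed (simp add: exit_pfaffian_def)
  have "(\<lambda>N. \<integral>\<omega>. ?E (Suc N) \<omega> \<partial>M) \<longlonglongrightarrow> (\<integral>\<omega>. 0 \<partial>M)"
  proof (rule integral_dominated_convergence[where w = "\<lambda>_. \<Sum>l = 1..k. c l"])
    show "?E (Suc N) \<in> borel_measurable M" for N
      using surv(1)[of _ "Suc N"] by (intro borel_measurable_sum borel_measurable_times borel_measurable_const) auto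
    show "AE \<omega> in M. (\<lambda>N. ?E (Suc N) \<omega>) \<longlonglongrightarrow> 0"
      using AE_start_all by eventually_elim (rule lim_0)
    show "AE \<omega> in M. norm (?E (Suc N) \<omega>) \<le> (\<Sum>l = 1..k. c l)" for N
      using AE_start_all
    proof eventually_elim
      case (elim \<omega>)
      show ?case
        unfolding real_norm_def
        by (rule order_trans[OF sum_abs]) (use bound[OF elim] in \<open>auto simp: abs_mult power_abs intro!: sum_mono\<close>)
    qed
  qed simp_all
  then have "(\<lambda>N. prob (apart t) + (\<integral>\<omega>. ?E (Suc N) \<omega> \<partial>M)) \<longlonglongrightarrow> prob (apart t) + 0"
    by (intro tendsto_add tendsto_const) simp
  moreover have "(\<lambda>N. ?S (clamped_staircase (Suc N))) \<longlonglongrightarrow> ?S staircase"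
    by (intro tendsto_sum tendsto_mult tendsto_const tendsto_pfaffian LIMSEQ_Suc[OF tendsto_gauss_avg_clamped])
  ultimately show ?thesis unfolding clamped using LIMSEQ_unique by fastforce
qed

text \<open>With two particles the exit has gap 0 or 1. Gap 0 is a meeting on the line at the same
  moment, so the circle does not come first; at gap 1 the particles meet on the circle while still
  distinct on the line.\<close>

lemma AE_winding_iff:
  assumes "0 < t" and K: "K = {i, j}" and "i < j"
  shows "AE \<omega> in M. (meeting_time (circle_proj B) i j \<omega> \<le> ereal t
      \<and> meeting_time (circle_proj B) i j \<omega> < meeting_time B i j \<omega>)
    \<longleftrightarrow> \<omega> \<in> exits t \<and> B i (hit \<omega>) \<omega> - B j (hit \<omega>) \<omega> = 1"
  using AE_not_apart_iff_exits[OF \<open>0 < t\<close>] AE_start_all AE_space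
proof eventually_elim
  case (elim \<omega>)
  have ij: "i \<in> K" "j \<in> K" using K by auto
  let ?c = "meeting_time (circle_proj B) i j \<omega>" and ?m = "meeting_time B i j \<omega>"
  have apart: "\<omega> \<in> apart r \<longleftrightarrow> ?c > ereal r" for r
    using apart_iff_meeting[OF elim(3)] K \<open>i < j\<close> by auto
  show ?case
  proof (cases "\<omega> \<in> exits t")
    case False
    then show ?thesis using elim(1) apart by auto
  next
    case True
    note e = exitsD(2,3)[OF True]
    have c_t: "?c \<le> ereal t" using apart e(2) by (simp add: not_less)
    have c_hit: "?c \<le> ereal (hit \<omega>)"
      using apart_iff_less_hit[OF e, of "hit \<omega>"] hit(1)[OF e] apart by (simp add: not_less)
    have m_iff: "?m > ereal r \<longleftrightarrow> (\<forall>u\<in>{0..r}. B i u \<omega> \<noteq> B j u \<omega>)" for r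
      by (rule meeting_time_greater_iff[where X = B, OF closed_meetings(1)[OF elim(3) ij]])
    have D: "B i (hit \<omega>) \<omega> - B j (hit \<omega>) \<omega> = 0 \<or> B i (hit \<omega>) \<omega> - B j (hit \<omega>) \<omega> = 1"
      using exit_pairE[OF True elim(2)] K \<open>i < j\<close> by (metis insertE less_asym less_irrefl singletonD)
    have "?c < ?m \<longleftrightarrow> B i (hit \<omega>) \<omega> - B j (hit \<omega>) \<omega> = 1"
    proof
      assume "B i (hit \<omega>) \<omega> - B j (hit \<omega>) \<omega> = 1"
      moreover have "B i u \<omega> \<noteq> B j u \<omega>" if "0 \<le> u" "u < hit \<omega>" for u
        using apart_iff_less_hit[OF e that(1)] that apartD[of \<omega> u u i j] ij \<open>i < j\<close> by auto
      ultimately have "B i u \<omega> \<noteq> B j u \<omega>" if "u \<in> {0..hit \<omega>}" for u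
        using that by (cases "u = hit \<omega>") auto
      then have "?m > ereal (hit \<omega>)" using m_iff by blast
      then show "?c < ?m" using c_hit by (rule le_less_trans[rotated])
    next
      assume lt: "?c < ?m"
      show "B i (hit \<omega>) \<omega> - B j (hit \<omega>) \<omega> = 1"
      proof (rule ccontr)
        assume "B i (hit \<omega>) \<omega> - B j (hit \<omega>) \<omega> \<noteq> 1"
        then have "B i (hit \<omega>) \<omega> = B j (hit \<omega>) \<omega>" using D by simp
        moreover have "hit \<omega> \<in> {0..hit \<omega>}" using hit(1)[OF e] by simp
        ultimately have "?m \<le> ereal (hit \<omega>)" using m_iff[of "hit \<omega>"] by (auto simp: not_less[symmetric])
        \<comment> \<open>A real time strictly between the two meeting times would lie before
          \<open>hit\<close>, hence before any meeting on the circle, against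
          \<open>?c < ereal q\<close>.\<close>
        moreover obtain q where q: "?c < ereal q" "ereal q < ?m" using ereal_dense2[OF lt] by blast
        ultimately have "ereal q < ereal (hit \<omega>)" by (metis less_le_trans)
        moreover have "0 \<le> q"
          using le_less_trans[OF meeting_time_nonneg q(1)] by simp
        ultimately have "\<omega> \<in> apart q" using apart_iff_less_hit[OF e] by simp
        then show False using apart q(1) by auto
      qed
    qed
    then show ?thesis using True c_t by blast
  qed
qed

text \<open>A strict inequality between two times is witnessed by a level \<open>q\<close> that
  separates them, and countably many levels suffice; for fixed \<open>q\<close> both conditions are
  expressed through positivity of continuous paths.\<close>

lemma sets_winding:
  assumes "0 \<le> t" and K: "K = {i, j}" and "i < j"
  shows "{\<omega>\<in>space M. meeting_time (circle_proj B) i j \<omega> \<le> ereal t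
    \<and> meeting_time (circle_proj B) i j \<omega> < meeting_time B i j \<omega>} \<in> sets M" (is "?E \<in> _")
proof -
  let ?c = "\<lambda>\<omega>. meeting_time (circle_proj B) i j \<omega>" and ?m = "\<lambda>\<omega>. meeting_time B i j \<omega>"
  have ij: "i \<in> K" "j \<in> K" using K by auto
  have apart: "\<omega> \<in> apart r \<longleftrightarrow> ?c \<omega> > ereal r" if "\<omega> \<in> space M" for r \<omega>
    using apart_iff_meeting[OF that] K \<open>i < j\<close> by auto
  \<comment> \<open>The level \<open>t\<close> serves when the meeting on the line comes after
    \<open>t\<close>; otherwise a rational level lies strictly between the two times.\<close>
  let ?Q = "insert t (\<rat> \<inter> {0..t})"
  let ?F = "\<lambda>q. {\<omega>\<in>space M. \<forall>u\<in>{0..q}. 0 < \<bar>B i u \<omega> - B j u \<omega>\<bar>}"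
  have F: "?F q = {\<omega>\<in>space M. ?m \<omega> > ereal q}" for q
    using meeting_time_greater_iff[where X = B, OF closed_meetings(1)[OF _ ij]] by auto
  have sets_F: "?F q \<in> sets M" for q
    using measurable_B[OF ij(1)] measurable_B[OF ij(2)]
    by (intro sets_positive_on continuous_intros continuous_B ij) auto
  have "?E = (\<Union>q\<in>?Q. (space M - apart q) \<inter> ?F q)"
  proof (intro equalityI subsetI)
    fix \<omega> assume E: "\<omega> \<in> ?E"
    have "\<exists>q\<in>?Q. ?c \<omega> \<le> ereal q \<and> ereal q < ?m \<omega>"
    proof (cases "ereal t < ?m \<omega>")
      case True
      then show ?thesis using E by auto
    next
      case False
      obtain q :: rat where q: "?c \<omega> < ereal (of_rat q)" "ereal (of_rat q) < ?m \<omega>"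
        using ereal_dense3[of "?c \<omega>" "?m \<omega>"] E by auto
      have "ereal (of_rat q) < ereal t" using q(2) False by (metis less_le_trans not_less)
      moreover have "0 \<le> (of_rat q :: real)" using le_less_trans[OF meeting_time_nonneg q(1)] by simp
      ultimately have "of_rat q \<in> ?Q" by simp
      then show ?thesis using q by (intro bexI[of _ "of_rat q"]) auto
    qed
    then show "\<omega> \<in> (\<Union>q\<in>?Q. (space M - apart q) \<inter> ?F q)"
      unfolding F using E apart by (auto simp: not_less)
  next
    fix \<omega> assume "\<omega> \<in> (\<Union>q\<in>?Q. (space M - apart q) \<inter> ?F q)"
    then obtain q where q: "q \<in> ?Q" "\<omega> \<in> space M" "\<omega> \<notin> apart q" "ereal q < ?m \<omega>"
      unfolding F by blast
    then have "?c \<omega> \<le> ereal q" "q \<le> t" using apart by (auto simp: not_less)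
    then have "?c \<omega> \<le> ereal t" "?c \<omega> < ?m \<omega>" using q(4) order_trans[of "?c \<omega>" "ereal q" "ereal t"] by auto
    then show "\<omega> \<in> ?E" using q(2) by simp
  qed
  moreover have "countable ?Q" using countable_rat by blast
  ultimately show ?thesis using sets_apart sets_F by (simp only:) (intro sets.countable_UN'' sets.Int sets.compl_sets)
qed

text \<open>The exit term remains here. The smoothed staircase is 0 at gap 0 by oddness and 2 at gap
  1 by the shift rule, so the exit contributes 2 on the winding event, which is the factor 2 in
  \<open>q_entry\<close>.\<close>

lemma gauss_avg_staircase_pair:
  assumes "0 < t" and K: "K = {i, j}" and "i < j"
  shows "gauss_avg staircase (x i - x j) t = prob (apart t) +
    2 * prob {\<omega>\<in>space M. meeting_time (circle_proj B) i j \<omega> \<le> ereal t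
      \<and> meeting_time (circle_proj B) i j \<omega> < meeting_time B i j \<omega>}" (is "_ = _ + 2 * prob ?E")
proof -
  have [measurable]: "?E \<in> sets M" using assms by (intro sets_winding) auto
  have ij: "i \<in> K" "j \<in> K" using K by auto
  let ?P = "\<lambda>N. exit_pfaffian (clamped_staircase (Suc N)) {i, j} t"
  have "even (card {i, j})" and "{i, j} \<subseteq> K" using \<open>i < j\<close> K by auto
  note surv = survival_pfaffian[OF \<open>0 < t\<close> this(2,1) borel_measurable_waves(3) abs_clamped_staircase_le
      isCont_clamped_staircase clamped_staircase_unit[OF _ _ zero_less_Suc], unfolded pfaffian_pair[OF \<open>i < j\<close>]]
  have P: "?P N \<omega> = gauss_avg (clamped_staircase (Suc N)) (B i (hit \<omega>) \<omega> - B j (hit \<omega>) \<omega>) (t - hit \<omega>) * indicator (exits t) \<omega>" for N \<omega>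
    by (simp add: exit_pfaffian_def pfaffian_pair[OF \<open>i < j\<close>])
  obtain C where C: "\<And>N d r. \<bar>d\<bar> \<le> 1 \<Longrightarrow> 0 \<le> r \<Longrightarrow> r \<le> t \<Longrightarrow> \<bar>gauss_avg (clamped_staircase N) d r\<bar> \<le> C"
    using gauss_avg_clamped_bounded by blast
  have zero: "gauss_avg staircase 0 r = 0" if "0 < r" for r
    using gauss_avg_odd[OF borel_measurable_waves(2) staircase_odd that, of 0] by simp
  have one: "gauss_avg staircase 1 r = 2" if "0 < r" for r
    using gauss_avg_shift[OF integrable_staircase staircase_shift, of 0 r] zero[OF that] by simp
  have "(\<lambda>N. \<integral>\<omega>. ?P N \<omega> \<partial>M) \<longlonglongrightarrow> (\<integral>\<omega>. 2 * indicator ?E \<omega> \<partial>M)"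
  proof (rule integral_dominated_convergence[where w = "\<lambda>_. \<bar>C\<bar>"])
    show "?P N \<in> borel_measurable M" for N using surv(1) by auto
    show "AE \<omega> in M. (\<lambda>N. ?P N \<omega>) \<longlonglongrightarrow> 2 * indicator ?E \<omega>"
      using AE_winding_iff[OF assms] AE_start_all AE_space
    proof eventually_elim
      case (elim \<omega>)
      show ?case
      proof (cases "\<omega> \<in> exits t")
        case True
        define d where "d = B i (hit \<omega>) \<omega> - B j (hit \<omega>) \<omega>"
        have "d = 0 \<or> d = 1"
          using exit_pairE[OF True elim(2)] K \<open>i < j\<close> unfolding d_def by (metis insertE less_asym less_irrefl singletonD)
        then have "gauss_avg staircase d (t - hit \<omega>) = 2 * indicator ?E \<omega>"
          using elim(1,3) True zero[of "t - hit \<omega>"] one[of "t - hit \<omega>"] hit_less[OF True]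
          by (auto simp: indicator_def d_def)
        moreover have "(\<lambda>N. gauss_avg (clamped_staircase (Suc N)) d (t - hit \<omega>)) \<longlonglongrightarrow> gauss_avg staircase d (t - hit \<omega>)"
          by (rule LIMSEQ_Suc[OF tendsto_gauss_avg_clamped])
        ultimately show ?thesis using True by (simp add: P d_def)
      next
        case False
        then show ?thesis using elim(1) by (simp add: P)
      qed
    qed
    show "AE \<omega> in M. norm (?P N \<omega>) \<le> \<bar>C\<bar>" for N
      using AE_start_all
    proof eventually_elim
      case (elim \<omega>)
      show ?case
      proof (cases "\<omega> \<in> exits t")
        case True
        have "\<bar>B i (hit \<omega>) \<omega> - B j (hit \<omega>) \<omega>\<bar> \<le> 1" "0 \<le> t - hit \<omega>" "t - hit \<omega> \<le> t"
          using gap_exit[OF True elim ij \<open>i < j\<close>] hit_less[OF True] hit(1)[OF exitsD(2,3)[OF True]] by auto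
        from C[OF this, of "Suc N"] show ?thesis using True by (simp add: P)
      qed (simp add: P)
    qed
  qed auto
  then have "(\<lambda>N. prob (apart t) + (\<integral>\<omega>. ?P N \<omega> \<partial>M)) \<longlonglongrightarrow> prob (apart t) + (\<integral>\<omega>. 2 * indicator ?E \<omega> \<partial>M)"
    by (intro tendsto_add tendsto_const)
  moreover have "prob (apart t) + (\<integral>\<omega>. ?P N \<omega> \<partial>M) = gauss_avg (clamped_staircase (Suc N)) (x i - x j) t" for N
    using surv(2) by simp
  ultimately have "(\<lambda>N. gauss_avg (clamped_staircase (Suc N)) (x i - x j) t) \<longlonglongrightarrow> prob (apart t) + (\<integral>\<omega>. 2 * indicator ?E \<omega> \<partial>M)"
    by simp
  then have "gauss_avg staircase (x i - x j) t = prob (apart t) + (\<integral>\<omega>. 2 * indicator ?E \<omega> \<partial>M)"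
    by (rule LIMSEQ_unique[OF LIMSEQ_Suc[OF tendsto_gauss_avg_clamped]])
  also have "(\<integral>\<omega>. 2 * indicator ?E \<omega> \<partial>M) = 2 * prob ?E"
    using sets.Int_space_eq2[OF \<open>?E \<in> sets M\<close>] by simp
  finally show ?thesis .
qed

end

text \<open>Makes the results available for a single pair {i, j}, whose survival and winding
  probabilities form the matrix entries.\<close>

lemma (in circular_family) restrict_family:
  assumes "L \<subseteq> K"
  shows "circular_family M L x B"
proof
  show "finite L" using assms finite_K by (rule finite_subset)
  show "brownian_motion M (x n) (B n)" if "n \<in> L" for n using that assms brownian by auto
  show "independent_processes M L B"
    using independent assms unfolding independent_processes_def by (rule indep_vars_subset)
  show "0 < x i - x j \<and> x i - x j < 1" if "i \<in> L" "j \<in> L" "i < j" for i j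
    using that assms start_gap by auto
qed

section \<open>Matrix entries as Gaussian averages\<close>

lemma (in circular_family) prob_apart_0: "prob (apart 0) = 1"
  using AE_apart_0[OF separation_start] prob_eq_1[OF sets_apart] by simp

lemma (in circular_family) p_entry_eq:
  assumes "0 \<le> t" "i \<in> K" "j \<in> K" "i < j"
  shows "p_entry M B t i j = gauss_avg square_wave (x i - x j) t"
proof -
  interpret P: circular_family M "{i, j}" x B using assms by (intro restrict_family) auto
  have "P.apart t = {\<omega>\<in>space M. meeting_time (circle_proj B) i j \<omega> > ereal t}"
    using P.apart_iff_meeting[of _ t] \<open>i < j\<close> by (auto simp: P.apart_def)
  then have p: "p_entry M B t i j = prob (P.apart t)" using \<open>i < j\<close> by (simp add: p_entry_def skew_def)
  show ?thesis
  proof (cases "t = 0")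
    \<comment> \<open>\<open>survival_even\<close> needs a positive time; at time 0 both sides are
      1.\<close>
    case True
    then show ?thesis
      using p P.prob_apart_0 start_gap[OF assms(2-4)] by (simp add: square_wave_unit)
  next
    case False
    then show ?thesis
      using p P.survival_even[of t] assms by (simp add: pfaffian_pair)
  qed
qed

lemma (in circular_family) q_entry_eq:
  assumes "0 \<le> t" "i \<in> K" "j \<in> K" "i < j"
  shows "q_entry M B t i j = gauss_avg staircase (x i - x j) t"
proof -
  interpret P: circular_family M "{i, j}" x B using assms by (intro restrict_family) auto
  let ?E = "{\<omega>\<in>space M. meeting_time (circle_proj B) i j \<omega> \<le> ereal t
    \<and> meeting_time (circle_proj B) i j \<omega> < meeting_time B i j \<omega>}"
  have apart: "P.apart t = {\<omega>\<in>space M. meeting_time (circle_proj B) i j \<omega> > ereal t}"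
    using P.apart_iff_meeting[of _ t] \<open>i < j\<close> by (auto simp: P.apart_def)
  then have q: "q_entry M B t i j = prob (P.apart t) + 2 * prob ?E"
    using \<open>i < j\<close> by (simp add: q_entry_def skew_def)
  show ?thesis
  proof (cases "t = 0")
    case True
    \<comment> \<open>Almost surely the pair has not met at time 0, so the winding event is null and
      the entry is 1.\<close>
    have "AE \<omega> in M. \<omega> \<notin> ?E"
      using P.AE_apart_0[OF P.separation_start] by (rule eventually_mono) (use apart True in auto)
    then have "prob ?E = 0"
      using P.sets_winding[OF \<open>0 \<le> t\<close> refl \<open>i < j\<close>] by (subst prob_eq_0)
    then show ?thesis
      using q True P.prob_apart_0 start_gap[OF assms(2-4)] by (simp add: staircase_unit)
  next
    case False
    then show ?thesis
      using q P.gauss_avg_staircase_pair[OF _ refl \<open>i < j\<close>, of t] \<open>0 \<le> t\<close> by simp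
  qed
qed

theorem proposition1:
  fixes M :: "'a measure" and B :: "nat \<Rightarrow> real \<Rightarrow> 'a \<Rightarrow> real"
    and k :: nat and x :: "nat \<Rightarrow> real" and t :: real
  assumes "k \<ge> 2"
    and "1 + x k > x 1"
    and "\<And>i j. 1 \<le> i \<Longrightarrow> i < j \<Longrightarrow> j \<le> k \<Longrightarrow> x i > x j"
    and "prob_space M"
    and "\<And>n. n \<in> {1..k} \<Longrightarrow> brownian_motion M (x n) (B n)"
    and "independent_processes M {1..k} B"
    and "t \<ge> 0"
  shows "(even k \<longrightarrow>
            \<P>(\<omega> in M. first_meeting_time k (circle_proj B) \<omega> > ereal t)
              = pfaffian {1..k} (p_entry M B t)) \<and>
         (odd k \<longrightarrow>
            \<P>(\<omega> in M. first_meeting_time k (circle_proj B) \<omega> > ereal t)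
              = (\<Sum>l = 1..k. (-1) ^ (l + 1) * pfaffian ({1..k} - {l}) (q_entry M B t)))"
proof -
  interpret prob_space M by fact
  interpret F: circular_family M "{1..k}" x B
  proof
    fix i j assume ij: "i \<in> {1..k}" "j \<in> {1..k}" "i < j"
    \<comment> \<open>Every gap is at most \<open>x 1 - x k\<close>, which is below 1.\<close>
    have "x i \<le> x 1" using ij assms(3)[of 1 i] by (cases "i = 1") auto
    moreover have "x k \<le> x j" using ij assms(3)[of j k] by (cases "j = k") auto
    ultimately show "0 < x i - x j \<and> x i - x j < 1"
      using ij assms(2) assms(3)[of i j] by auto
  qed (use assms in auto)
  have first: "first_meeting_time k (circle_proj B) \<omega> > ereal t \<longleftrightarrow>
      (\<forall>i\<in>{1..k}. \<forall>j\<in>{1..k}. i < j \<longrightarrow> meeting_time (circle_proj B) i j \<omega> > ereal t)" for \<omega>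
  proof -
    let ?T = "{meeting_time (circle_proj B) i j \<omega> | i j. 1 \<le> i \<and> i < j \<and> j \<le> k}"
    have "?T \<subseteq> (\<lambda>(i, j). meeting_time (circle_proj B) i j \<omega>) ` ({1..k} \<times> {1..k})" by force
    then have "finite ?T" by (rule finite_subset) auto
    moreover have "meeting_time (circle_proj B) 1 2 \<omega> \<in> ?T" using assms(1) by force
    then have "?T \<noteq> {}" by blast
    ultimately have "first_meeting_time k (circle_proj B) \<omega> > ereal t \<longleftrightarrow> (\<forall>a\<in>?T. a > ereal t)"
      unfolding first_meeting_time_def by (rule Min_gr_iff)
    also have "\<dots> \<longleftrightarrow> (\<forall>i\<in>{1..k}. \<forall>j\<in>{1..k}. i < j \<longrightarrow> meeting_time (circle_proj B) i j \<omega> > ereal t)"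
      by fastforce
    finally show ?thesis .
  qed
  have survival: "\<P>(\<omega> in M. first_meeting_time k (circle_proj B) \<omega> > ereal t) = prob (F.apart t)"
  proof -
    have "F.apart t \<subseteq> space M" unfolding F.apart_def by blast
    then have "{\<omega>\<in>space M. first_meeting_time k (circle_proj B) \<omega> > ereal t} = F.apart t"
      unfolding first using F.apart_iff_meeting[of _ t] by blast
    then show ?thesis by simp
  qed
  have p: "pfaffian {1..k} (p_entry M B t) = pfaffian {1..k} (\<lambda>i j. gauss_avg square_wave (x i - x j) t)"
    using \<open>t \<ge> 0\<close> by (intro pfaffian_cong F.p_entry_eq)
  have q: "pfaffian ({1..k} - {l}) (q_entry M B t) =
      pfaffian ({1..k} - {l}) (\<lambda>i j. gauss_avg staircase (x i - x j) t)" for l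
    using \<open>t \<ge> 0\<close> by (intro pfaffian_cong F.q_entry_eq) auto
  show ?thesis
  proof (cases "t = 0")
    case True
    \<comment> \<open>At time 0 the averages reduce to \<theta> at the starting gaps, all in (0, 1),
      so every entry above the diagonal is 1; the heat flow argument itself requires a positive
      time.\<close>
    have one: "\<theta> (x i - x j) = 1" if "\<And>z. 0 < z \<Longrightarrow> z < 1 \<Longrightarrow> \<theta> z = 1"
      "i \<in> {1..k}" "j \<in> {1..k}" "i < j" for i j and \<theta> :: "real \<Rightarrow> real"
      using that F.start_gap by blast
    have even_k: "pfaffian {1..k} (\<lambda>i j. gauss_avg square_wave (x i - x j) t) = 1" if "even k"
    proof -
      have "pfaffian {1..k} (\<lambda>i j. gauss_avg square_wave (x i - x j) t) = pfaffian {1..k} (\<lambda>_ _. 1)"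
        unfolding True gauss_avg_zero by (intro pfaffian_cong one[of square_wave] square_wave_unit)
      then show ?thesis using pfaffian_one[of "{1..k}"] that by simp
    qed
    have odd_k: "pfaffian ({1..k} - {l}) (\<lambda>i j. gauss_avg staircase (x i - x j) t) = 1"
      if "odd k" "l \<in> {1..k}" for l
    proof -
      have "pfaffian ({1..k} - {l}) (\<lambda>i j. gauss_avg staircase (x i - x j) t) = pfaffian ({1..k} - {l}) (\<lambda>_ _. 1)"
        unfolding True gauss_avg_zero by (intro pfaffian_cong one[of staircase] staircase_unit) auto
      then show ?thesis using pfaffian_one[of "{1..k} - {l}"] that by (simp add: card_Diff_singleton)
    qed
    have "(\<Sum>l = 1..k. (-1) ^ (l + 1) * pfaffian ({1..k} - {l}) (\<lambda>i j. gauss_avg staircase (x i - x j) t)) = 1"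
      if "odd k"
      using odd_k[OF that] alternating_sum_odd[OF that] by simp
    then show ?thesis
      using even_k F.prob_apart_0 True unfolding survival p q by simp
  next
    case False
    then have "0 < t" using \<open>t \<ge> 0\<close> by simp
    then show ?thesis
      unfolding survival p q using F.survival_even F.survival_odd by simp
  qed
qed

end
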